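(* Let $m\in\mathbb{C}$. For $(x,y)\in\mathbb{H}^+$ and $(\xi,\eta)\in\mathbb{H}^+$ with $(x,y)\neq(\xi,\eta)$, put, if $\operatorname{Re} m\ge 1$, $$E_m(x,y,\xi,\eta)=-\frac{\xi^m}{2\pi}\int_0^{\pi}\frac{\sin^{m-1}\theta\,d\theta}{\left[(x-\xi)^2+4x\xi\sin^2\left(\frac{\theta}{2}\right)+(y-\eta)^2\right]^{m/2}},$$ and, if $\operatorname{Re} m<1$, $$E_m(x,y,\xi,\eta)=\left(\frac{\xi}{x}\right)^{m-1}E_{2-m}(x,y,\xi,\eta)=-\frac{\xi x^{1-m}}{2\pi}\int_0^{\pi}\frac{\sin^{1-m}\theta\,d\theta}{\left[(x-\xi)^2+4x\xi\sin^2\left(\frac{\theta}{2}\right)+(y-\eta)^2\right]^{1-\frac m2}}.$$ Then for every fixed $(x,y)\in\mathbb{H}^+$, $E_m(x,y,\cdot,\cdot)$ is a fundamental solution on $\mathbb{H}^+$ of $L^\star_{m,\xi,\eta}$ at $(x,y)$, i.e. in the sense of distributions on $\mathbb{H}^+$ (in the variables $(\xi,\eta)$) $$L^\star_{m,\xi,\eta}E_m(x,y,\xi,\eta)=\delta_{(x,y)}(\xi,\eta).$$ Moreover, for every fixed $(\xi,\eta)\in\mathbb{H}^+$, $E_m(\cdot,\cdot,\xi,\eta)$ is a fundamental solution on $\mathbb{H}^+$ of $L_{m,x,y}$ at $(\xi,\eta)$, i.e. in the sense of distributions on $\mathbb{H}^+$ (in the variables $(x,y)$) $$L_{m,x,y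}E_m(x,y,\xi,\eta)=\delta_{(\xi,\eta)}(x,y).$$
   Context: $\mathbb{H}^+=\{(x,y)\in\mathbb{R}^2: x>0\}$. Functions are complex valued; complex powers of positive reals are $t^{s}=\exp(s\ln t)$. For $m\in\mathbb{C}$ the Weinstein operator is $L_mu=\Delta u+\frac{m}{x}\frac{\partial u}{\partial x}$ on $\mathbb{H}^+$, and its adjoint in the sense of distributions is $L_m^\star u=\Delta u-\frac{\partial}{\partial x}\left(\frac{m u}{x}\right)$. Subscripts indicate the variables in which the operator acts: $L_{m,x,y}$ acts in $(x,y)$ and $L^\star_{m,\xi,\eta}$ acts in $(\xi,\eta)$ (with $\xi$ playing the role of $x$). $\delta_{(x,y)}$ is the Dirac mass at $(x,y)$. A fundamental solution of an operator $L$ on $\mathbb{H}^+$ at a point $a\in\mathbb{H}^+$ is a distribution $T$ on $\mathbb{H}^+$ with $LT=\delta_a$. *)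

theory Defs
  imports "HOL-Analysis.Analysis"
begin

section \<open>Test functions and distributions on open subsets of the plane\<close>

definition pd_x :: "(real \<times> real \<Rightarrow> complex) \<Rightarrow> real \<times> real \<Rightarrow> complex" where
  "pd_x f p = vector_derivative (\<lambda>t. f (t, snd p)) (at (fst p))"

definition pd_y :: "(real \<times> real \<Rightarrow> complex) \<Rightarrow> real \<times> real \<Rightarrow> complex" where
  "pd_y f p = vector_derivative (\<lambda>t. f (fst p, t)) (at (snd p))"

primrec C_k :: "nat \<Rightarrow> (real \<times> real \<Rightarrow> complex) \<Rightarrow> bool" where
  "C_k 0 f \<longleftrightarrow> continuous_on UNIV f"
| "C_k (Suc k) f \<longleftrightarrow> f differentiable_on UNIV \<and> C_k k (pd_x f) \<and> C_k k (pd_y f)"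

definition smooth :: "(real \<times> real \<Rightarrow> complex) \<Rightarrow> bool" where
  "smooth f \<longleftrightarrow> (\<forall>k. C_k k f)"

definition supp :: "(real \<times> real \<Rightarrow> complex) \<Rightarrow> (real \<times> real) set" where
  "supp f = closure {p. f p \<noteq> 0}"

text \<open>Elements of \<open>C\<^sub>c\<^sup>\<infinity>(U)\<close> are represented by their extension by zero to the whole plane.\<close>

definition test_functions :: "(real \<times> real) set \<Rightarrow> (real \<times> real \<Rightarrow> complex) set" where
  "test_functions U = {\<phi>. smooth \<phi> \<and> compact (supp \<phi>) \<and> supp \<phi> \<subseteq> U}"

text \<open>A distribution on \<open>U\<close> is represented by a total functional of which only the values on
  \<open>test_functions U\<close> are meaningful; the last clause is the usual seminorm form of continuity.\<close>

type_synonym functional = "(real \<times> real \<Rightarrow> complex) \<Rightarrow> complex"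

definition is_distribution :: "(real \<times> real) set \<Rightarrow> functional \<Rightarrow> bool" where
  "is_distribution U T \<longleftrightarrow>
     (\<forall>\<phi>\<in>test_functions U. \<forall>\<psi>\<in>test_functions U. T (\<lambda>p. \<phi> p + \<psi> p) = T \<phi> + T \<psi>) \<and>
     (\<forall>\<phi>\<in>test_functions U. \<forall>c. T (\<lambda>p. c * \<phi> p) = c * T \<phi>) \<and>
     (\<forall>K. compact K \<and> K \<subseteq> U \<longrightarrow>
        (\<exists>N C. \<forall>\<phi>\<in>test_functions U. supp \<phi> \<subseteq> K \<longrightarrow>
           cmod (T \<phi>) \<le> C * (\<Sum>i\<le>N. \<Sum>j\<le>N. SUP p. cmod ((pd_x ^^ i) ((pd_y ^^ j) \<phi>) p))))"

definition dist_eq :: "(real \<times> real) set \<Rightarrow> functional \<Rightarrow> functional \<Rightarrow> bool" where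
  "dist_eq U S T \<longleftrightarrow> (\<forall>\<phi>\<in>test_functions U. S \<phi> = T \<phi>)"

definition dirac :: "real \<times> real \<Rightarrow> functional" where
  "dirac a \<phi> = \<phi> a"

definition dist_x :: "functional \<Rightarrow> functional" where
  "dist_x T \<phi> = - T (pd_x \<phi>)"

definition dist_y :: "functional \<Rightarrow> functional" where
  "dist_y T \<phi> = - T (pd_y \<phi>)"

definition dist_mult :: "(real \<times> real \<Rightarrow> complex) \<Rightarrow> functional \<Rightarrow> functional" where
  "dist_mult a T \<phi> = T (\<lambda>p. a p * \<phi> p)"

definition dist_laplacian :: "functional \<Rightarrow> functional" where
  "dist_laplacian T \<phi> = dist_x (dist_x T) \<phi> + dist_y (dist_y T) \<phi>"

definition locally_integrable :: "(real \<times> real) set \<Rightarrow> (real \<times> real \<Rightarrow> complex) \<Rightarrow> bool" where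
  "locally_integrable U f \<longleftrightarrow> (\<forall>K. compact K \<and> K \<subseteq> U \<longrightarrow> f absolutely_integrable_on K)"

definition dist_of :: "(real \<times> real) set \<Rightarrow> (real \<times> real \<Rightarrow> complex) \<Rightarrow> functional" where
  "dist_of U f \<phi> = (LINT p:U|lebesgue. f p * \<phi> p)"

definition fundamental_solution ::
    "(real \<times> real) set \<Rightarrow> (functional \<Rightarrow> functional) \<Rightarrow> real \<times> real \<Rightarrow> functional \<Rightarrow> bool" where
  "fundamental_solution U L a T \<longleftrightarrow> is_distribution U T \<and> dist_eq U (L T) (dirac a)"

text \<open>A locally integrable function is a fundamental solution if the distribution it defines is one.\<close>

definition fundamental_solution_fun ::
    "(real \<times> real) set \<Rightarrow> (functional \<Rightarrow> functional) \<Rightarrow> real \<times> real \<Rightarrow>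
      (real \<times> real \<Rightarrow> complex) \<Rightarrow> bool" where
  "fundamental_solution_fun U L a f \<longleftrightarrow>
     locally_integrable U f \<and> fundamental_solution U L a (dist_of U f)"

section \<open>The Weinstein operator\<close>

definition half_plane :: "(real \<times> real) set" where
  "half_plane = {(x, y). x > 0}"

definition weinstein :: "complex \<Rightarrow> functional \<Rightarrow> functional" where
  "weinstein m T \<phi> =
     dist_laplacian T \<phi> + dist_mult (\<lambda>(x, y). m / of_real x) (dist_x T) \<phi>"

definition weinstein_adjoint :: "complex \<Rightarrow> functional \<Rightarrow> functional" where
  "weinstein_adjoint m T \<phi> =
     dist_laplacian T \<phi> - dist_x (dist_mult (\<lambda>(x, y). m / of_real x) T) \<phi>"

text \<open>All complex powers below have positive real base, up to the null set \<open>\<theta> \<in> {0, pi}\<close>, so that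
  \<open>of_real t powr s = exp (s * of_real (ln t))\<close>, provided \<open>x, \<xi> > 0\<close> and \<open>(x, y) \<noteq> (\<xi>, \<eta>)\<close>.\<close>

definition bracket :: "real \<Rightarrow> real \<Rightarrow> real \<Rightarrow> real \<Rightarrow> real \<Rightarrow> real" where
  "bracket x y \<xi> \<eta> \<theta> = (x - \<xi>)\<^sup>2 + 4 * x * \<xi> * (sin (\<theta> / 2))\<^sup>2 + (y - \<eta>)\<^sup>2"

definition E_ge1 :: "complex \<Rightarrow> real \<Rightarrow> real \<Rightarrow> real \<Rightarrow> real \<Rightarrow> complex" where
  "E_ge1 m x y \<xi> \<eta> =
     - (of_real \<xi> powr m / (2 * of_real pi)) *
       integral {0..pi} (\<lambda>\<theta>. of_real (sin \<theta>) powr (m - 1) /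
                                of_real (bracket x y \<xi> \<eta> \<theta>) powr (m / 2))"

text \<open>The value at the pole \<open>(x, y) = (\<xi>, \<eta>)\<close> is immaterial: it does not affect the distribution.\<close>

definition E :: "complex \<Rightarrow> real \<Rightarrow> real \<Rightarrow> real \<Rightarrow> real \<Rightarrow> complex" where
  "E m x y \<xi> \<eta> =
     (if Re m \<ge> 1 then E_ge1 m x y \<xi> \<eta>
      else of_real (\<xi> / x) powr (m - 1) * E_ge1 (2 - m) x y \<xi> \<eta>)"

end

theory Submission
  imports Defs "HOL-Real_Asymp.Real_Asymp"
begin

text \<open>
  Let \<open>Re n \<ge> 1\<close> and regularise the kernel by replacing the bracket \<open>B\<close> with \<open>B + e\<close>, \<open>e = \<epsilon>\<^sup>2 > 0\<close>.
  Up to the \<open>\<theta>\<close>-derivative of a function vanishing at \<open>0\<close> and \<open>\<pi>\<close>, the operator \<open>L\<^sub>n\<close> maps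
  \<open>(B + e)^(-n/2)\<close> to \<open>- n (n + 2) e (B + e)^(-n/2 - 2)\<close>: this is the Laplacian of a regularised
  Newton kernel in ``dimension'' \<open>n + 2\<close>, written in cylindrical coordinates. Rescaling \<open>(\<xi>, \<eta>, \<theta>)\<close>
  by \<open>\<epsilon>\<close> around \<open>(x, y, 0)\<close> shows that the latter is an approximate identity, whereas the kernel
  itself is dominated by a multiple of \<open>(\<bar>x - \<xi>\<bar> \<bar>y - \<eta>\<bar>)^(-1/2)\<close>. Letting \<open>\<epsilon>\<close> tend to \<open>0\<close>,
  the integral of \<open>\<xi>^n G\<^sub>n L\<^sub>n \<psi>\<close> is \<open>- 2 \<pi> \<psi>(x, y)\<close>, where \<open>G\<^sub>n\<close> is the integral over \<open>\<theta>\<close>.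
  All four cases of the theorem are instances with \<open>\<psi> = \<xi>^s \<phi>\<close>: \<open>(n, s)\<close> is \<open>(m, 0)\<close> or
  \<open>(2 - m, m - 1)\<close> for the adjoint operator, and \<open>(m, - m)\<close> or \<open>(2 - m, - 1)\<close> for \<open>L\<^sub>m\<close>.
\<close>

section \<open>Complex powers of nonnegative reals\<close>

text \<open>For integer \<open>n\<close>, read \<xi> as the radius in R^(n+1) and \<eta> as one more
  coordinate: \<open>L_n\<close> is then the Laplacian of R^(n+2) on axially symmetric functions,
  \<open>B\<close> a squared distance at angle \<theta>, sin(\<theta>)^(n-1) the density of that
  angle on the sphere, and the \<theta>-derivative the spherical part of the Laplacian. For complex
  \<open>n\<close> the picture is lost, but the identities it suggests are algebraic and persist,
  and the estimates see only Re n. The obstacle is the pole. Cutting out a small disc would require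
  the asymptotics of the angular integral and of its gradient, which in general has no elementary
  form. For e > 0 nothing is singular at the pole, so integration by parts leaves no boundary term
  there. The majorants used in the limit are products of functions of one variable, which spares
  polar coordinates. The weight \<xi>^n makes \<open>L_n\<close> formally symmetric. The limit
  profile has mass 2 pi / (n (n + 2)), and its denominator cancels the factor n (n + 2) produced by
  \<open>L_n\<close>; this is why the constant does not depend on \<open>n\<close>.\<close>

definition cpow :: "real \<Rightarrow> complex \<Rightarrow> complex" where
  "cpow t s = (if t > 0 then exp (s * of_real (ln t)) else 0)"

text \<open>Both powers vanish at base 0. They differ at negative bases, where \<open>cpow\<close>
  is 0: this keeps \<open>cpow\<close> additive in the exponent for every base and lets integrands
  in t extend by zero to t \<le> 0.\<close>

lemma of_real_powr_eq_cpow: "t \<ge> 0 \<Longrightarrow> of_real t powr s = cpow t s"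
  by (auto simp: cpow_def powr_def Ln_of_real)

lemma cpow_nz [simp]: "t > 0 \<Longrightarrow> cpow t s \<noteq> 0"
  by (simp add: cpow_def)

lemma norm_cpow: "t \<ge> 0 \<Longrightarrow> norm (cpow t s) = t powr Re s"
  by (auto simp: cpow_def powr_def)

lemma cpow_add: "cpow t (s + r) = cpow t s * cpow t r"
  by (simp add: cpow_def ring_distribs exp_add)

lemma cpow_mult: "a \<ge> 0 \<Longrightarrow> b \<ge> 0 \<Longrightarrow> cpow (a * b) s = cpow a s * cpow b s"
  by (auto simp: cpow_def ln_mult ring_distribs exp_add zero_less_mult_iff)

lemma cpow_0 [simp]: "t > 0 \<Longrightarrow> cpow t 0 = 1"
  by (simp add: cpow_def)

lemma cpow_1: "t \<ge> 0 \<Longrightarrow> cpow t 1 = of_real t"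
  by (auto simp: cpow_def exp_of_real)

lemma cpow_minus: "t > 0 \<Longrightarrow> cpow t (- s) = 1 / cpow t s"
  by (simp add: cpow_def exp_minus divide_inverse)

lemma cpow_diff: "t > 0 \<Longrightarrow> cpow t (s - r) = cpow t s / cpow t r"
  using cpow_add[of t s "-r"] by (simp add: cpow_minus)

lemma cpow_minus_1: "t > 0 \<Longrightarrow> cpow t (s - 1) = cpow t s / of_real t"
  by (simp add: cpow_diff cpow_1)

lemma cpow_measurable [measurable (raw)]:
  "f \<in> borel_measurable M \<Longrightarrow> (\<lambda>x. cpow (f x) s) \<in> borel_measurable M"
  unfolding cpow_def by (rule measurable_If) simp_all

lemma continuous_on_cpow [continuous_intros]:
  assumes "continuous_on A f" "\<And>x. x \<in> A \<Longrightarrow> f x > 0"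
  shows "continuous_on A (\<lambda>x. cpow (f x) s)"
proof -
  have "continuous_on A (\<lambda>x. exp (s * of_real (ln (f x))))"
    by (intro continuous_intros assms) (metis assms(2) less_irrefl)
  then show ?thesis
    by (rule continuous_on_eq) (simp add: cpow_def assms)
qed

lemma tendsto_cpow [tendsto_intros]:
  assumes "(f \<longlongrightarrow> l) F" "l > 0"
  shows "((\<lambda>x. cpow (f x) s) \<longlongrightarrow> cpow l s) F"
proof -
  have "isCont (\<lambda>t. cpow t s) l"
    using continuous_on_cpow[of "{0<..}" "\<lambda>x. x" s] assms(2)
    by (simp add: continuous_on_eq_continuous_at)
  then show ?thesis
    using assms(1) by (rule isCont_tendsto_compose)
qed

text \<open>The modulus t^(Re s) tends to 0 at the origin, whatever the phase does. This supplies
  the boundary values of primitives at t = 0 and of powers of sin \<theta> at the ends of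
  [0, pi].\<close>

lemma continuous_on_cpow_0:
  assumes "Re s > 0"
  shows "continuous_on {0..} (\<lambda>t. cpow t s)"
proof -
  have "((\<lambda>t. cpow t s) \<longlongrightarrow> cpow x s) (at x within {0..})" if "x \<ge> 0" for x
  proof (cases "x = 0")
    case True
    have "((\<lambda>t::real. t powr Re s) \<longlongrightarrow> 0 powr Re s) (at 0 within {0..})"
      by (intro tendsto_powr') (auto simp: assms eventually_at_filter)
    then have "((\<lambda>t::real. norm (cpow t s)) \<longlongrightarrow> 0) (at 0 within {0..})"
      using assms by (subst tendsto_cong[where g="\<lambda>t. t powr Re s"])
        (auto simp: eventually_at_filter norm_cpow)
    then show ?thesis
      using True tendsto_norm_zero_iff by (auto simp: cpow_def)
  next
    case False
    then show ?thesis using that by (auto intro!: tendsto_intros)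
  qed
  then show ?thesis by (auto simp: continuous_on_def)
qed

text \<open>The derivative is written as the same power divided by the base, so that all derivatives
  of a power of the bracket share that power as a common factor.\<close>

lemma has_vector_derivative_cpow:
  assumes "(f has_real_derivative f') (at t)" "f t > 0"
  shows "((\<lambda>t. cpow (f t) s) has_vector_derivative s * of_real f' * cpow (f t) s / of_real (f t)) (at t)"
proof -
  have L: "((\<lambda>t. of_real (ln (f t))) has_vector_derivative of_real (f' / f t)) (at t)"
    using assms by (intro has_vector_derivative_of_real)
      (auto intro!: derivative_eq_intros simp: field_simps simp flip: has_real_derivative_iff_has_vector_derivative)
  have "((\<lambda>x. exp (s * x)) has_field_derivative exp (s * of_real (ln (f t))) * s) (at (of_real (ln (f t))))"
    by (auto intro!: derivative_eq_intros)
  from field_vector_diff_chain_at[OF L this]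
  have "((\<lambda>t. exp (s * of_real (ln (f t)))) has_vector_derivative s * of_real f' * cpow (f t) s / of_real (f t)) (at t)"
    using assms by (simp add: cpow_def o_def mult_ac)
  note D = this[unfolded has_vector_derivative_def]
  have ev: "\<forall>\<^sub>F x in at t. f x > 0"
    using assms DERIV_isCont isContD order_tendstoD(1) by metis
  show ?thesis
    unfolding has_vector_derivative_def
    by (rule has_derivative_transform_eventually[OF D])
       (use assms ev in \<open>auto elim!: eventually_mono simp: cpow_def\<close>)
qed

text \<open>Jordan's inequality: concavity keeps the sine above the chord from (0, 0) to (pi/2, 1).
  It is the source of the quadratic growth of the bracket in \<theta>.\<close>

lemma sin_ge_linear:
  assumes "0 \<le> z" "z \<le> pi / 2"
  shows "2 * z / pi \<le> sin z"
proof -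
  have "concave_on {0..pi} sin"
    by (rule f''_le0_imp_concave[where f'=cos and f''="\<lambda>x. - sin x"])
      (auto intro!: derivative_eq_intros sin_ge_zero)
  from concave_onD[OF this, of "2 * z / pi" 0 "pi / 2"] show ?thesis
    using assms by (simp add: field_simps)
qed

section \<open>Integrability of powers and integration over the real line\<close>

lemma integrable_one_plus_abs_powr:
  assumes "r > 1"
  shows "integrable lborel (\<lambda>u::real. (1 + \<bar>u\<bar>) powr - r)"
proof -
  let ?f = "\<lambda>u::real. (1 + \<bar>u\<bar>) powr - r"
  have "((\<lambda>x::real. x powr - r) has_integral - (1 powr (- r + 1)) / (- r + 1)) {1..}"
    by (rule has_integral_powr_to_inf) (use assms in auto)
  then have "(\<lambda>x::real. x powr - r) absolutely_integrable_on {1..}"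
    by (intro nonnegative_absolutely_integrable_1) auto
  then have "integrable lborel (\<lambda>x::real. indicator {1..} x * x powr - r)"
    by (simp add: set_integrable_def integrable_completion)
  \<comment> \<open>A translation yields the branch u \<ge> 0 and a further reflection the branch u
    \<le> 0; the sum of the two dominates the function.\<close>
  from lborel_integrable_real_affine[OF this, of 1 1]
  have 1: "integrable lborel (\<lambda>x::real. indicator {1..} (1 + x) * (1 + x) powr - r)" by simp
  from lborel_integrable_real_affine[OF this, of "-1" 0]
  have "integrable lborel (\<lambda>x::real. indicator {1..} (1 - x) * (1 - x) powr - r)" by simp
  from Bochner_Integration.integrable_add[OF 1 this] show ?thesis
    by (rule Bochner_Integration.integrable_bound) (auto simp: indicator_def)
qed

lemma integrable_abs_powr_interval:
  assumes "-1 < r"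
  shows "integrable lborel (\<lambda>u::real. indicator {a..b} u * \<bar>u - c\<bar> powr r)"
proof -
  \<comment> \<open>Every point of [a, b] lies within distance d of c.\<close>
  define d where "d = \<bar>a - c\<bar> + \<bar>b - c\<bar>"
  have "((\<lambda>x::real. x powr r) has_integral d powr (r + 1) / (r + 1)) {0..d}"
    by (rule has_integral_powr_from_0) (use assms in \<open>auto simp: d_def\<close>)
  then have "(\<lambda>x::real. x powr r) absolutely_integrable_on {0..d}"
    by (intro nonnegative_absolutely_integrable_1) auto
  then have 0: "integrable lborel (\<lambda>x::real. indicator {0..d} x * x powr r)"
    by (simp add: set_integrable_def integrable_completion)
  have 1: "integrable lborel (\<lambda>x::real. indicator {0..d} (x - c) * (x - c) powr r)"
    using lborel_integrable_real_affine[OF 0, of 1 "-c"] by simp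
  have "integrable lborel (\<lambda>x::real. indicator {0..d} (c - x) * (c - x) powr r)"
    using lborel_integrable_real_affine[OF 0, of "-1" c] by simp
  from Bochner_Integration.integrable_add[OF 1 this] show ?thesis
    by (rule Bochner_Integration.integrable_bound) (auto simp: indicator_def d_def abs_if)
qed

lemma integrable_lborel_prod:
  fixes f :: "'a::euclidean_space \<Rightarrow> 'c::{real_normed_field,banach,second_countable_topology}" and g :: "'b::euclidean_space \<Rightarrow> 'c"
  assumes "integrable lborel f" "integrable lborel g"
  shows "integrable lborel (\<lambda>z. f (fst z) * g (snd z))"
proof -
  have [measurable]: "f \<in> borel_measurable lborel" "g \<in> borel_measurable lborel"
    using assms by auto
  have "integrable (lborel \<Otimes>\<^sub>M lborel) (\<lambda>z. f (fst z) * g (snd z))"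
  proof (rule lborel_pair.Fubini_integrable)
    show "integrable lborel (\<lambda>x. LBINT y. norm (f (fst (x, y)) * g (snd (x, y))))"
      using assms by (simp add: norm_mult)
    show "AE x in lborel. integrable lborel (\<lambda>y. f (fst (x, y)) * g (snd (x, y)))"
      using assms by simp
  qed simp
  then show ?thesis by (simp add: lborel_prod)
qed

lemma has_bochner_integral_FTC_whole_line:
  fixes f F :: "real \<Rightarrow> real"
  assumes "\<And>x. (F has_real_derivative f x) (at x)" "continuous_on UNIV f"
    "(F \<longlongrightarrow> A) at_bot" "(F \<longlongrightarrow> B) at_top" "\<And>x. f x \<ge> 0"
  shows "has_bochner_integral lborel f (B - A)"
proof -
  have c: "isCont f x" for x using assms(2) by (simp add: continuous_on_eq_continuous_at)
  have 1: "((F \<circ> real_of_ereal) \<longlongrightarrow> A) (at_right (-\<infinity>))"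
    and 2: "((F \<circ> real_of_ereal) \<longlongrightarrow> B) (at_left \<infinity>)"
    using assms(3,4) by (simp_all add: ereal_tendsto_simps)
  have "set_integrable lborel (einterval (-\<infinity>) \<infinity>) f"
    by (rule interval_integral_FTC_nonneg(1)[OF _ _ _ _ 1 2]) (use assms c in auto)
  moreover have "(LBINT x=-\<infinity>..\<infinity>. f x) = B - A"
    by (rule interval_integral_FTC_nonneg(2)[OF _ _ _ _ 1 2]) (use assms c in auto)
  ultimately show ?thesis
    by (simp add: has_bochner_integral_iff set_integrable_def interval_lebesgue_integral_def
        set_lebesgue_integral_def einterval_def)
qed

section \<open>The constant in the approximate identity\<close>

text \<open>The rescaled kernel decays like a length to the power -5. Each of the three variables
  receives a third of this, and 5/3 > 1 makes each factor integrable.\<close>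

definition decay :: "(real \<times> real) \<times> real \<Rightarrow> real" where
  "decay z = ((1 + \<bar>fst (fst z)\<bar>) powr - (5/3) * (1 + \<bar>snd (fst z)\<bar>) powr - (5/3)) * (1 + \<bar>snd z\<bar>) powr - (5/3)"

lemma decay_integrable: "integrable lborel decay"
  unfolding decay_def
  by (intro integrable_lborel_prod[where f="\<lambda>p. (1 + \<bar>fst p\<bar>) powr - (5/3) * (1 + \<bar>snd p\<bar>) powr - (5/3)"
        and g="\<lambda>t. (1 + \<bar>t\<bar>) powr - (5/3)"] integrable_lborel_prod integrable_one_plus_abs_powr) simp_all

text \<open>Bounding t^(a-1) by a multiple of X^((a-1)/2) leaves X^(-5/2), whatever a is; this
  splits into three factors X^(-5/6), one per variable. Allowing every X above the quadratic form
  lets the bound serve both the limit profile and the rescaled kernels.\<close>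

lemma powr_le_decay:
  fixes a c :: real
  assumes "a \<ge> 1" "c > 0"
  obtains C where "C \<ge> 0" "\<And>u v t X. t > 0 \<Longrightarrow> X \<ge> 1 + u\<^sup>2 + v\<^sup>2 + c * t\<^sup>2 \<Longrightarrow>
    t powr (a - 1) * X powr (- a / 2 - 2) \<le> C * decay ((u, v), t)"
proof -
  \<comment> \<open>Since (1 + |s|)^2 \<le> 2 + 2 s^2, this k gives k (1 + |s|)^2 \<le> 1 + min(1,
    c) s^2, which is at most X for s = u, v and t.\<close>
  define k where "k = min 1 c / 2"
  have k: "k > 0" "k \<le> 1 / 2" "k \<le> c / 2" using assms by (auto simp: k_def)
  define C where "C = c powr (- (a - 1) / 2) * (k powr - (5/6)) ^ 3"
  have C: "C \<ge> 0" by (simp add: C_def)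
  have *: "t powr (a - 1) * X powr (- a / 2 - 2) \<le> C * decay ((u, v), t)"
    if t: "t > 0" and X: "X \<ge> 1 + u\<^sup>2 + v\<^sup>2 + c * t\<^sup>2" for u v t X :: real
  proof -
    have ct: "c * t\<^sup>2 > 0" using t assms by simp
    have Xp: "X > 0" using X ct by (smt (verit) zero_le_power2)
    have ct2: "c * t\<^sup>2 \<le> X" using X by (smt (verit) zero_le_power2)
    have "t powr (a - 1) = c powr (- (a - 1) / 2) * (c * t\<^sup>2) powr ((a - 1) / 2)"
    proof -
      have "2 * ((a - 1) / 2) = a - 1" by simp
      then have "(t\<^sup>2) powr ((a - 1) / 2) = t powr (a - 1)"
        using t powr_powr[of t 2 "(a - 1) / 2"] by (metis powr_numeral less_imp_le)
      then show ?thesis using assms t by (simp add: powr_mult flip: powr_add mult.assoc)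
        (simp add: powr_add[symmetric] add_divide_distrib[symmetric])
    qed
    also have "\<dots> \<le> c powr (- (a - 1) / 2) * X powr ((a - 1) / 2)"
      using ct ct2 assms by (intro mult_left_mono powr_mono2) auto
    finally have "t powr (a - 1) * X powr (- a / 2 - 2)
        \<le> c powr (- (a - 1) / 2) * X powr ((a - 1) / 2) * X powr (- a / 2 - 2)"
      by (intro mult_right_mono) auto
    also have "\<dots> = c powr (- (a - 1) / 2) * X powr (- (5/2))"
      by (simp add: mult.assoc powr_add[symmetric] diff_divide_distrib)
    also have "X powr (- (5/2)) = (X powr - (5/6)) * (X powr - (5/6)) * (X powr - (5/6))"
      by (simp add: powr_add[symmetric])
    finally have 1: "t powr (a - 1) * X powr (- a / 2 - 2)
       \<le> c powr (- (a - 1) / 2) * ((X powr - (5/6)) * (X powr - (5/6)) * (X powr - (5/6)))" .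
    have 2: "X powr - (5/6) \<le> k powr - (5/6) * (1 + \<bar>s\<bar>) powr - (5/3)"
      if "X \<ge> k * (1 + \<bar>s\<bar>)\<^sup>2" for s :: real
    proof -
      have "k * (1 + \<bar>s\<bar>)\<^sup>2 > 0" using k by (intro mult_pos_pos zero_less_power) auto
      then have "X powr - (5/6) \<le> (k * (1 + \<bar>s\<bar>)\<^sup>2) powr - (5/6)"
        using that by (intro powr_mono2') auto
      also have "\<dots> = k powr - (5/6) * (1 + \<bar>s\<bar>) powr - (5/3)"
        using k by (simp add: powr_mult powr_powr flip: powr_numeral)
      finally show ?thesis .
    qed
    have sq: "k * (1 + \<bar>s\<bar>)\<^sup>2 \<le> 2 * k + 2 * k * s\<^sup>2" for s :: real
    proof -
      have "(1 + \<bar>s\<bar>)\<^sup>2 \<le> 2 + 2 * s\<^sup>2"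
        using zero_le_power2[of "1 - \<bar>s\<bar>"] by (simp add: power2_eq_square algebra_simps)
      from mult_left_mono[OF this, of k] k show ?thesis by (simp add: algebra_simps)
    qed
    have m: "2 * k * s\<^sup>2 \<le> s\<^sup>2" "2 * k * s\<^sup>2 \<le> c * s\<^sup>2" for s :: real
      using k mult_right_mono[of "2 * k" 1 "s\<^sup>2"] mult_right_mono[of "2 * k" c "s\<^sup>2"] by auto
    have u: "X \<ge> k * (1 + \<bar>u\<bar>)\<^sup>2" using sq[of u] m(1)[of u] X k ct zero_le_power2[of v] by linarith
    have v: "X \<ge> k * (1 + \<bar>v\<bar>)\<^sup>2" using sq[of v] m(1)[of v] X k ct zero_le_power2[of u] by linarith
    have tt: "X \<ge> k * (1 + \<bar>t\<bar>)\<^sup>2" using sq[of t] m(2)[of t] X k zero_le_power2[of u] zero_le_power2[of v] by linarith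
    have "(X powr - (5/6)) * (X powr - (5/6)) * (X powr - (5/6)) \<le>
       (k powr - (5/6) * (1 + \<bar>u\<bar>) powr - (5/3)) * (k powr - (5/6) * (1 + \<bar>v\<bar>) powr - (5/3))
         * (k powr - (5/6) * (1 + \<bar>t\<bar>) powr - (5/3))"
      by (intro mult_mono 2 u v tt mult_nonneg_nonneg) auto
    from mult_left_mono[OF this, of "c powr (- (a - 1) / 2)"] 1 show ?thesis
      by (simp add: C_def decay_def power3_eq_cube mult_ac)
  qed
  show ?thesis by (rule that[OF C *])
qed

lemma integral_inverse_square_quadratic:
  fixes b :: real
  assumes "b > 0"
  shows "has_bochner_integral lborel (\<lambda>v. 1 / (b + v\<^sup>2)\<^sup>2) (pi / (2 * (sqrt b) ^ 3))"
proof -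
  have pos: "b + v\<^sup>2 > 0" for v using assms by (smt (verit) zero_le_power2)
  define s where "s = sqrt b"
  have s: "s > 0" "b = s\<^sup>2" using assms by (auto simp: s_def)
  let ?F = "\<lambda>v. v / (2 * s\<^sup>2 * (s\<^sup>2 + v\<^sup>2)) + arctan (v / s) / (2 * s ^ 3)"
  have sp: "s\<^sup>2 + v\<^sup>2 > 0" for v using pos s by simp
  have "(?F has_real_derivative 1 / (b + v\<^sup>2)\<^sup>2) (at v)" for v
  proof -
    have "1 + (v / s)\<^sup>2 = (s\<^sup>2 + v\<^sup>2) / s\<^sup>2" using s by (simp add: field_simps)
    have A: "((\<lambda>v. arctan (v / s) / (2 * s ^ 3)) has_real_derivative
        (s\<^sup>2 / (s\<^sup>2 + v\<^sup>2)) * (1 / s) / (2 * s ^ 3)) (at v)"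
      using s by (auto intro!: derivative_eq_intros simp: inverse_eq_divide \<open>1 + (v / s)\<^sup>2 = _\<close>)
        (simp add: eval_nat_numeral)
    have "((\<lambda>v. v / (2 * s\<^sup>2 * (s\<^sup>2 + v\<^sup>2))) has_real_derivative
        (2 * s\<^sup>2 * (s\<^sup>2 + v\<^sup>2) - v * (2 * s\<^sup>2 * (2 * v))) / (2 * s\<^sup>2 * (s\<^sup>2 + v\<^sup>2))\<^sup>2) (at v)"
      using sp[of v] s by (auto intro!: derivative_eq_intros simp: power2_eq_square)
    from DERIV_add[OF this A] have "(?F has_real_derivative (2 * s\<^sup>2 * (s\<^sup>2 + v\<^sup>2) - v * (2 * s\<^sup>2 * (2 * v))) / (2 * s\<^sup>2 * (s\<^sup>2 + v\<^sup>2))\<^sup>2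
        + (s\<^sup>2 / (s\<^sup>2 + v\<^sup>2)) * (1 / s) / (2 * s ^ 3)) (at v)" .
    also have "(2 * s\<^sup>2 * (s\<^sup>2 + v\<^sup>2) - v * (2 * s\<^sup>2 * (2 * v))) / (2 * s\<^sup>2 * (s\<^sup>2 + v\<^sup>2))\<^sup>2
        + (s\<^sup>2 / (s\<^sup>2 + v\<^sup>2)) * (1 / s) / (2 * s ^ 3) = 1 / (s\<^sup>2 + v\<^sup>2)\<^sup>2"
    proof -
      define D where "D = s\<^sup>2 + v\<^sup>2"
      have D: "D \<noteq> 0" using sp[of v] unfolding D_def by linarith
      have v2: "v * (2 * s\<^sup>2 * (2 * v)) = 4 * s\<^sup>2 * (D - s\<^sup>2)" by (simp add: D_def power2_eq_square)
      show ?thesis unfolding v2 D_def[symmetric] using D s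
        by (simp add: field_simps eval_nat_numeral)
    qed
    finally show ?thesis using s by simp
  qed
  moreover have "continuous_on UNIV (\<lambda>v. 1 / (b + v\<^sup>2)\<^sup>2)"
    by (intro continuous_intros) (use pos in \<open>auto simp: less_imp_neq[symmetric]\<close>)
  moreover have "(?F \<longlongrightarrow> 0 + (- (pi / 2)) / (2 * s ^ 3)) at_bot"
  proof (intro tendsto_add tendsto_divide tendsto_const)
    show "((\<lambda>v. v / (2 * s\<^sup>2 * (s\<^sup>2 + v\<^sup>2))) \<longlongrightarrow> 0) at_bot" using s by real_asymp
    show "((\<lambda>v. arctan (v / s)) \<longlongrightarrow> - (pi / 2)) at_bot" using s by real_asymp
  qed (use s in auto)
  moreover have "(?F \<longlongrightarrow> 0 + (pi / 2) / (2 * s ^ 3)) at_top"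
  proof (intro tendsto_add tendsto_divide tendsto_const)
    show "((\<lambda>v. v / (2 * s\<^sup>2 * (s\<^sup>2 + v\<^sup>2))) \<longlongrightarrow> 0) at_top" using s by real_asymp
    show "((\<lambda>v. arctan (v / s)) \<longlongrightarrow> (pi / 2)) at_top" using s by real_asymp
  qed (use s in auto)
  ultimately have "has_bochner_integral lborel (\<lambda>v. 1 / (b + v\<^sup>2)\<^sup>2)
     ((0 + (pi / 2) / (2 * s ^ 3)) - (0 + (- (pi / 2)) / (2 * s ^ 3)))"
    by (rule has_bochner_integral_FTC_whole_line) simp
  then show ?thesis by (simp add: s_def)
qed

lemma integral_one_plus_square_powr:
  "has_bochner_integral lborel (\<lambda>u::real. 1 / (sqrt (1 + u\<^sup>2)) ^ 3) 2"
proof -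
  have pos: "1 + u\<^sup>2 > 0" for u :: real by (smt (verit) zero_le_power2)
  let ?F = "\<lambda>u::real. u / sqrt (1 + u\<^sup>2)"
  have "(?F has_real_derivative 1 / (sqrt (1 + u\<^sup>2)) ^ 3) (at u)" for u :: real
  proof -
    define D where "D = sqrt (1 + u\<^sup>2)"
    have D: "D > 0" "D\<^sup>2 = 1 + u\<^sup>2" using pos[of u] by (auto simp: D_def)
    have "(?F has_real_derivative (D - u * (u / D)) / D\<^sup>2) (at u)"
      using pos[of u] unfolding D_def
      by (auto intro!: derivative_eq_intros simp: inverse_eq_divide power2_eq_square)
    also have "(D - u * (u / D)) / D\<^sup>2 = (D\<^sup>2 - u\<^sup>2) / D ^ 3"
      using D by (simp add: field_simps power2_eq_square power3_eq_cube)
    also have "\<dots> = 1 / D ^ 3" by (simp add: D(2))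
    finally show ?thesis by (simp add: D_def)
  qed
  moreover have "continuous_on UNIV (\<lambda>u::real. 1 / (sqrt (1 + u\<^sup>2)) ^ 3)"
    by (intro continuous_intros) (use pos in \<open>auto simp: less_imp_neq[symmetric]\<close>)
  moreover have "(?F \<longlongrightarrow> -1) at_bot" by real_asymp
  moreover have "(?F \<longlongrightarrow> 1) at_top" by real_asymp
  ultimately have "has_bochner_integral lborel (\<lambda>u::real. 1 / (sqrt (1 + u\<^sup>2)) ^ 3) (1 - (-1))"
    by (rule has_bochner_integral_FTC_whole_line) (use pos in \<open>auto intro!: divide_nonneg_nonneg\<close>)
  then show ?thesis by simp
qed

text \<open>Integrating over v first leaves (pi / 2) (1 + u^2)^(-3/2), whose integral over u is pi.
  The integrability required by Fubini comes from the product majorant 1 / ((1 + u^2) (1 +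
  v^2)).\<close>

lemma integral_plane_kernel:
  "integral\<^sup>L lborel (\<lambda>p::real \<times> real. 1 / (1 + (fst p)\<^sup>2 + (snd p)\<^sup>2)\<^sup>2) = pi"
proof -
  let ?f = "\<lambda>p::real \<times> real. 1 / (1 + (fst p)\<^sup>2 + (snd p)\<^sup>2)\<^sup>2"
  have pos: "1 + u\<^sup>2 > 0" for u :: real by (smt (verit) zero_le_power2)
  have i: "has_bochner_integral lborel (\<lambda>u::real. 1 / (1 + u\<^sup>2)) (pi / 2 - (- (pi / 2)))"
    by (rule has_bochner_integral_FTC_whole_line[where F=arctan])
      (use pos in \<open>auto intro!: derivative_eq_intros continuous_intros tendsto_arctan_at_top tendsto_arctan_at_bot
          simp: inverse_eq_divide less_imp_neq[symmetric] less_imp_le\<close>)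
  then have "integrable lborel (\<lambda>p::real \<times> real. 1 / (1 + (fst p)\<^sup>2) * (1 / (1 + (snd p)\<^sup>2)))"
    by (intro integrable_lborel_prod) (auto simp: has_bochner_integral_iff)
  then have "integrable lborel ?f"
  proof (rule Bochner_Integration.integrable_bound)
    have "norm (1 / (1 + u\<^sup>2 + v\<^sup>2)\<^sup>2) \<le> norm (1 / (1 + u\<^sup>2) * (1 / (1 + v\<^sup>2)))" for u v :: real
    proof -
      have "(1 + u\<^sup>2) * (1 + v\<^sup>2) \<le> (1 + u\<^sup>2 + v\<^sup>2) * (1 + u\<^sup>2 + v\<^sup>2)"
        by (intro mult_mono) auto
      then have "1 / (1 + u\<^sup>2 + v\<^sup>2)\<^sup>2 \<le> 1 / ((1 + u\<^sup>2) * (1 + v\<^sup>2))"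
        using pos[of u] pos[of v] by (intro frac_le) (auto simp: power2_eq_square)
      then show ?thesis using pos by (simp add: less_imp_le)
    qed
    then show "AE p in lborel. norm (?f p) \<le> norm (1 / (1 + (fst p)\<^sup>2) * (1 / (1 + (snd p)\<^sup>2)))"
      by simp
  qed (simp add: borel_prod[symmetric])
  then have "integrable (lborel \<Otimes>\<^sub>M lborel) ?f" by (simp add: lborel_prod)
  from lborel_pair.integral_fst'[OF this]
  have "integral\<^sup>L lborel ?f = (LBINT u. LBINT v. 1 / ((1 + u\<^sup>2) + v\<^sup>2)\<^sup>2)"
    by (simp add: lborel_prod)
  also have "\<dots> = (LBINT u. (pi / 2) * (1 / (sqrt (1 + u\<^sup>2)) ^ 3))"
    using integral_inverse_square_quadratic[OF pos] by (simp add: has_bochner_integral_iff)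
  also have "\<dots> = pi"
    using integral_one_plus_square_powr
    by (subst Bochner_Integration.integral_mult_right) (auto simp: has_bochner_integral_iff)
  finally show ?thesis .
qed

lemma cpow_inverse: "t > 0 \<Longrightarrow> cpow (1 / t) s = cpow t (- s)"
  by (simp add: cpow_def ln_div)

lemma cpow_square: "t > 0 \<Longrightarrow> cpow (t\<^sup>2) s = cpow t (2 * s)"
  by (simp add: cpow_def ln_realpow mult_ac)

lemma cpow_minus_2: "t > 0 \<Longrightarrow> cpow t (s - 2) = cpow t s / (of_real t)\<^sup>2"
  using cpow_minus_1[of t s] cpow_minus_1[of t "s - 1"] by (simp add: power2_eq_square)

lemma cpow_one_left [simp]: "cpow 1 s = 1" by (simp add: cpow_def)

text \<open>The substitution W = x^2 t^2 / (A + x^2 t^2) maps the half line onto (0, 1) and turns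
  the integrand into W^(n/2-1) (1 - W) dW / (2 A^2), a Beta integral with an elementary primitive
  even for complex n. Its value is (1/n - 1/(n+2)) / A^2.\<close>

lemma radial_integral:
  fixes n :: complex
  assumes n: "Re n > 0" and A: "A > 0" and x: "x > 0"
    and int: "integrable lborel (\<lambda>t. cpow t (n - 1) * cpow x n * cpow (A + x\<^sup>2 * t\<^sup>2) (- n / 2 - 2))"
  shows "(LBINT t. cpow t (n - 1) * cpow x n * cpow (A + x\<^sup>2 * t\<^sup>2) (- n / 2 - 2)) =
    2 / (n * (n + 2)) * of_real (1 / A\<^sup>2)"
proof -
  let ?f = "\<lambda>t. cpow t (n - 1) * cpow x n * cpow (A + x\<^sup>2 * t\<^sup>2) (- n / 2 - 2)"
  define W where "W t = x\<^sup>2 * t\<^sup>2 / (A + x\<^sup>2 * t\<^sup>2)" for t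
  define F where "F t = of_real (1 / A\<^sup>2) * (cpow (W t) (n / 2) / n - cpow (W t) (n / 2 + 1) / (n + 2))" for t
  have D: "A + x\<^sup>2 * t\<^sup>2 > 0" for t using A by (smt (verit) zero_le_power2 mult_nonneg_nonneg)
  have n0: "n \<noteq> 0" "n + 2 \<noteq> 0"
    using n by (auto simp: complex_eq_iff)
  have der: "(F has_vector_derivative ?f t) (at t)" if t: "t > 0" for t
  proof -
    define D where "D = A + x\<^sup>2 * t\<^sup>2"
    have Dp: "D > 0" using D by (simp add: D_def)
    have Wp: "W t > 0" using t x Dp by (simp add: W_def D_def)
    have "(W has_real_derivative (2 * x\<^sup>2 * t * D - x\<^sup>2 * t\<^sup>2 * (2 * x\<^sup>2 * t)) / D\<^sup>2) (at t)"
      unfolding W_def D_def using Dp D_def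
      by (auto intro!: derivative_eq_intros simp: power2_eq_square)
    also have "(2 * x\<^sup>2 * t * D - x\<^sup>2 * t\<^sup>2 * (2 * x\<^sup>2 * t)) / D\<^sup>2 = 2 * x\<^sup>2 * t * A / D\<^sup>2"
      by (simp add: D_def algebra_simps)
    finally have W': "(W has_real_derivative 2 * x\<^sup>2 * t * A / D\<^sup>2) (at t)" .
    define d where "d = complex_of_real (2 * x\<^sup>2 * t * A / D\<^sup>2)"
    have "(F has_vector_derivative of_real (1 / A\<^sup>2) *
        ((n / 2) * d * cpow (W t) (n / 2) / of_real (W t) / n -
         (n / 2 + 1) * d * cpow (W t) (n / 2 + 1) / of_real (W t) / (n + 2))) (at t)"
      unfolding F_def d_def
      by (intro has_vector_derivative_mult_right has_vector_derivative_diff has_vector_derivative_divide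
          has_vector_derivative_cpow W' Wp)
    also have "of_real (1 / A\<^sup>2) *
        ((n / 2) * d * cpow (W t) (n / 2) / of_real (W t) / n -
         (n / 2 + 1) * d * cpow (W t) (n / 2 + 1) / of_real (W t) / (n + 2))
       = of_real (1 / A\<^sup>2) * (d / (2 * of_real (W t))) * cpow (W t) (n / 2) * of_real (1 - W t)"
    proof -
      have "n / 2 * d * c / w / n - (n / 2 + 1) * d * (c * w) / w / (n + 2) = d / (2 * w) * c * (1 - w)"
        if "w \<noteq> 0" for c w :: complex
      proof -
        have h: "n / 2 + 1 = (n + 2) / 2" by simp
        have e1: "(n / 2 + 1) * d * (c * w) / w / (n + 2) = d * c / 2"
        proof -
          have "N / 2 * d * (c * w) / w / N = d * c / 2" if "N \<noteq> 0" for N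
            using that \<open>w \<noteq> 0\<close> by simp
          from this[OF n0(2)] show ?thesis unfolding h .
        qed
        have e2: "n / 2 * d * c / w / n = d * c / (2 * w)" using n0 that by simp
        show ?thesis unfolding e1 e2 using that by (simp add: field_simps)
      qed
      from this[of "of_real (W t)" "cpow (W t) (n / 2)"] show ?thesis
        using Wp by (simp add: cpow_add cpow_1 mult.assoc)
    qed
    also have "\<dots> = of_real ((1 / A\<^sup>2) * (2 * x\<^sup>2 * t * A / D\<^sup>2 / (2 * W t)) * (1 - W t)) * cpow (W t) (n / 2)"
      by (simp add: d_def)
    also have "(1 / A\<^sup>2) * (2 * x\<^sup>2 * t * A / D\<^sup>2 / (2 * W t)) * (1 - W t) = 1 / (t * D\<^sup>2)"
    proof -
      have e: "1 - W t = A / D" using Dp by (simp add: W_def D_def field_simps)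
      have w: "W t = x\<^sup>2 * t\<^sup>2 / D" by (simp add: W_def D_def)
      show ?thesis
        unfolding e unfolding w using Dp A x t by (simp add: field_simps power2_eq_square)
    qed
    also have "cpow (W t) (n / 2) = cpow x n * cpow t n * cpow D (- n / 2)"
    proof -
      have "W t = x\<^sup>2 * t\<^sup>2 * (1 / D)" by (simp add: W_def D_def)
      then have "cpow (W t) (n / 2) = cpow (x\<^sup>2) (n / 2) * cpow (t\<^sup>2) (n / 2) * cpow (1 / D) (n / 2)"
        using Dp by (simp only: cpow_mult zero_le_power2 mult_nonneg_nonneg zero_le_divide_1_iff less_imp_le)
      then show ?thesis
        using Dp x t cpow_square[of x "n / 2"] cpow_square[of t "n / 2"] by (simp add: cpow_inverse)
    qed
    also have "of_real (1 / (t * D\<^sup>2)) * (cpow x n * cpow t n * cpow D (- n / 2)) = ?f t"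
      using Dp x t by (simp add: D_def[symmetric] cpow_minus_1 cpow_minus_2)
    finally show ?thesis .
  qed
  have cont: "isCont ?f t" if "t > 0" for t
  proof -
    have "continuous_on {0<..} ?f"
      by (intro continuous_intros) (use D in auto)
    then show ?thesis using that by (simp add: continuous_on_eq_continuous_at)
  qed
  have si: "set_integrable lborel (einterval 0 \<infinity>) ?f"
    unfolding set_integrable_def
    by (rule Bochner_Integration.integrable_bound[OF int]) (auto simp: indicator_def)
  have W0: "(W \<longlongrightarrow> 0) (at_right 0)"
    unfolding W_def by (rule tendsto_eq_intros refl | use A in simp)+
  have lim0: "(F \<longlongrightarrow> 0) (at_right 0)"
  proof -
    have *: "((\<lambda>t. cpow (W t) s) \<longlongrightarrow> 0) (at_right 0)" if "Re s > 0" for s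
    proof -
      have "((\<lambda>t. cpow t s) \<longlongrightarrow> cpow 0 s) (at 0 within {0..})"
        using continuous_on_cpow_0[OF that] by (auto simp: continuous_on_def)
      moreover have "filterlim W (at 0 within {0..}) (at_right 0)"
        unfolding filterlim_at
        using W0 D x by (auto simp: eventually_at_filter W_def less_imp_le less_imp_neq[symmetric])
      ultimately show ?thesis
        by (auto simp: cpow_def dest: filterlim_compose)
    qed
    have "(F \<longlongrightarrow> of_real (1 / A\<^sup>2) * (0 / n - 0 / (n + 2))) (at_right 0)"
      unfolding F_def by (intro tendsto_intros *) (use n n0 in auto)
    then show ?thesis by simp
  qed
  have W1: "(W \<longlongrightarrow> 1) at_top"
    unfolding W_def using A x by real_asymp
  have lim1: "(F \<longlongrightarrow> of_real (1 / A\<^sup>2) * (cpow 1 (n / 2) / n - cpow 1 (n / 2 + 1) / (n + 2))) at_top"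
    unfolding F_def by (intro tendsto_intros W1) (use n0 in auto)
  have "(LBINT t=0..\<infinity>. ?f t) = of_real (1 / A\<^sup>2) * (cpow 1 (n / 2) / n - cpow 1 (n / 2 + 1) / (n + 2)) - 0"
    by (rule interval_integral_FTC_integrable[where F=F])
      (use der cont si lim0 lim1 in \<open>auto simp: ereal_tendsto_simps zero_ereal_def\<close>)
  \<comment> \<open>For t \<le> 0 the integrand is 0 because \<open>cpow\<close> vanishes
    there.\<close>
  also have "(LBINT t=0..\<infinity>. ?f t) = (LBINT t. ?f t)"
    unfolding interval_lebesgue_integral_def set_lebesgue_integral_def
    by (auto intro!: Bochner_Integration.integral_cong simp: einterval_def indicator_def cpow_def zero_ereal_def)
  finally show ?thesis using n0 by (simp add: field_simps)
qed

text \<open>The approximate identity seen at scale \<epsilon>, in the limit: \<xi> is frozen at x,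
  sin \<theta> has become t, and the bracket has become a quadratic form with coefficient x^2 in t.
  The factor \<open>cpow (snd z) (n - 1)\<close> confines it to t > 0.\<close>

definition profile :: "complex \<Rightarrow> real \<Rightarrow> (real \<times> real) \<times> real \<Rightarrow> complex" where
  "profile n x z = cpow (snd z) (n - 1) * cpow x n *
     cpow (1 + (fst (fst z))\<^sup>2 + (snd (fst z))\<^sup>2 + x\<^sup>2 * (snd z)\<^sup>2) (- n / 2 - 2)"

lemma profile_integral:
  assumes n: "Re n \<ge> 1" and x: "x > 0"
  shows "integral\<^sup>L lborel (profile n x) = 2 * of_real pi / (n * (n + 2))"
proof -
  obtain C where C: "C \<ge> 0" "\<And>u v t X. t > 0 \<Longrightarrow> X \<ge> 1 + u\<^sup>2 + v\<^sup>2 + x\<^sup>2 * t\<^sup>2 \<Longrightarrow>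
    t powr (Re n - 1) * X powr (- Re n / 2 - 2) \<le> C * decay ((u, v), t)"
    using powr_le_decay[of "Re n" "x\<^sup>2"] n x by (metis zero_less_power)
  have pos: "1 + u\<^sup>2 + v\<^sup>2 > 0" "1 + u\<^sup>2 + v\<^sup>2 + x\<^sup>2 * t\<^sup>2 > 0" for u v t :: real
    by (smt (verit) zero_le_power2 mult_nonneg_nonneg)+
  have dnn: "decay z \<ge> 0" for z by (simp add: decay_def)
  have "integrable lborel (\<lambda>z. norm (cpow x n) * C * decay z)"
    using decay_integrable by simp
  then have int: "integrable lborel (profile n x)"
  proof (rule Bochner_Integration.integrable_bound)
    show "profile n x \<in> borel_measurable lborel" unfolding profile_def
      by (simp, intro borel_measurable_times cpow_measurable;
          intro borel_measurable_continuous_onI continuous_intros)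
    have "norm (profile n x ((u, v), t)) \<le> norm (norm (cpow x n) * C * decay ((u, v), t))" for u v t
    proof (cases "t > 0")
      case True
      from mult_left_mono[OF C(2)[OF True order_refl[of "1 + u\<^sup>2 + v\<^sup>2 + x\<^sup>2 * t\<^sup>2"]], of "norm (cpow x n)"]
      show ?thesis
        using True pos(2)[of u v t] C dnn by (simp add: profile_def norm_mult norm_cpow less_imp_le mult_ac)
    next
      case False
      then show ?thesis by (simp add: profile_def cpow_def)
    qed
    then show "AE z in lborel. norm (profile n x z) \<le> norm (norm (cpow x n) * C * decay z)" by auto
  qed
  then have int2: "integrable (lborel \<Otimes>\<^sub>M lborel) (profile n x)" by (simp add: lborel_prod)
  have "integral\<^sup>L lborel (profile n x) = (LBINT p. LBINT t. profile n x (p, t))"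
    using lborel_pair.integral_fst'[OF int2] by (simp add: lborel_prod)
  also have "\<dots> = (LBINT p. 2 / (n * (n + 2)) * of_real (1 / (1 + (fst p)\<^sup>2 + (snd p)\<^sup>2)\<^sup>2))"
  \<comment> \<open>Fubini provides integrability in t for almost every p only, and the radial
    formula presupposes it.\<close>
  proof (rule integral_cong_AE)
    show "AE p in lborel. (LBINT t. profile n x (p, t)) = 2 / (n * (n + 2)) * of_real (1 / (1 + (fst p)\<^sup>2 + (snd p)\<^sup>2)\<^sup>2)"
      using lborel_pair.AE_integrable_fst'[OF int2]
    proof eventually_elim
      case (elim p)
      then show ?case
        using radial_integral[of n "1 + (fst p)\<^sup>2 + (snd p)\<^sup>2" x] n x pos(1)
        by (simp add: profile_def)
    qed
    show "(\<lambda>p. LBINT t. profile n x (p, t)) \<in> borel_measurable lborel"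
      by (rule borel_measurable_integrable[OF lborel_pair.integrable_fst'[OF int2]])
  qed (simp add: borel_prod[symmetric])
  also have "\<dots> = 2 / (n * (n + 2)) * of_real pi"
    by (simp add: integral_plane_kernel del: of_real_divide of_real_power of_real_add flip: of_real_divide)
  finally show ?thesis by simp
qed

section \<open>The approximate identity\<close>

lemma half_plane_iff: "p \<in> half_plane \<longleftrightarrow> fst p > 0"
  by (cases p) (simp add: half_plane_def)

lemma open_half_plane: "open half_plane"
proof -
  have "half_plane = fst -` {0<..}" by (auto simp: half_plane_iff)
  then show ?thesis using open_vimage_fst[OF open_greaterThan[of "0::real"]] by metis
qed

text \<open>Law of cosines for sides x and \<xi> enclosing the angle \<theta>. This form is the one
  to differentiate; the half-angle form is the one that shows the sign and the growth.\<close>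

lemma bracket_eq_cos: "bracket x y \<xi> \<eta> \<theta> = \<xi>\<^sup>2 - 2 * x * \<xi> * cos \<theta> + x\<^sup>2 + (y - \<eta>)\<^sup>2"
proof -
  have "cos \<theta> = 1 - 2 * (sin (\<theta> / 2))\<^sup>2" using cos_double_sin[of "\<theta> / 2"] by simp
  then have "4 * x * \<xi> * (sin (\<theta> / 2))\<^sup>2 = 2 * x * \<xi> * (1 - cos \<theta>)" by simp
  then show ?thesis by (simp add: bracket_def power2_diff algebra_simps)
qed

lemma bracket_nonneg: "x > 0 \<Longrightarrow> \<xi> > 0 \<Longrightarrow> bracket x y \<xi> \<eta> \<theta> \<ge> 0"
  by (simp add: bracket_def)

text \<open>Jordan's inequality at \<theta>/2 gives sin(\<theta>/2) \<ge> \<theta>/pi, hence the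
  constant 4 x lo / pi^2. The lower bound lo on \<xi> makes the estimate uniform over a compact
  set.\<close>

lemma bracket_ge:
  assumes "x > 0" "\<xi> \<ge> lo" "lo > 0" "0 \<le> \<theta>" "\<theta> \<le> pi"
  shows "bracket x y \<xi> \<eta> \<theta> \<ge> (x - \<xi>)\<^sup>2 + (y - \<eta>)\<^sup>2 + 4 * x * lo / pi\<^sup>2 * \<theta>\<^sup>2"
proof -
  have "\<theta> / pi \<le> sin (\<theta> / 2)"
    using sin_ge_linear[of "\<theta> / 2"] assms by simp
  then have "(\<theta> / pi)\<^sup>2 \<le> (sin (\<theta> / 2))\<^sup>2" using assms by (intro power_mono) auto
  then have "4 * x * lo * (\<theta> / pi)\<^sup>2 \<le> 4 * x * \<xi> * (sin (\<theta> / 2))\<^sup>2"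
    using assms by (intro mult_mono) auto
  then show ?thesis by (simp add: bracket_def power_divide)
qed

lemma compact_half_plane_bounds:
  assumes "compact S" "S \<subseteq> half_plane"
  obtains lo hi a b where "lo > 0" "lo \<le> hi" "S \<subseteq> {lo..hi} \<times> {a..b}"
proof (cases "S = {}")
  case True
  then show ?thesis using that[of 1 1] by auto
next
  case False
  obtain p where p: "p \<in> S" "\<And>q. q \<in> S \<Longrightarrow> fst p \<le> fst q"
    using continuous_attains_inf[OF assms(1) False, of fst] continuous_on_fst[OF continuous_on_id] by blast
  obtain q where q: "q \<in> S" "\<And>r. r \<in> S \<Longrightarrow> fst r \<le> fst q"
    using continuous_attains_sup[OF assms(1) False, of fst] continuous_on_fst[OF continuous_on_id] by blast
  obtain r where r: "r \<in> S" "\<And>q. q \<in> S \<Longrightarrow> snd r \<le> snd q"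
    using continuous_attains_inf[OF assms(1) False, of snd] continuous_on_snd[OF continuous_on_id] by blast
  obtain s where s: "s \<in> S" "\<And>q. q \<in> S \<Longrightarrow> snd q \<le> snd s"
    using continuous_attains_sup[OF assms(1) False, of snd] continuous_on_snd[OF continuous_on_id] by blast
  have "q' \<in> {fst p..fst q} \<times> {snd r..snd s}" if "q' \<in> S" for q'
    using p(2)[OF that] q(2)[OF that] r(2)[OF that] s(2)[OF that] by (cases q') auto
  moreover have "fst p > 0" using p(1) assms(2) by (auto simp: half_plane_iff)
  ultimately show ?thesis using that[of "fst p" "fst q"] p(2)[OF q(1)] by blast
qed

lemma compact_bound:
  fixes f :: "'a::topological_space \<Rightarrow> 'b::real_normed_vector"
  assumes "compact S" "continuous_on S f"
  obtains M where "M \<ge> 0" "\<And>x. x \<in> S \<Longrightarrow> norm (f x) \<le> M"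
proof -
  have "bounded (f ` S)" using assms by (intro compact_imp_bounded compact_continuous_image)
  then obtain M where M: "\<forall>x\<in>f ` S. norm x \<le> M" by (auto simp: bounded_iff)
  show ?thesis by (rule that[of "max M 0"]) (use M in \<open>auto simp: le_max_iff_disj\<close>)
qed

lemma lborel_integral_affine:
  fixes f :: "'a::euclidean_space \<Rightarrow> complex"
  assumes "f \<in> borel_measurable borel" "c > 0"
  shows "integral\<^sup>L lborel f = of_real (c ^ DIM('a)) * (LBINT x. f (a + c *\<^sub>R x))"
proof -
  have "integral\<^sup>L lborel f = integral\<^sup>L (density (distr lborel borel (\<lambda>x. a + c *\<^sub>R x)) (\<lambda>_. ennreal (\<bar>c\<bar> ^ DIM('a)))) f"
    using lborel_affine[of c a] assms by simp
  also have "\<dots> = (LBINT x. (c ^ DIM('a)) *\<^sub>R f (a + c *\<^sub>R x))"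
    using assms by (subst integral_density) (auto simp: integral_distr)
  finally show ?thesis by (simp add: scaleR_conv_of_real)
qed

lemma borel_measurable_indicator_compose:
  assumes "f \<in> M \<rightarrow>\<^sub>M N" "A \<in> sets N"
  shows "(\<lambda>z. indicator A (f z) :: complex) \<in> borel_measurable M"
  using measurable_compose[OF assms(1) borel_measurable_indicator[OF assms(2)]] .

lemma borel_measurable_bracket:
  "(\<lambda>z. bracket x y (fst (fst z)) (snd (fst z)) (snd z)) \<in> borel_measurable borel"
  unfolding bracket_def by (intro borel_measurable_continuous_onI continuous_intros) auto

lemma approximate_identity:
  fixes \<psi> :: "real \<times> real \<Rightarrow> complex"
  assumes n: "Re n \<ge> 1" and x: "x > 0" and S: "compact S" "S \<subseteq> half_plane"
    and \<psi>: "continuous_on UNIV \<psi>" "\<And>q. q \<notin> S \<Longrightarrow> \<psi> q = 0"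
    and \<epsilon>: "\<And>k::nat. \<epsilon> k > 0" "\<epsilon> \<longlonglongrightarrow> 0"
  shows "(\<lambda>k. LBINT z. indicator {0..pi} (snd z) * cpow (sin (snd z)) (n - 1) * cpow (fst (fst z)) n *
      \<psi> (fst z) * of_real ((\<epsilon> k)\<^sup>2) *
      cpow (bracket x y (fst (fst z)) (snd (fst z)) (snd z) + (\<epsilon> k)\<^sup>2) (- n / 2 - 2))
    \<longlonglongrightarrow> \<psi> (x, y) * (2 * of_real pi / (n * (n + 2)))"
proof -
  define K where "K e z = indicator {0..pi} (snd z) * cpow (sin (snd z)) (n - 1) * cpow (fst (fst z)) n *
      \<psi> (fst z) * of_real (e\<^sup>2) * cpow (bracket x y (fst (fst z)) (snd (fst z)) (snd z) + e\<^sup>2) (- n / 2 - 2)"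
    for e and z :: "(real \<times> real) \<times> real"
  \<comment> \<open>The regularised bracket at the rescaled point is e^2 times this
    quantity.\<close>
  define D where "D e z = 1 + (fst (fst z))\<^sup>2 + (snd (fst z))\<^sup>2 +
      4 * x * (x + e * fst (fst z)) * (sin (e * snd z / 2) / e)\<^sup>2" for e and z :: "(real \<times> real) \<times> real"
  \<comment> \<open>The powers of e cancel: 3 from the volume, 2 from the explicit factor, n - 1
    from the sine and -n - 4 from the bracket. Spelling out the cancelled form lets the limit be
    read off factor by factor.\<close>
  define g where "g e z = indicator {0..pi} (e * snd z) * cpow (sin (e * snd z) / e) (n - 1) *
      cpow (x + e * fst (fst z)) n * \<psi> (x + e * fst (fst z), y + e * snd (fst z)) *
      cpow (D e z) (- n / 2 - 2)" for e z
  have K_meas: "K e \<in> borel_measurable borel" for e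
    unfolding K_def
    by (intro borel_measurable_times borel_measurable_indicator_compose[where N=borel] cpow_measurable borel_measurable_add
          borel_measurable_bracket; (intro borel_measurable_continuous_onI continuous_intros continuous_on_compose2[OF \<psi>(1)])?; simp)
  have g_eq: "of_real (e ^ 3) * K e (((x, y), 0) + e *\<^sub>R z) = g e z" if e: "e > 0" for e z
  proof -
    obtain u v t where z: "z = ((u, v), t)" by (metis surj_pair)
    show ?thesis
    proof (cases "\<psi> (x + e * u, y + e * v) = 0 \<or> e * t \<notin> {0..pi}")
      case True
      then show ?thesis by (auto simp: z K_def g_def)
    next
      case False
      \<comment> \<open>Where \<psi> does not vanish, the rescaled point lies in S and hence in the
        half plane, so the bases of the powers split below have the right sign.\<close>
      then have xi: "x + e * u > 0" and t: "0 \<le> e * t" "e * t \<le> pi"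
        using \<psi>(2)[of "(x + e * u, y + e * v)"] S(2) by (auto simp: half_plane_iff subset_iff)
      have s: "sin (e * t) \<ge> 0" using t by (intro sin_ge_zero) auto
      have Dp: "D e z > 0"
        unfolding D_def z fst_conv snd_conv using xi x by (intro add_pos_nonneg add_pos_nonneg mult_nonneg_nonneg) auto
      have "cpow (sin (e * t)) (n - 1) = cpow (e * (sin (e * t) / e)) (n - 1)" using e by simp
      also have "\<dots> = cpow e (n - 1) * cpow (sin (e * t) / e) (n - 1)"
        using e s by (intro cpow_mult) auto
      finally have 1: "cpow (sin (e * t)) (n - 1) = cpow e n / of_real e * cpow (sin (e * t) / e) (n - 1)"
        using e by (simp add: cpow_minus_1)
      have "bracket x y (x + e * u) (y + e * v) (e * t) + e\<^sup>2 = e\<^sup>2 * D e z"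
        using e by (simp add: z bracket_def D_def power2_eq_square field_simps)
      then have "cpow (bracket x y (x + e * u) (y + e * v) (e * t) + e\<^sup>2) (- n / 2 - 2)
          = cpow (e\<^sup>2) (- n / 2 - 2) * cpow (D e z) (- n / 2 - 2)"
        using Dp by (simp add: cpow_mult)
      also have "cpow (e\<^sup>2) (- n / 2 - 2) = 1 / cpow e n / of_real (e ^ 4)"
      proof -
        have "cpow (e\<^sup>2) (- n / 2 - 2) = cpow (e\<^sup>2) (- n / 2) / of_real (e ^ 4)"
          using e cpow_minus_2[of "e\<^sup>2" "- n / 2"] by (simp add: eval_nat_numeral)
        also have "cpow (e\<^sup>2) (- n / 2) = 1 / cpow e n"
          using e cpow_square[of e "- n / 2"] by (simp add: cpow_minus)
        finally show ?thesis .
      qed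
      finally have 2: "cpow (bracket x y (x + e * u) (y + e * v) (e * t) + e\<^sup>2) (- n / 2 - 2)
          = 1 / cpow e n / of_real (e ^ 4) * cpow (D e z) (- n / 2 - 2)" .
      have "e ^ 3 * e\<^sup>2 = e * e ^ 4" by (simp add: eval_nat_numeral)
      then have c: "of_real (e ^ 3) * (cpow e n / of_real e * of_real (e\<^sup>2) * (1 / cpow e n / of_real (e ^ 4))) = (1::complex)"
        using e by (simp add: field_simps) (simp flip: of_real_mult of_real_power add: mult_ac)
      have Kz: "K e (((x, y), 0) + e *\<^sub>R z) = cpow (sin (e * t)) (n - 1) * cpow (x + e * u) n *
          \<psi> (x + e * u, y + e * v) * of_real (e\<^sup>2) *
          cpow (bracket x y (x + e * u) (y + e * v) (e * t) + e\<^sup>2) (- n / 2 - 2)"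
        using t by (simp add: K_def z)
      have gz: "g e z = cpow (sin (e * t) / e) (n - 1) * cpow (x + e * u) n *
          \<psi> (x + e * u, y + e * v) * cpow (D e z) (- n / 2 - 2)"
        using t by (simp add: g_def z)
      have "of_real (e ^ 3) * K e (((x, y), 0) + e *\<^sub>R z) =
         (of_real (e ^ 3) * (cpow e n / of_real e * of_real (e\<^sup>2) * (1 / cpow e n / of_real (e ^ 4)))) * g e z"
        unfolding Kz gz 1 2 by (simp only: mult_ac)
      then show ?thesis unfolding c by simp
    qed
  qed
  have g_meas: "g e \<in> borel_measurable borel" if e: "e > 0" for e
  proof -
    have "(\<lambda>z. of_real (e ^ 3) * K e (((x, y), 0) + e *\<^sub>R z)) \<in> borel_measurable borel"
      by (rule borel_measurable_times[OF borel_measurable_const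
            measurable_compose[OF borel_measurable_continuous_onI K_meas]]) (intro continuous_intros)
    then show ?thesis by (simp only: g_eq[OF e])
  qed
  have scale: "integral\<^sup>L lborel (K e) = integral\<^sup>L lborel (g e)" if e: "e > 0" for e
  proof -
    have "integral\<^sup>L lborel (K e) = of_real (e ^ 3) * (LBINT z. K e (((x, y), 0) + e *\<^sub>R z))"
      using lborel_integral_affine[OF K_meas e, of e "((x, y), 0)"] by (simp add: power3_eq_cube)
    also have "\<dots> = (LBINT z. of_real (e ^ 3) * K e (((x, y), 0) + e *\<^sub>R z))" by simp
    finally show ?thesis by (simp only: g_eq[OF e])
  qed
  obtain lo hi a b where lo: "lo > 0" "lo \<le> hi" "S \<subseteq> {lo..hi} \<times> {a..b}"
    using compact_half_plane_bounds[OF S] .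
  obtain M where M: "M \<ge> 0" "\<And>q. q \<in> S \<Longrightarrow> norm (\<psi> q) \<le> M"
    using compact_bound[OF S(1) continuous_on_subset[OF \<psi>(1)]] by blast
  define c where "c = 4 * x * lo / pi\<^sup>2"
  have c: "c > 0" using x lo by (simp add: c_def)
  obtain C where C: "C \<ge> 0" "\<And>u v t X. t > 0 \<Longrightarrow> X \<ge> 1 + u\<^sup>2 + v\<^sup>2 + c * t\<^sup>2 \<Longrightarrow>
    t powr (Re n - 1) * X powr (- Re n / 2 - 2) \<le> C * decay ((u, v), t)"
    using powr_le_decay[of "Re n" c] n c by metis
  have dnn: "decay z \<ge> 0" for z by (simp add: decay_def)
  have bound: "norm (g e z) \<le> hi powr Re n * M * C * decay z" if e: "e > 0" for e z
  proof -
    obtain u v t where z: "z = ((u, v), t)" by (metis surj_pair)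
    show ?thesis
    proof (cases "(x + e * u, y + e * v) \<in> S \<and> 0 < e * t \<and> e * t \<le> pi")
      case False
      then have "g e z = 0" using \<psi>(2) e by (auto simp: z g_def cpow_def indicator_def)
      then show ?thesis using M(1) C(1) dnn by (simp add: mult_nonneg_nonneg)
    next
      case True
      then have t: "0 < t" "e * t \<le> pi" and xi: "lo \<le> x + e * u" "x + e * u \<le> hi"
        using lo e by (auto simp: zero_less_mult_iff)
      have s: "sin (e * t) \<ge> 0" using t e by (intro sin_ge_zero) auto
      have s2: "sin (e * t) / e \<le> t" using sin_x_le_x[of "e * t"] t e by (simp add: field_simps)
      have "sin (e * t / 2) \<ge> e * t / pi" using sin_ge_linear[of "e * t / 2"] t e by simp
      then have "t / pi \<le> sin (e * t / 2) / e" using e by (simp add: field_simps)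
      then have "(t / pi)\<^sup>2 \<le> (sin (e * t / 2) / e)\<^sup>2" using t by (intro power_mono) auto
      then have "4 * x * lo * (t / pi)\<^sup>2 \<le> 4 * x * (x + e * u) * (sin (e * t / 2) / e)\<^sup>2"
        using x lo xi by (intro mult_mono) auto
      then have D: "D e z \<ge> 1 + u\<^sup>2 + v\<^sup>2 + c * t\<^sup>2" by (simp add: D_def z c_def power_divide)
      moreover have "1 + u\<^sup>2 + v\<^sup>2 + c * t\<^sup>2 > 0" using c by (intro add_pos_nonneg) auto
      ultimately have D0: "D e z \<ge> 0" by linarith
      have "norm (g e z) = (sin (e * t) / e) powr (Re n - 1) * (x + e * u) powr Re n *
          norm (\<psi> (x + e * u, y + e * v)) * D e z powr (- Re n / 2 - 2)"
        using True t xi s e lo D0 by (simp add: g_def z norm_mult norm_cpow)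
      also have "\<dots> \<le> t powr (Re n - 1) * hi powr Re n * M * D e z powr (- Re n / 2 - 2)"
      proof -
        have "(sin (e * t) / e) powr (Re n - 1) \<le> t powr (Re n - 1)"
          using s s2 e n by (intro powr_mono2) auto
        moreover have "(x + e * u) powr Re n \<le> hi powr Re n"
          using xi lo n by (intro powr_mono2) auto
        ultimately show ?thesis
          using M True by (intro mult_mono order_refl mult_nonneg_nonneg) auto
      qed
      also have "\<dots> = hi powr Re n * M * (t powr (Re n - 1) * D e z powr (- Re n / 2 - 2))" by simp
      also have "\<dots> \<le> hi powr Re n * M * (C * decay ((u, v), t))"
        using M by (intro mult_left_mono C(2) t D) auto
      finally show ?thesis by (simp add: z mult_ac)
    qed
  qed
  have \<epsilon>0: "filterlim \<epsilon> (at_right 0) sequentially"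
    using \<epsilon> by (auto simp: filterlim_at less_imp_neq[symmetric])
  have lim: "(\<lambda>k. g (\<epsilon> k) z) \<longlonglongrightarrow> \<psi> (x, y) * profile n x z" for z
  proof -
    obtain u v t where z: "z = ((u, v), t)" by (metis surj_pair)
    show ?thesis
    proof (cases "t > 0")
      \<comment> \<open>For t \<le> 0 nothing has to converge: at t = 0 the power of the sine is 0,
        at t < 0 the indicator is.\<close>
      case False
      then have "profile n x z = 0" by (simp add: z profile_def cpow_def)
      moreover have "g (\<epsilon> k) z = 0" for k
      proof (cases "t = 0")
        case True
        then show ?thesis by (simp add: z g_def cpow_def)
      next
        case nz: False
        then have "\<epsilon> k * t < 0" using False \<epsilon>(1)[of k] by (intro mult_pos_neg) auto
        then show ?thesis by (simp add: z g_def)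
      qed
      ultimately show ?thesis by simp
    next
      case True
      have e0: "((\<lambda>e::real. e) \<longlongrightarrow> 0) (at_right 0)" by (rule tendsto_ident_at)
      have D: "((\<lambda>e. D e z) \<longlongrightarrow> 1 + u\<^sup>2 + v\<^sup>2 + x\<^sup>2 * t\<^sup>2) (at_right 0)"
      proof -
        \<comment> \<open>The square of the limit t/2 turns the coefficient 4 x \<xi>, with \<xi>
          tending to x, into the x^2 of the profile.\<close>
        have A: "((\<lambda>e. sin (e * t / 2) / e) \<longlongrightarrow> t / 2) (at_right 0)" by real_asymp
        have "((\<lambda>e. D e z) \<longlongrightarrow> 1 + u\<^sup>2 + v\<^sup>2 + 4 * x * (x + 0 * u) * (t / 2)\<^sup>2) (at_right 0)"
          unfolding D_def z fst_conv snd_conv by (intro tendsto_add tendsto_mult tendsto_power tendsto_const e0 A)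
        then show ?thesis by (simp add: power2_eq_square mult.assoc)
      qed
      have "((\<lambda>e. \<psi> (x + e * u, y + e * v)) \<longlongrightarrow> \<psi> (x + 0 * u, y + 0 * v)) (at_right 0)"
        by (rule continuous_on_tendsto_compose[OF \<psi>(1)]) (intro tendsto_intros e0 | simp)+
      moreover have "((\<lambda>e. cpow (x + e * u) n) \<longlongrightarrow> cpow (x + 0 * u) n) (at_right 0)"
        by (rule tendsto_cpow) (intro tendsto_intros e0 | simp add: x)+
      moreover have "((\<lambda>e. cpow (sin (e * t) / e) (n - 1)) \<longlongrightarrow> cpow t (n - 1)) (at_right 0)"
        by (rule tendsto_cpow[OF _ True]) real_asymp
      moreover have "((\<lambda>e. cpow (D e z) (- n / 2 - 2)) \<longlongrightarrow> cpow (1 + u\<^sup>2 + v\<^sup>2 + x\<^sup>2 * t\<^sup>2) (- n / 2 - 2)) (at_right 0)"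
        by (rule tendsto_cpow[OF D]) (intro add_pos_nonneg; simp)
      moreover have "((\<lambda>e. indicator {0..pi} (e * t)) \<longlongrightarrow> (1::complex)) (at_right 0)"
      proof (rule tendsto_eventually)
        have "\<forall>\<^sub>F e in at_right 0. e * t < pi"
          by (rule order_tendstoD(2)[of _ "0 * t"]) (intro tendsto_intros e0 | simp)+
        moreover have "\<forall>\<^sub>F e in at_right 0. e > (0::real)" by (simp add: eventually_at_filter)
        ultimately show "\<forall>\<^sub>F e in at_right 0. indicator {0..pi} (e * t) = (1::complex)"
          by eventually_elim (use True in auto)
      qed
      ultimately have "((\<lambda>e. g e z) \<longlongrightarrow> 1 * cpow t (n - 1) * cpow (x + 0 * u) n * \<psi> (x + 0 * u, y + 0 * v) *
          cpow (1 + u\<^sup>2 + v\<^sup>2 + x\<^sup>2 * t\<^sup>2) (- n / 2 - 2)) (at_right 0)"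
        unfolding g_def z fst_conv snd_conv by (intro tendsto_mult)
      then have "((\<lambda>e. g e z) \<longlongrightarrow> \<psi> (x, y) * profile n x z) (at_right 0)"
        by (simp add: profile_def z mult_ac)
      from filterlim_compose[OF this \<epsilon>0] show ?thesis .
    qed
  qed
  have "(\<lambda>k. integral\<^sup>L lborel (g (\<epsilon> k))) \<longlonglongrightarrow> (LBINT z. \<psi> (x, y) * profile n x z)"
  proof (rule integral_dominated_convergence[where w="\<lambda>z. hi powr Re n * M * C * decay z"])
    show "(\<lambda>z. \<psi> (x, y) * profile n x z) \<in> borel_measurable lborel"
      by (rule borel_measurable_LIMSEQ_metric[of "\<lambda>k. g (\<epsilon> k)"]) (use lim g_meas \<epsilon> in auto)
  qed (use lim bound \<epsilon> decay_integrable g_meas in auto)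
  then have "(\<lambda>k. integral\<^sup>L lborel (K (\<epsilon> k))) \<longlonglongrightarrow> \<psi> (x, y) * (2 * of_real pi / (n * (n + 2)))"
    using \<epsilon>(1) by (simp add: scale profile_integral[OF n x])
  then show ?thesis unfolding K_def .
qed

section \<open>Integration by parts for the regularised kernel\<close>

text \<open>The open sets H and - S cover the space, and f is continuous on each of them.\<close>

lemma continuous_on_extend_zero:
  fixes f :: "'a::topological_space \<Rightarrow> 'b::{topological_space,zero}"
  assumes "open H" "closed S" "S \<subseteq> H" "continuous_on H f" "\<And>q. q \<notin> S \<Longrightarrow> f q = 0"
  shows "continuous_on UNIV f"
proof -
  have "continuous_on (- S) f"
    by (rule continuous_on_eq[OF continuous_on_const[of _ 0]]) (use assms(5) in auto)
  with assms have "continuous_on (H \<union> - S) f"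
    by (intro continuous_on_open_Un) auto
  moreover have "H \<union> - S = UNIV" using assms(3) by auto
  ultimately show ?thesis by simp
qed

lemma has_vector_derivative_extend_zero:
  fixes g :: "real \<Rightarrow> 'b::real_normed_vector"
  assumes "closed S" "u \<notin> S" "\<And>t. t \<notin> S \<Longrightarrow> g t = 0"
  shows "(g has_vector_derivative 0) (at u)"
  unfolding has_vector_derivative_def
proof (rule has_derivative_transform_within_open[of "\<lambda>_. 0" _ _ _ "- S"])
  show "((\<lambda>_. 0) has_derivative (\<lambda>x. x *\<^sub>R 0)) (at u)" by simp
qed (use assms in auto)

lemma integrable_continuous_compact_support:
  fixes f :: "'a::euclidean_space \<Rightarrow> 'b::euclidean_space"
  assumes "compact S" "continuous_on S f" "\<And>q. q \<notin> S \<Longrightarrow> f q = 0"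
  shows "integrable lborel f"
proof -
  have "(\<lambda>q. indicat_real S q *\<^sub>R f q) = f" using assms(3) by (auto simp: indicator_def)
  then show ?thesis using borel_integrable_compact[OF assms(1,2)] by simp
qed

lemma integral_derivative_compact_support:
  fixes g g' :: "real \<Rightarrow> complex"
  assumes "compact S" "\<And>t. (g has_vector_derivative g' t) (at t)" "continuous_on UNIV g'"
    "\<And>t. t \<notin> S \<Longrightarrow> g t = 0" "\<And>t. t \<notin> S \<Longrightarrow> g' t = 0"
  shows "integral\<^sup>L lborel g' = 0"
proof -
  obtain R where R: "R > 0" "\<And>t. t \<in> S \<Longrightarrow> \<bar>t\<bar> \<le> R"
    using compact_imp_bounded[OF assms(1)] by (auto simp: bounded_pos)
  have "integral\<^sup>L lborel (\<lambda>t. indicator {- (R + 1)..R + 1} t *\<^sub>R g' t) = g (R + 1) - g (- (R + 1))"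
    by (rule integral_FTC_Icc)
      (use R assms in \<open>auto intro: has_vector_derivative_at_within continuous_on_subset\<close>)
  also have "(\<lambda>t. indicator {- (R + 1)..R + 1} t *\<^sub>R g' t) = g'"
    using assms(5) R(2) by (force simp: indicator_def)
  also have "g (R + 1) = 0" using assms(4) R by (metis abs_of_pos add_pos_pos less_add_one not_le zero_less_one)
  also have "g (- (R + 1)) = 0"
    using assms(4)[of "- (R + 1)"] R(2)[of "- (R + 1)"] R(1) by auto
  finally show ?thesis by simp
qed

text \<open>Fubini with the differentiated variable innermost, then the fundamental theorem on each
  line. Derivatives are assumed on H only; a point of the line outside H lies outside the closed set
  S, so g vanishes near it and the slice is differentiable there too.\<close>

lemma integral_partial_derivative_zero:
  fixes g g1 g2 :: "real \<times> real \<Rightarrow> complex"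
  assumes S: "compact S" "S \<subseteq> H" and H: "open H" and z: "\<And>q. q \<notin> S \<Longrightarrow> g q = 0"
  shows "\<lbrakk>\<And>q. q \<in> H \<Longrightarrow> ((\<lambda>t. g (t, snd q)) has_vector_derivative g1 q) (at (fst q));
      continuous_on H g1; \<And>q. q \<notin> S \<Longrightarrow> g1 q = 0\<rbrakk> \<Longrightarrow> integral\<^sup>L lborel g1 = 0"
    and "\<lbrakk>\<And>q. q \<in> H \<Longrightarrow> ((\<lambda>t. g (fst q, t)) has_vector_derivative g2 q) (at (snd q));
      continuous_on H g2; \<And>q. q \<notin> S \<Longrightarrow> g2 q = 0\<rbrakk> \<Longrightarrow> integral\<^sup>L lborel g2 = 0"
proof -
  have cl: "closed S" using S by (simp add: compact_imp_closed)
  have c1: "compact (fst ` S)" "compact (snd ` S)"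
    using S(1) by (auto intro!: compact_continuous_image continuous_intros)
  {
    assume d: "\<And>q. q \<in> H \<Longrightarrow> ((\<lambda>t. g (t, snd q)) has_vector_derivative g1 q) (at (fst q))"
      and c: "continuous_on H g1" and z1: "\<And>q. q \<notin> S \<Longrightarrow> g1 q = 0"
    have cU: "continuous_on UNIV g1" by (rule continuous_on_extend_zero[OF H cl S(2) c z1])
    have "integrable lborel g1"
      by (rule integrable_continuous_compact_support[OF S(1) continuous_on_subset[OF cU]]) (use z1 in auto)
    then have "integral\<^sup>L lborel g1 = (LBINT v. LBINT u. g1 (u, v))"
      using lborel_pair.integral_snd[of "\<lambda>u v. g1 (u, v)"] by (simp add: lborel_prod)
    moreover have "(LBINT u. g1 (u, v)) = 0" for v
    proof (rule integral_derivative_compact_support[OF c1(1), where g="\<lambda>u. g (u, v)"])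
      fix t
      show "((\<lambda>u. g (u, v)) has_vector_derivative g1 (t, v)) (at t)"
      proof (cases "(t, v) \<in> H")
        case True
        then show ?thesis using d[of "(t, v)"] by simp
      next
        case False
        then have "(t, v) \<notin> S" using S by auto
        have "closed ((\<lambda>u. (u, v)) -` S)" by (intro closed_vimage cl continuous_intros)
        from has_vector_derivative_extend_zero[OF this, of t "\<lambda>u. g (u, v)"] \<open>(t, v) \<notin> S\<close>
        show ?thesis using z z1 by simp
      qed
    next
      show "continuous_on UNIV (\<lambda>u. g1 (u, v))"
        by (rule continuous_on_compose2[OF cU]) (auto intro!: continuous_intros)
    qed (use z z1 in force)+
    ultimately show "integral\<^sup>L lborel g1 = 0" by simp
  }
  {
    assume d: "\<And>q. q \<in> H \<Longrightarrow> ((\<lambda>t. g (fst q, t)) has_vector_derivative g2 q) (at (snd q))"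
      and c: "continuous_on H g2" and z2: "\<And>q. q \<notin> S \<Longrightarrow> g2 q = 0"
    have cU: "continuous_on UNIV g2" by (rule continuous_on_extend_zero[OF H cl S(2) c z2])
    have "integrable lborel g2"
      by (rule integrable_continuous_compact_support[OF S(1) continuous_on_subset[OF cU]]) (use z2 in auto)
    then have "integral\<^sup>L lborel g2 = (LBINT u. LBINT v. g2 (u, v))"
      using lborel_pair.integral_fst[of "\<lambda>u v. g2 (u, v)"] by (simp add: lborel_prod)
    moreover have "(LBINT v. g2 (u, v)) = 0" for u
    proof (rule integral_derivative_compact_support[OF c1(2), where g="\<lambda>v. g (u, v)"])
      fix t
      show "((\<lambda>v. g (u, v)) has_vector_derivative g2 (u, t)) (at t)"
      proof (cases "(u, t) \<in> H")
        case True
        then show ?thesis using d[of "(u, t)"] by simp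
      next
        case False
        then have "(u, t) \<notin> S" using S by auto
        have "closed ((\<lambda>v. (u, v)) -` S)" by (intro closed_vimage cl continuous_intros)
        from has_vector_derivative_extend_zero[OF this, of t "\<lambda>v. g (u, v)"] \<open>(u, t) \<notin> S\<close>
        show ?thesis using z z2 by simp
      qed
    next
      show "continuous_on UNIV (\<lambda>v. g2 (u, v))"
        by (rule continuous_on_compose2[OF cU]) (auto intro!: continuous_intros)
    qed (use z z2 in force)+
    ultimately show "integral\<^sup>L lborel g2 = 0" by simp
  }
qed

section \<open>The angular weight on [0, pi]\<close>

definition sin_weight :: "complex \<Rightarrow> real \<Rightarrow> complex" where
  "sin_weight n \<theta> = indicator {0..pi} \<theta> * cpow (sin \<theta>) (n - 1)"

lemma sin_weight_measurable: "sin_weight n \<in> borel_measurable borel"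
  unfolding sin_weight_def
  by (intro borel_measurable_times cpow_measurable) (auto intro!: borel_measurable_continuous_onI continuous_intros)

lemma norm_sin_weight: "0 \<le> \<theta> \<Longrightarrow> \<theta> \<le> pi \<Longrightarrow> norm (sin_weight n \<theta>) = sin \<theta> powr (Re n - 1)"
  by (simp add: sin_weight_def norm_cpow sin_ge_zero)

lemma norm_sin_weight_le: "Re n \<ge> 1 \<Longrightarrow> norm (sin_weight n \<theta>) \<le> indicator {0..pi} \<theta>"
  by (cases "\<theta> \<in> {0..pi}")
    (auto simp: norm_sin_weight powr_le1 sin_ge_zero, auto simp: sin_weight_def)

lemma norm_sin_weight_le_1: "Re n \<ge> 1 \<Longrightarrow> norm (sin_weight n \<theta>) \<le> 1"
  by (rule order_trans[OF norm_sin_weight_le]) (simp_all add: indicator_def)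

lemma set_integrable_sin_powr:
  fixes g :: "real \<Rightarrow> complex"
  assumes n: "Re n \<ge> 1" and g: "continuous_on {0..pi} g"
  shows "set_integrable lborel {0..pi} (\<lambda>\<theta>. cpow (sin \<theta>) (n - 1) * g \<theta>)"
proof -
  have i: "integrable lborel (\<lambda>\<theta>. indicat_real {0..pi} \<theta> *\<^sub>R g \<theta>)"
    by (intro borel_integrable_compact g) simp
  have eq: "indicat_real {0..pi} \<theta> *\<^sub>R (cpow (sin \<theta>) (n - 1) * g \<theta>) =
      sin_weight n \<theta> * (indicat_real {0..pi} \<theta> *\<^sub>R g \<theta>)" for \<theta>
    by (simp add: sin_weight_def indicator_def)
  show ?thesis
    unfolding set_integrable_def eq
  proof (rule Bochner_Integration.integrable_bound[OF i])
    show "(\<lambda>\<theta>. sin_weight n \<theta> * (indicat_real {0..pi} \<theta> *\<^sub>R g \<theta>)) \<in> borel_measurable lborel"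
      using borel_measurable_integrable[OF i] sin_weight_measurable[of n]
      by (intro borel_measurable_times) simp_all
    show "AE \<theta> in lborel. norm (sin_weight n \<theta> * (indicat_real {0..pi} \<theta> *\<^sub>R g \<theta>)) \<le> norm (indicat_real {0..pi} \<theta> *\<^sub>R g \<theta>)"
      unfolding norm_mult by (intro AE_I2 mult_left_le_one_le norm_sin_weight_le_1 n) auto
  qed
qed

text \<open>For Re n = 1 the weight need not be continuous at 0 and pi. Integrability therefore
  comes from its bound 1 and from h, which is continuous on the compact set S \<times>
  [0, pi].\<close>

lemma integrable_sin_weight:
  fixes h :: "(real \<times> real) \<times> real \<Rightarrow> complex"
  assumes n: "Re n \<ge> 1" and S: "compact S" "S \<subseteq> half_plane"
    and h: "continuous_on (half_plane \<times> UNIV) h" "\<And>q \<theta>. q \<notin> S \<Longrightarrow> h (q, \<theta>) = 0"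
  shows "integrable lborel (\<lambda>z. sin_weight n (snd z) * h z)"
proof -
  have i: "integrable lborel (\<lambda>z. indicat_real (S \<times> {0..pi}) z *\<^sub>R h z)"
    using S by (intro borel_integrable_compact compact_Times continuous_on_subset[OF h(1)]) auto
  have "integrable lborel (\<lambda>z. sin_weight n (snd z) * (indicat_real (S \<times> {0..pi}) z *\<^sub>R h z))"
  proof (rule Bochner_Integration.integrable_bound[OF i])
    show "(\<lambda>z. sin_weight n (snd z) * (indicat_real (S \<times> {0..pi}) z *\<^sub>R h z)) \<in> borel_measurable lborel"
    proof (rule borel_measurable_times[OF _ borel_measurable_integrable[OF i]])
      have "snd \<in> borel \<rightarrow>\<^sub>M (borel :: real measure)"
        by (intro borel_measurable_continuous_onI continuous_intros)
      from measurable_compose[OF this sin_weight_measurable]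
      show "(\<lambda>z::(real \<times> real) \<times> real. sin_weight n (snd z)) \<in> borel_measurable lborel" by simp
    qed
    have "norm (sin_weight n (snd z) * v) \<le> norm v" for z :: "(real \<times> real) \<times> real" and v
      using mult_right_mono[OF norm_sin_weight_le_1[OF n], of "norm v"] by (simp add: norm_mult)
    then show "AE z in lborel. norm (sin_weight n (snd z) * (indicat_real (S \<times> {0..pi}) z *\<^sub>R h z))
        \<le> norm (indicat_real (S \<times> {0..pi}) z *\<^sub>R h z)" by (intro AE_I2)
  qed
  moreover have "sin_weight n (snd z) * (indicat_real (S \<times> {0..pi}) z *\<^sub>R h z) = sin_weight n (snd z) * h z" for z
    using h(2) by (cases z) (auto simp: sin_weight_def indicator_def)
  ultimately show ?thesis by simp
qed

section \<open>Derivatives of the regularised kernel and Green's identity\<close>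

lemma has_vector_derivative_cpow_half:
  assumes "(f has_real_derivative 2 * d) (at t)" "f t > 0"
  shows "((\<lambda>t. cpow (f t) (- n / 2)) has_vector_derivative - n * of_real d * cpow (f t) (- n / 2) / of_real (f t)) (at t)"
  using has_vector_derivative_cpow[OF assms, of "- n / 2"] by simp

text \<open>Dividing by f lowers the exponent from -n/2 to -(n+2)/2, so n + 2 replaces n in the
  coefficient.\<close>

lemma has_vector_derivative_cpow_half_div:
  assumes "(f has_real_derivative 2 * d) (at t)" "f t > 0"
  shows "((\<lambda>t. cpow (f t) (- n / 2) / of_real (f t)) has_vector_derivative
    - (n + 2) * of_real d * cpow (f t) (- n / 2) / (of_real (f t))\<^sup>2) (at t)"
proof -
  \<comment> \<open>Both sides are 0 for u \<le> 0, so the equation is unconditional and can rewrite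
    under the binder.\<close>
  have "cpow u (- n / 2 - 1) = cpow u (- n / 2) / of_real u" for u
    using cpow_minus_1[of u] by (cases "u > 0") (auto simp: cpow_def)
  note * = has_vector_derivative_cpow[OF assms, of "- n / 2 - 1", unfolded this]
  have half: "- n / 2 - 1 = - (n + 2) / 2" by (simp add: field_simps)
  show ?thesis
    by (rule has_vector_derivative_eq_rhs[OF *]) (unfold half, simp add: power2_eq_square)
qed

text \<open>The derivatives of \<psi> are parameters so that \<xi>^s \<phi> can be inserted with
  explicit formulas. These have to hold on the half plane only; the compact set S keeps everything
  away from its boundary.\<close>

locale weinstein_test =
  fixes n :: complex and x y :: real and S :: "(real \<times> real) set"
    and \<psi> \<psi>1 \<psi>2 \<psi>11 \<psi>22 :: "real \<times> real \<Rightarrow> complex"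
  assumes n: "Re n \<ge> 1" and x: "x > 0" and S: "compact S" "S \<subseteq> half_plane"
    and zero: "\<And>q. q \<notin> S \<Longrightarrow> \<psi> q = 0" "\<And>q. q \<notin> S \<Longrightarrow> \<psi>1 q = 0" "\<And>q. q \<notin> S \<Longrightarrow> \<psi>2 q = 0"
      "\<And>q. q \<notin> S \<Longrightarrow> \<psi>11 q = 0" "\<And>q. q \<notin> S \<Longrightarrow> \<psi>22 q = 0"
    and cont: "continuous_on half_plane \<psi>" "continuous_on half_plane \<psi>1" "continuous_on half_plane \<psi>2"
      "continuous_on half_plane \<psi>11" "continuous_on half_plane \<psi>22"
    and d1: "\<And>q. q \<in> half_plane \<Longrightarrow> ((\<lambda>t. \<psi> (t, snd q)) has_vector_derivative \<psi>1 q) (at (fst q))"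
    and d2: "\<And>q. q \<in> half_plane \<Longrightarrow> ((\<lambda>t. \<psi> (fst q, t)) has_vector_derivative \<psi>2 q) (at (snd q))"
    and d11: "\<And>q. q \<in> half_plane \<Longrightarrow> ((\<lambda>t. \<psi>1 (t, snd q)) has_vector_derivative \<psi>11 q) (at (fst q))"
    and d22: "\<And>q. q \<in> half_plane \<Longrightarrow> ((\<lambda>t. \<psi>2 (fst q, t)) has_vector_derivative \<psi>22 q) (at (snd q))"
begin

definition L\<psi> :: "real \<times> real \<Rightarrow> complex" where
  "L\<psi> q = \<psi>11 q + \<psi>22 q + n / of_real (fst q) * \<psi>1 q"

definition B :: "real \<Rightarrow> (real \<times> real) \<times> real \<Rightarrow> real" where
  "B e z = bracket x y (fst (fst z)) (snd (fst z)) (snd z) + e"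

definition F :: "real \<Rightarrow> (real \<times> real) \<times> real \<Rightarrow> complex" where
  "F e z = cpow (B e z) (- n / 2)"

text \<open>With the weight \<open>sin_weight n \<theta>\<close>, \<open>dP\<close> and \<open>dQ\<close> are the \<open>\<xi>\<close>- and the \<open>\<eta>\<close>-derivative of
  \<open>\<xi>^n (F \<partial>\<psi> - \<psi> \<partial>F)\<close>, and \<open>dR\<close> is the \<open>\<theta>\<close>-derivative of \<open>sin(\<theta>)^(n-1) \<partial>F/\<partial>\<theta>\<close>.\<close>

definition dP where
  "dP e z = cpow (fst (fst z)) n * (n / of_real (fst (fst z)) *
     (F e z * \<psi>1 (fst z) + \<psi> (fst z) * (n * of_real (fst (fst z) - x * cos (snd z)) * F e z / of_real (B e z)))
     + F e z * \<psi>11 (fst z) + \<psi> (fst z) * (n * F e z / of_real (B e z)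
       - n * (n + 2) * of_real ((fst (fst z) - x * cos (snd z))\<^sup>2) * F e z / (of_real (B e z))\<^sup>2))"

definition dQ where
  "dQ e z = cpow (fst (fst z)) n * (F e z * \<psi>22 (fst z) + \<psi> (fst z) * (n * F e z / of_real (B e z)
       - n * (n + 2) * of_real ((snd (fst z) - y)\<^sup>2) * F e z / (of_real (B e z))\<^sup>2))"

definition dR where
  "dR e z = - n * of_real (x * fst (fst z)) * (n * of_real (cos (snd z)) * F e z / of_real (B e z)
     - (n + 2) * of_real (x * fst (fst z) * (sin (snd z))\<^sup>2) * F e z / (of_real (B e z))\<^sup>2)"

lemma B_pos: "e > 0 \<Longrightarrow> fst (fst z) > 0 \<Longrightarrow> B e z > 0"
  unfolding B_def using bracket_nonneg[OF x] by (simp add: add_nonneg_pos)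

text \<open>The vector of length x is resolved into x cos \<theta> along and x sin \<theta> across
  the direction of \<xi>. The squares on the right are those produced by the \<xi>-, \<eta>- and
  \<theta>-derivatives of \<open>F\<close>, and together they restore B - e.\<close>

lemma B_eq: "B e z = (fst (fst z) - x * cos (snd z))\<^sup>2 + (snd (fst z) - y)\<^sup>2 + x\<^sup>2 * (sin (snd z))\<^sup>2 + e"
proof -
  have "x\<^sup>2 * (cos (snd z))\<^sup>2 + x\<^sup>2 * (sin (snd z))\<^sup>2 = x\<^sup>2" by (simp flip: distrib_left)
  then show ?thesis unfolding B_def bracket_eq_cos by (simp add: power2_diff power_mult_distrib algebra_simps)
qed

text \<open>Write L for \<open>L_n\<close>. Green's identity gives \<xi>^n (F L \<psi> - \<psi> L F)
  = dP + dQ. The full Laplacian L F + dR / \<xi>^2 of a radial power in dimension n + 2 is -n (n +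
  2) e F / B^2: the squares sum to B - e, and only e survives against the term of first order in
  1/B. Eliminating L F gives the claim.\<close>

lemma weinstein_identity:
  assumes e: "e > 0" and q: "fst (fst z) > 0"
  shows "cpow (fst (fst z)) n * (F e z * L\<psi> (fst z) + n * (n + 2) * of_real e * \<psi> (fst z) * F e z / (of_real (B e z))\<^sup>2)
    = dP e z + dQ e z - cpow (fst (fst z)) n / (of_real (fst (fst z)))\<^sup>2 * \<psi> (fst z) * dR e z"
proof -
  define \<xi> c s \<eta> b E p :: complex where "\<xi> = of_real (fst (fst z))" and "c = of_real (x * cos (snd z))" and "s = of_real (x * sin (snd z))"
    and "\<eta> = of_real (snd (fst z) - y)" and "b = of_real (B e z)" and "E = of_real e" and "p = \<psi> (fst z)"
  have b: "b = (\<xi> - c)\<^sup>2 + \<eta>\<^sup>2 + s\<^sup>2 + E"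
    unfolding b_def B_eq \<xi>_def c_def s_def \<eta>_def E_def by (simp add: power_mult_distrib)
  have nz: "\<xi> \<noteq> 0" "b \<noteq> 0" using q B_pos[OF e q] by (auto simp: \<xi>_def b_def)
  have key: "n * (n + 2) * E / b\<^sup>2 =
      (n / \<xi>) * (n * (\<xi> - c) / b) + 2 * n / b - n * (n + 2) * ((\<xi> - c)\<^sup>2 + \<eta>\<^sup>2) / b\<^sup>2
      + n / \<xi> * (n * c / b) - n * (n + 2) * s\<^sup>2 / b\<^sup>2"
  proof -
    \<comment> \<open>The two terms with 1/\<xi> recombine: \<xi> - c from the radial derivative and
      c from the angular one add up to \<xi>.\<close>
    have "(n / \<xi>) * (n * (\<xi> - c) / b) + n / \<xi> * (n * c / b) = n * n / b"
      using nz by (simp add: field_simps)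
    moreover have "n * n / b + 2 * n / b = n * (n + 2) * b / b\<^sup>2"
      using nz by (simp add: field_simps power2_eq_square)
    moreover have "n * (n + 2) * b / b\<^sup>2 - n * (n + 2) * ((\<xi> - c)\<^sup>2 + \<eta>\<^sup>2) / b\<^sup>2 - n * (n + 2) * s\<^sup>2 / b\<^sup>2
        = n * (n + 2) * E / b\<^sup>2"
      by (simp add: b add_divide_distrib[symmetric] diff_divide_distrib[symmetric] algebra_simps)
    ultimately show ?thesis by (simp add: algebra_simps)
  qed
  have R: "dR e z = - (n * \<xi>) * (n * c / b - (n + 2) * \<xi> * s\<^sup>2 / b\<^sup>2) * F e z"
    unfolding dR_def b_def[symmetric] \<xi>_def c_def s_def by (simp add: power2_eq_square algebra_simps)
  have "dP e z + dQ e z - cpow (fst (fst z)) n / \<xi>\<^sup>2 * p * dR e z =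
     cpow (fst (fst z)) n * F e z * (L\<psi> (fst z) + p * ((n / \<xi>) * (n * (\<xi> - c) / b) + 2 * n / b - n * (n + 2) * ((\<xi> - c)\<^sup>2 + \<eta>\<^sup>2) / b\<^sup>2
      + n / \<xi> * (n * c / b) - n * (n + 2) * s\<^sup>2 / b\<^sup>2))"
  proof -
    have 1: "cpow (fst (fst z)) n / \<xi>\<^sup>2 * p * dR e z =
        cpow (fst (fst z)) n * F e z * p * (- (n / \<xi> * (n * c / b)) + n * (n + 2) * s\<^sup>2 / b\<^sup>2)"
      unfolding R using nz by (simp add: field_simps power2_eq_square)
    have 2: "dP e z = cpow (fst (fst z)) n * F e z * (n / \<xi> * \<psi>1 (fst z) + \<psi>11 (fst z) +
        p * (n / \<xi> * (n * (\<xi> - c) / b) + n / b - n * (n + 2) * (\<xi> - c)\<^sup>2 / b\<^sup>2))"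
      unfolding dP_def b_def[symmetric] p_def[symmetric] \<xi>_def c_def by (simp add: algebra_simps)
    have 3: "dQ e z = cpow (fst (fst z)) n * F e z * (\<psi>22 (fst z) + p * (n / b - n * (n + 2) * \<eta>\<^sup>2 / b\<^sup>2))"
      unfolding dQ_def b_def[symmetric] p_def[symmetric] \<eta>_def by (simp add: algebra_simps)
    show ?thesis
      unfolding 1 2 3 L\<psi>_def \<xi>_def[symmetric] by (simp add: algebra_simps add_divide_distrib)
  qed
  also have "\<dots> = cpow (fst (fst z)) n * (F e z * L\<psi> (fst z) + n * (n + 2) * E * p * F e z / b\<^sup>2)"
    unfolding key[symmetric] by (simp add: algebra_simps)
  finally show ?thesis unfolding \<xi>_def p_def E_def b_def by simp
qed

lemma cont3 [continuous_intros]: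
  "continuous_on (half_plane \<times> UNIV) (\<lambda>z. \<psi> (fst z))" "continuous_on (half_plane \<times> UNIV) (\<lambda>z. \<psi>1 (fst z))"
  "continuous_on (half_plane \<times> UNIV) (\<lambda>z. \<psi>11 (fst z))" "continuous_on (half_plane \<times> UNIV) (\<lambda>z. \<psi>22 (fst z))"
  by (rule continuous_on_compose2[OF cont(1)] continuous_on_compose2[OF cont(2)]
      continuous_on_compose2[OF cont(4)] continuous_on_compose2[OF cont(5)];
      (intro continuous_intros)?; auto)+

lemma cont_B: "continuous_on A (B e)"
  unfolding B_def bracket_def by (intro continuous_intros) auto

lemma cont_F: "e > 0 \<Longrightarrow> continuous_on (half_plane \<times> UNIV) (F e)"
  unfolding F_def by (intro continuous_on_cpow cont_B B_pos) (auto simp: half_plane_iff)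

lemma cont_dP: "e > 0 \<Longrightarrow> continuous_on (half_plane \<times> UNIV) (dP e)"
  and cont_dQ: "e > 0 \<Longrightarrow> continuous_on (half_plane \<times> UNIV) (dQ e)"
  and cont_dR: "e > 0 \<Longrightarrow> continuous_on (half_plane \<times> UNIV) (dR e)"
proof -
  assume e: "e > 0"
  have nz: "\<forall>z\<in>half_plane \<times> UNIV. complex_of_real (B e z) \<noteq> 0"
  proof
    fix z :: "(real \<times> real) \<times> real" assume "z \<in> half_plane \<times> UNIV"
    then show "complex_of_real (B e z) \<noteq> 0"
      using B_pos[OF e, of z] by (cases z) (auto simp: half_plane_iff)
  qed
  then have nz2: "\<forall>z\<in>half_plane \<times> UNIV. (complex_of_real (B e z))\<^sup>2 \<noteq> 0" by simp
  have X: "\<And>z. z \<in> half_plane \<times> UNIV \<Longrightarrow> fst (fst z) > 0"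
    "\<forall>z\<in>half_plane \<times> UNIV. complex_of_real (fst (fst z)) \<noteq> 0"
    by (auto simp: half_plane_iff)
  show "continuous_on (half_plane \<times> UNIV) (dP e)" "continuous_on (half_plane \<times> UNIV) (dQ e)"
    "continuous_on (half_plane \<times> UNIV) (dR e)"
    unfolding dP_def dQ_def dR_def
    by (intro continuous_intros cont_F cont_B e nz nz2 X; assumption)+
qed

lemma L\<psi>_zero: "q \<notin> S \<Longrightarrow> L\<psi> q = 0"
  by (simp add: L\<psi>_def zero)

lemma cont_L\<psi>: "continuous_on half_plane L\<psi>"
  unfolding L\<psi>_def by (intro continuous_intros cont) (auto simp: half_plane_iff)

text \<open>Fubini in whichever order has a vanishing inner integral. For the \<xi>- and
  \<eta>-derivatives this is the integral over q, where the weight is a constant factor; for the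
  angular term it is the integral over \<theta>, where the weight is part of the derivative.\<close>

lemma integral_sin_weight_slices:
  assumes h: "continuous_on (half_plane \<times> UNIV) h" "\<And>q \<theta>. q \<notin> S \<Longrightarrow> h (q, \<theta>) = 0"
    and sl: "(\<forall>\<theta>. (LBINT q. h (q, \<theta>)) = 0) \<or> (\<forall>q. (LBINT \<theta>. sin_weight n \<theta> * h (q, \<theta>)) = 0)"
  shows "(LBINT z. sin_weight n (snd z) * h z) = 0"
proof -
  have i: "integrable (lborel \<Otimes>\<^sub>M lborel) (\<lambda>z. sin_weight n (snd z) * h z)"
    using integrable_sin_weight[OF n S h] by (simp add: lborel_prod)
  have sp: "(\<lambda>(q, \<theta>). sin_weight n \<theta> * h (q, \<theta>)) = (\<lambda>z. sin_weight n (snd z) * h z)" by auto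
  have 1: "(LBINT z. sin_weight n (snd z) * h z) = (LBINT \<theta>. LBINT q. sin_weight n \<theta> * h (q, \<theta>))"
    using lborel_pair.integral_snd[of "\<lambda>q \<theta>. sin_weight n \<theta> * h (q, \<theta>)", unfolded sp, OF i]
    by (simp add: lborel_prod)
  have 2: "(LBINT z. sin_weight n (snd z) * h z) = (LBINT q. LBINT \<theta>. sin_weight n \<theta> * h (q, \<theta>))"
    using lborel_pair.integral_fst[of "\<lambda>q \<theta>. sin_weight n \<theta> * h (q, \<theta>)", unfolded sp, OF i]
    by (simp add: lborel_prod)
  show ?thesis
    using sl
  proof
    assume "\<forall>\<theta>. (LBINT q. h (q, \<theta>)) = 0"
    then show ?thesis unfolding 1 by simp
  next
    assume "\<forall>q. (LBINT \<theta>. sin_weight n \<theta> * h (q, \<theta>)) = 0"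
    then show ?thesis unfolding 2 by (simp del: split_paired_All)
  qed
qed

lemma slice_cont:
  assumes "continuous_on (half_plane \<times> UNIV) h"
  shows "continuous_on half_plane (\<lambda>q. h (q, \<theta>))"
  by (rule continuous_on_compose2[OF assms]) (auto intro!: continuous_intros)

lemma has_vector_derivative_F:
  assumes e: "e > 0" and q: "q \<in> half_plane"
  shows "((\<lambda>t. F e ((t, snd q), \<theta>)) has_vector_derivative
      - n * of_real (fst q - x * cos \<theta>) * F e (q, \<theta>) / of_real (B e (q, \<theta>))) (at (fst q))"
    and "((\<lambda>t. F e ((t, snd q), \<theta>) / of_real (B e ((t, snd q), \<theta>))) has_vector_derivative
      - (n + 2) * of_real (fst q - x * cos \<theta>) * F e (q, \<theta>) / (of_real (B e (q, \<theta>)))\<^sup>2) (at (fst q))"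
    and "((\<lambda>t. F e ((fst q, t), \<theta>)) has_vector_derivative
      - n * of_real (snd q - y) * F e (q, \<theta>) / of_real (B e (q, \<theta>))) (at (snd q))"
    and "((\<lambda>t. F e ((fst q, t), \<theta>) / of_real (B e ((fst q, t), \<theta>))) has_vector_derivative
      - (n + 2) * of_real (snd q - y) * F e (q, \<theta>) / (of_real (B e (q, \<theta>)))\<^sup>2) (at (snd q))"
    and "((\<lambda>t. F e (q, t) / of_real (B e (q, t))) has_vector_derivative
      - (n + 2) * of_real (x * fst q * sin \<theta>) * F e (q, \<theta>) / (of_real (B e (q, \<theta>)))\<^sup>2) (at \<theta>)"
proof -
  have qp: "fst q > 0" using q by (simp add: half_plane_iff)
  have p: "B e ((fst q, snd q), \<theta>) > 0" "B e (q, \<theta>) > 0" using B_pos[OF e] qp by simp_all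
  have 1: "((\<lambda>t. B e ((t, snd q), \<theta>)) has_real_derivative 2 * (fst q - x * cos \<theta>)) (at (fst q))"
    and 2: "((\<lambda>t. B e ((fst q, t), \<theta>)) has_real_derivative 2 * (snd q - y)) (at (snd q))"
    and 3: "((\<lambda>t. B e (q, t)) has_real_derivative 2 * (x * fst q * sin \<theta>)) (at \<theta>)"
    unfolding B_def bracket_eq_cos by (auto intro!: derivative_eq_intros simp: algebra_simps)
  note a = has_vector_derivative_cpow_half[of _ _ _ n] and b = has_vector_derivative_cpow_half_div[of _ _ _ n]
  show "((\<lambda>t. F e ((t, snd q), \<theta>)) has_vector_derivative
      - n * of_real (fst q - x * cos \<theta>) * F e (q, \<theta>) / of_real (B e (q, \<theta>))) (at (fst q))"
    using a[OF 1 p(1)] unfolding F_def by simp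
  show "((\<lambda>t. F e ((t, snd q), \<theta>) / of_real (B e ((t, snd q), \<theta>))) has_vector_derivative
      - (n + 2) * of_real (fst q - x * cos \<theta>) * F e (q, \<theta>) / (of_real (B e (q, \<theta>)))\<^sup>2) (at (fst q))"
    using b[OF 1 p(1)] unfolding F_def by simp
  show "((\<lambda>t. F e ((fst q, t), \<theta>)) has_vector_derivative
      - n * of_real (snd q - y) * F e (q, \<theta>) / of_real (B e (q, \<theta>))) (at (snd q))"
    using a[OF 2 p(1)] unfolding F_def by simp
  show "((\<lambda>t. F e ((fst q, t), \<theta>) / of_real (B e ((fst q, t), \<theta>))) has_vector_derivative
      - (n + 2) * of_real (snd q - y) * F e (q, \<theta>) / (of_real (B e (q, \<theta>)))\<^sup>2) (at (snd q))"
    using b[OF 2 p(1)] unfolding F_def by simp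
  show "((\<lambda>t. F e (q, t) / of_real (B e (q, t))) has_vector_derivative
      - (n + 2) * of_real (x * fst q * sin \<theta>) * F e (q, \<theta>) / (of_real (B e (q, \<theta>)))\<^sup>2) (at \<theta>)"
    using b[OF 3 p(2)] unfolding F_def by simp
qed

end

context weinstein_test begin

lemma integral_dP:
  assumes e: "e > 0"
  shows "(LBINT z. sin_weight n (snd z) * dP e z) = 0"
proof (rule integral_sin_weight_slices[OF cont_dP[OF e]])
  show "dP e (q, \<theta>) = 0" if "q \<notin> S" for q \<theta> using that by (simp add: dP_def zero)
  show "(\<forall>\<theta>. (LBINT q. dP e (q, \<theta>)) = 0) \<or> (\<forall>q. (LBINT \<theta>. sin_weight n \<theta> * dP e (q, \<theta>)) = 0)"
  proof (intro disjI1 allI)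
    fix \<theta>
    \<comment> \<open>The \<xi>-derivative of F is -n (\<xi> - x cos \<theta>) F / B, which explains
      the plus sign. F / B is kept as one factor because its derivative is available as a
      unit.\<close>
    let ?g = "\<lambda>q. cpow (fst q) n * (F e (q, \<theta>) * \<psi>1 q +
      \<psi> q * (n * (of_real (fst q - x * cos \<theta>) * (F e (q, \<theta>) / of_real (B e (q, \<theta>))))))"
    show "(LBINT q. dP e (q, \<theta>)) = 0"
    proof (rule integral_partial_derivative_zero(1)[OF S open_half_plane, where g="?g"])
      show "?g q = 0" "dP e (q, \<theta>) = 0" if "q \<notin> S" for q using that by (simp_all add: dP_def zero)
      show "continuous_on half_plane (\<lambda>q. dP e (q, \<theta>))" by (rule slice_cont[OF cont_dP[OF e]])
      fix q assume q: "q \<in> half_plane"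
      then have qp: "fst q > 0" by (simp add: half_plane_iff)
      have dX: "((\<lambda>t. cpow t n) has_vector_derivative n * cpow (fst q) n / of_real (fst q)) (at (fst q))"
        using has_vector_derivative_cpow[of "\<lambda>t. t" 1 "fst q" n] qp by simp
      have dk: "((\<lambda>t. complex_of_real (t - x * cos \<theta>)) has_vector_derivative of_real 1) (at (fst q))"
        by (intro has_vector_derivative_of_real)
          (auto intro!: derivative_eq_intros simp flip: has_real_derivative_iff_has_vector_derivative)
      note H = has_vector_derivative_mult[OF dX has_vector_derivative_add[OF
          has_vector_derivative_mult[OF has_vector_derivative_F(1)[OF e q] d11[OF q]]
          has_vector_derivative_mult[OF d1[OF q] has_vector_derivative_mult_right[OF
            has_vector_derivative_mult[OF dk has_vector_derivative_F(2)[OF e q]]]]], of \<theta> n]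
      have "((\<lambda>t. ?g (t, snd q)) has_vector_derivative dP e (q, \<theta>)) (at (fst q))"
        unfolding fst_conv snd_conv
      proof (rule has_vector_derivative_eq_rhs[OF H], unfold dP_def fst_conv snd_conv prod.collapse)
        define k where "k = complex_of_real (fst q - x * cos \<theta>)"
        define b where "b = complex_of_real (B e (q, \<theta>))"
        define f where "f = F e (q, \<theta>)"
        have sq: "complex_of_real ((fst q - x * cos \<theta>)\<^sup>2) = k\<^sup>2" by (simp add: k_def)
        show "cpow (fst q) n * (F e (q, \<theta>) * \<psi>11 q
             + - n * of_real (fst q - x * cos \<theta>) * F e (q, \<theta>) / of_real (B e (q, \<theta>)) * \<psi>1 q
             + (\<psi> q * (n * (of_real (fst q - x * cos \<theta>) *
                 (- (n + 2) * of_real (fst q - x * cos \<theta>) * F e (q, \<theta>) / (of_real (B e (q, \<theta>)))\<^sup>2)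
               + of_real 1 * (F e (q, \<theta>) / of_real (B e (q, \<theta>)))))
             + \<psi>1 q * (n * (of_real (fst q - x * cos \<theta>) * (F e (q, \<theta>) / of_real (B e (q, \<theta>)))))))
          + n * cpow (fst q) n / of_real (fst q) * (F e (q, \<theta>) * \<psi>1 q +
             \<psi> q * (n * (of_real (fst q - x * cos \<theta>) * (F e (q, \<theta>) / of_real (B e (q, \<theta>))))))
          = cpow (fst q) n * (n / of_real (fst q) *
             (F e (q, \<theta>) * \<psi>1 q + \<psi> q * (n * of_real (fst q - x * cos \<theta>) * F e (q, \<theta>) / of_real (B e (q, \<theta>))))
             + F e (q, \<theta>) * \<psi>11 q + \<psi> q * (n * F e (q, \<theta>) / of_real (B e (q, \<theta>))
             - n * (n + 2) * of_real ((fst q - x * cos \<theta>)\<^sup>2) * F e (q, \<theta>) / (of_real (B e (q, \<theta>)))\<^sup>2))"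
          unfolding sq unfolding k_def[symmetric] b_def[symmetric] f_def[symmetric]
          by (simp add: algebra_simps power2_eq_square) (simp flip: add_divide_distrib)
      qed
      then show "((\<lambda>t. ?g (t, snd q)) has_vector_derivative dP e (q, \<theta>)) (at (fst q))" .
    qed
  qed
qed

lemma integral_dQ:
  assumes e: "e > 0"
  shows "(LBINT z. sin_weight n (snd z) * dQ e z) = 0"
proof (rule integral_sin_weight_slices[OF cont_dQ[OF e]])
  show "dQ e (q, \<theta>) = 0" if "q \<notin> S" for q \<theta> using that by (simp add: dQ_def zero)
  show "(\<forall>\<theta>. (LBINT q. dQ e (q, \<theta>)) = 0) \<or> (\<forall>q. (LBINT \<theta>. sin_weight n \<theta> * dQ e (q, \<theta>)) = 0)"
  proof (intro disjI1 allI)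
    fix \<theta>
    let ?g = "\<lambda>q. cpow (fst q) n * (F e (q, \<theta>) * \<psi>2 q +
      \<psi> q * (n * (of_real (snd q - y) * (F e (q, \<theta>) / of_real (B e (q, \<theta>))))))"
    show "(LBINT q. dQ e (q, \<theta>)) = 0"
    proof (rule integral_partial_derivative_zero(2)[OF S open_half_plane, where g="?g"])
      show "?g q = 0" "dQ e (q, \<theta>) = 0" if "q \<notin> S" for q using that by (simp_all add: dQ_def zero)
      show "continuous_on half_plane (\<lambda>q. dQ e (q, \<theta>))" by (rule slice_cont[OF cont_dQ[OF e]])
      fix q assume q: "q \<in> half_plane"
      have dk: "((\<lambda>t. complex_of_real (t - y)) has_vector_derivative of_real 1) (at (snd q))"
        by (intro has_vector_derivative_of_real)
          (auto intro!: derivative_eq_intros simp flip: has_real_derivative_iff_has_vector_derivative)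
      note H = has_vector_derivative_mult_right[OF has_vector_derivative_add[OF
          has_vector_derivative_mult[OF has_vector_derivative_F(3)[OF e q] d22[OF q]]
          has_vector_derivative_mult[OF d2[OF q] has_vector_derivative_mult_right[OF
            has_vector_derivative_mult[OF dk has_vector_derivative_F(4)[OF e q]]]]], of "cpow (fst q) n" \<theta> n]
      have "((\<lambda>t. ?g (fst q, t)) has_vector_derivative dQ e (q, \<theta>)) (at (snd q))"
        unfolding fst_conv snd_conv
      proof (rule has_vector_derivative_eq_rhs[OF H], unfold dQ_def fst_conv snd_conv prod.collapse)
        define k where "k = complex_of_real (snd q - y)"
        define b where "b = complex_of_real (B e (q, \<theta>))"
        define f where "f = F e (q, \<theta>)"
        have sq: "complex_of_real ((snd q - y)\<^sup>2) = k\<^sup>2" by (simp add: k_def)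
        show "cpow (fst q) n * (F e (q, \<theta>) * \<psi>22 q
             + - n * of_real (snd q - y) * F e (q, \<theta>) / of_real (B e (q, \<theta>)) * \<psi>2 q
             + (\<psi> q * (n * (of_real (snd q - y) *
                 (- (n + 2) * of_real (snd q - y) * F e (q, \<theta>) / (of_real (B e (q, \<theta>)))\<^sup>2)
               + of_real 1 * (F e (q, \<theta>) / of_real (B e (q, \<theta>)))))
             + \<psi>2 q * (n * (of_real (snd q - y) * (F e (q, \<theta>) / of_real (B e (q, \<theta>)))))))
          = cpow (fst q) n * (F e (q, \<theta>) * \<psi>22 q + \<psi> q * (n * F e (q, \<theta>) / of_real (B e (q, \<theta>))
             - n * (n + 2) * of_real ((snd q - y)\<^sup>2) * F e (q, \<theta>) / (of_real (B e (q, \<theta>)))\<^sup>2))"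
          unfolding sq unfolding k_def[symmetric] b_def[symmetric] f_def[symmetric]
          by (simp add: algebra_simps power2_eq_square) (simp flip: add_divide_distrib)
      qed
      then show "((\<lambda>t. ?g (fst q, t)) has_vector_derivative dQ e (q, \<theta>)) (at (snd q))" .
    qed
  qed
qed

text \<open>The \<theta>-derivative of F contributes another factor sin \<theta>, so the primitive
  carries sin(\<theta>)^n. It is continuous on [0, pi] and vanishes at both ends since Re n > 0. The
  remaining factors do not depend on \<theta>.\<close>

lemma integral_dR:
  assumes e: "e > 0"
  shows "(LBINT z. sin_weight n (snd z) * (cpow (fst (fst z)) n / (of_real (fst (fst z)))\<^sup>2 * \<psi> (fst z) * dR e z)) = 0"
proof (rule integral_sin_weight_slices)
  let ?h = "\<lambda>z. cpow (fst (fst z)) n / (of_real (fst (fst z)))\<^sup>2 * \<psi> (fst z) * dR e z"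
  show "continuous_on (half_plane \<times> UNIV) ?h"
    by (intro continuous_intros cont_dR[OF e]) (auto simp: half_plane_iff)
  show "?h (q, \<theta>) = 0" if "q \<notin> S" for q \<theta> using that by (simp add: zero)
  show "(\<forall>\<theta>. (LBINT q. ?h (q, \<theta>)) = 0) \<or> (\<forall>q. (LBINT \<theta>. sin_weight n \<theta> * ?h (q, \<theta>)) = 0)"
  proof (intro disjI2 allI)
    fix q
    show "(LBINT \<theta>. sin_weight n \<theta> * ?h (q, \<theta>)) = 0"
    proof (cases "q \<in> S")
      case False
      then show ?thesis by (simp add: zero)
    next
      case True
      then have q: "q \<in> half_plane" and qp: "fst q > 0" using S by (auto simp: half_plane_iff)
      define W where "W \<theta> = cpow (sin \<theta>) (n - 1) * dR e (q, \<theta>)" for \<theta>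
      define R where "R \<theta> = - n * of_real (x * fst q) * (cpow (sin \<theta>) n * (F e (q, \<theta>) / of_real (B e (q, \<theta>))))" for \<theta>
      have Bp: "B e (q, \<theta>) > 0" for \<theta> using B_pos[OF e] qp by simp
      have cz: "continuous_on A (\<lambda>\<theta>. (q, \<theta>))" for A :: "real set" by (intro continuous_intros)
      have cF: "continuous_on A (\<lambda>\<theta>. F e (q, \<theta>))" and cD: "continuous_on A (\<lambda>\<theta>. dR e (q, \<theta>))" for A
        by (rule continuous_on_compose2[OF cont_F[OF e] cz] continuous_on_compose2[OF cont_dR[OF e] cz],
            use q in auto)+
      have cB: "continuous_on A (\<lambda>\<theta>. of_real (B e (q, \<theta>)) :: complex)" for A
        by (intro continuous_on_of_real continuous_on_compose2[OF cont_B[of UNIV] cz]) auto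
      have cR: "continuous_on {0..pi} R"
        unfolding R_def
        by (intro continuous_intros cF cB continuous_on_compose2[OF continuous_on_cpow_0])
          (use n Bp in \<open>auto simp: sin_ge_zero less_imp_neq[symmetric]\<close>)
      have dW: "(R has_vector_derivative W \<theta>) (at \<theta>)" if \<theta>: "\<theta> \<in> {0<..<pi}" for \<theta>
      proof -
        have s: "sin \<theta> > 0" using \<theta> by (intro sin_gt_zero) auto
        have dS: "((\<lambda>\<theta>. cpow (sin \<theta>) n) has_vector_derivative n * of_real (cos \<theta>) * cpow (sin \<theta>) n / of_real (sin \<theta>)) (at \<theta>)"
          using s by (intro has_vector_derivative_cpow) (auto intro!: derivative_eq_intros)
        note H = has_vector_derivative_mult_right[OF has_vector_derivative_mult[OF dS has_vector_derivative_F(5)[OF e q]],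
            of "- n * of_real (x * fst q)"]
        show ?thesis
          unfolding R_def
        proof (rule has_vector_derivative_eq_rhs[OF H])
          define w where "w = complex_of_real (x * fst q)"
          define b where "b = complex_of_real (B e (q, \<theta>))"
          define f where "f = F e (q, \<theta>)"
          define \<sigma> where "\<sigma> = complex_of_real (sin \<theta>)"
          have nz: "\<sigma> \<noteq> 0" using s by (simp add: \<sigma>_def)
          have e1: "complex_of_real (x * fst q * sin \<theta>) = w * \<sigma>" "complex_of_real (x * fst q * (sin \<theta>)\<^sup>2) = w * \<sigma>\<^sup>2"
            by (simp_all add: w_def \<sigma>_def)
          show "- n * of_real (x * fst q) * (cpow (sin \<theta>) n *
               (- (n + 2) * of_real (x * fst q * sin \<theta>) * F e (q, \<theta>) / (of_real (B e (q, \<theta>)))\<^sup>2)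
             + n * of_real (cos \<theta>) * cpow (sin \<theta>) n / of_real (sin \<theta>) * (F e (q, \<theta>) / of_real (B e (q, \<theta>)))) = W \<theta>"
            unfolding W_def dR_def fst_conv snd_conv cpow_minus_1[OF s] e1
            unfolding w_def[symmetric] b_def[symmetric] f_def[symmetric] \<sigma>_def[symmetric]
            using nz by (simp add: algebra_simps power2_eq_square) (simp flip: add_divide_distrib)
        qed
      qed
      \<comment> \<open>The power of the sine need not be differentiable at 0 and pi; the
        fundamental theorem asks for the derivative in the interior and for continuity up to the
        ends.\<close>
      have hi: "(W has_integral R pi - R 0) {0..pi}"
        by (rule fundamental_theorem_of_calculus_interior) (use cR dW in auto)
      have "R pi - R 0 = 0" by (simp add: R_def cpow_def)
      have si: "set_integrable lborel {0..pi} W"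
        unfolding W_def by (rule set_integrable_sin_powr[OF n cD])
      have "(LBINT \<theta>. sin_weight n \<theta> * dR e (q, \<theta>)) = (LBINT \<theta>:{0..pi}. W \<theta>)"
        unfolding set_lebesgue_integral_def
        by (rule Bochner_Integration.integral_cong) (auto simp: sin_weight_def W_def indicator_def)
      also have "\<dots> = integral {0..pi} W" using set_borel_integral_eq_integral(2)[OF si] .
      also have "\<dots> = 0" using hi \<open>R pi - R 0 = 0\<close> by (simp add: integral_unique)
      finally have z: "(LBINT \<theta>. sin_weight n \<theta> * dR e (q, \<theta>)) = 0" .
      have "(LBINT \<theta>. sin_weight n \<theta> * ?h (q, \<theta>))
         = (LBINT \<theta>. cpow (fst q) n / (of_real (fst q))\<^sup>2 * \<psi> q * (sin_weight n \<theta> * dR e (q, \<theta>)))"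
        by (simp add: mult_ac)
      then show ?thesis using z by simp
    qed
  qed
qed

text \<open>The derivative terms integrate to zero, which leaves \<open>F\<close> against L\<psi> on
  one side and the approximate identity on the other.\<close>

lemma regularised_identity:
  assumes e: "e > 0"
  shows "(LBINT z. sin_weight n (snd z) * (cpow (fst (fst z)) n * F e z * L\<psi> (fst z))) =
    - (n * (n + 2)) * (LBINT z. indicator {0..pi} (snd z) * cpow (sin (snd z)) (n - 1) * cpow (fst (fst z)) n *
      \<psi> (fst z) * of_real e * cpow (bracket x y (fst (fst z)) (snd (fst z)) (snd z) + e) (- n / 2 - 2))"
proof -
  let ?w = "\<lambda>z. sin_weight n (snd z)"
  let ?R = "\<lambda>z. cpow (fst (fst z)) n / (of_real (fst (fst z)))\<^sup>2 * \<psi> (fst z) * dR e z"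
  let ?A = "\<lambda>z. cpow (fst (fst z)) n * F e z * L\<psi> (fst z)"
  let ?C = "\<lambda>z. cpow (fst (fst z)) n * (n * (n + 2) * of_real e * \<psi> (fst z) * F e z / (of_real (B e z))\<^sup>2)"
  have cL: "continuous_on (half_plane \<times> UNIV) (\<lambda>z. L\<psi> (fst z))"
    by (rule continuous_on_compose2[OF cont_L\<psi>]) (auto intro!: continuous_intros)
  have cX: "continuous_on (half_plane \<times> UNIV) (\<lambda>z. cpow (fst (fst z)) n)"
    by (intro continuous_intros) (auto simp: half_plane_iff)
  have iP: "integrable lborel (\<lambda>z. ?w z * dP e z)"
    by (rule integrable_sin_weight[OF n S cont_dP[OF e]]) (simp add: dP_def zero)
  have iQ: "integrable lborel (\<lambda>z. ?w z * dQ e z)"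
    by (rule integrable_sin_weight[OF n S cont_dQ[OF e]]) (simp add: dQ_def zero)
  have iR: "integrable lborel (\<lambda>z. ?w z * ?R z)"
  proof (rule integrable_sin_weight[OF n S])
    show "continuous_on (half_plane \<times> UNIV) ?R"
      by (intro continuous_intros cont_dR[OF e]) (auto simp: half_plane_iff)
  qed (simp add: zero)
  have iA: "integrable lborel (\<lambda>z. ?w z * ?A z)"
  proof (rule integrable_sin_weight[OF n S])
    show "continuous_on (half_plane \<times> UNIV) ?A" by (intro continuous_on_mult cX cL cont_F[OF e])
  qed (simp add: L\<psi>_zero)
  have iC: "integrable lborel (\<lambda>z. ?w z * ?C z)"
  proof (rule integrable_sin_weight[OF n S])
    have "B e z \<noteq> 0" if "z \<in> half_plane \<times> UNIV" for z
      using B_pos[OF e, of z] that by (cases z) (auto simp: half_plane_iff)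
    then show "continuous_on (half_plane \<times> UNIV) ?C"
      by (intro continuous_intros cX cont_F[OF e] cont_B) auto
  qed (simp add: zero)
  \<comment> \<open>On S the point lies in the half plane and the pointwise identity applies; off S
    all terms vanish.\<close>
  have eq: "?w z * ?A z = ?w z * dP e z + ?w z * dQ e z - ?w z * ?R z - ?w z * ?C z" for z
  proof (cases "fst z \<in> S")
    case True
    then have "fst (fst z) > 0" using S by (auto simp: half_plane_iff)
    from weinstein_identity[OF e this]
    have "?A z + ?C z = dP e z + dQ e z - ?R z" by (simp add: algebra_simps)
    then have "?w z * (?A z + ?C z) = ?w z * (dP e z + dQ e z - ?R z)" by (simp only:)
    then show ?thesis by (simp add: algebra_simps)
  next
    case False
    then show ?thesis by (simp add: dP_def dQ_def zero L\<psi>_zero)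
  qed
  have "(LBINT z. ?w z * ?A z) = (LBINT z. ?w z * dP e z + ?w z * dQ e z - ?w z * ?R z - ?w z * ?C z)"
    by (simp only: eq)
  also have "\<dots> = (LBINT z. ?w z * dP e z) + (LBINT z. ?w z * dQ e z) - (LBINT z. ?w z * ?R z) - (LBINT z. ?w z * ?C z)"
    using iP iQ iR iC by simp
  also have "\<dots> = - (LBINT z. ?w z * ?C z)"
    using integral_dP[OF e] integral_dQ[OF e] integral_dR[OF e] by simp
  also have "(LBINT z. ?w z * ?C z) = (LBINT z. n * (n + 2) * (indicator {0..pi} (snd z) * cpow (sin (snd z)) (n - 1) * cpow (fst (fst z)) n *
      \<psi> (fst z) * of_real e * cpow (bracket x y (fst (fst z)) (snd (fst z)) (snd z) + e) (- n / 2 - 2)))"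
  proof (rule Bochner_Integration.integral_cong)
    fix z
    show "?w z * ?C z = n * (n + 2) * (indicator {0..pi} (snd z) * cpow (sin (snd z)) (n - 1) * cpow (fst (fst z)) n *
      \<psi> (fst z) * of_real e * cpow (bracket x y (fst (fst z)) (snd (fst z)) (snd z) + e) (- n / 2 - 2))"
    proof (cases "fst z \<in> S")
      case True
      then have "fst (fst z) > 0" using S by (auto simp: half_plane_iff)
      from B_pos[OF e this]
      have "cpow (bracket x y (fst (fst z)) (snd (fst z)) (snd z) + e) (- n / 2 - 2) = F e z / (of_real (B e z))\<^sup>2"
        by (simp only: B_def[symmetric] F_def cpow_minus_2)
      then show ?thesis by (simp add: sin_weight_def)
    next
      case False
      then show ?thesis by (simp add: zero)
    qed
  qed simp
  finally show ?thesis by simp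
qed

end

section \<open>Passage to the limit\<close>

lemma AE_off_lines:
  "AE z :: (real \<times> real) \<times> real in lborel. fst (fst z) \<noteq> x \<and> snd (fst z) \<noteq> y"
proof -
  have *: "AE z in lborel. z \<bullet> k \<noteq> c" if "k \<in> Basis" for k :: "(real \<times> real) \<times> real" and c :: real
  proof (rule AE_I')
    have b: "{z::(real \<times> real) \<times> real. z \<bullet> k = c} \<in> sets borel"
      by (intro borel_closed closed_Collect_eq continuous_intros)
    have "{z::(real \<times> real) \<times> real. z \<bullet> k = c} \<in> null_sets lebesgue"
      using negligible_standard_hyperplane[OF that, of c] by (simp add: negligible_iff_null_sets)
    then show "{z::(real \<times> real) \<times> real. z \<bullet> k = c} \<in> null_sets lborel"
      using b by (simp add: null_sets_completion_iff)
  qed auto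
  have "((1, 0), 0) \<in> (Basis :: ((real \<times> real) \<times> real) set)" "((0, 1), 0) \<in> (Basis :: ((real \<times> real) \<times> real) set)"
    by (auto simp: Basis_prod_def)
  from *[OF this(1), of x] *[OF this(2), of y]
  have "AE z :: (real \<times> real) \<times> real in lborel. z \<bullet> ((1, 0), 0) \<noteq> x \<and> z \<bullet> ((0, 1), 0) \<noteq> y" by (rule AE_conjI)
  then show ?thesis by (simp add: inner_prod_def)
qed

text \<open>On the lines \<open>\<xi> = x\<close> and \<open>\<eta> = y\<close> the bound below fails, because \<open>0 powr r = 0\<close>.\<close>

lemma singular_integrand_bound:
  assumes n: "Re n \<ge> 1" and x: "x > 0" and S: "compact S" "S \<subseteq> half_plane"
  obtains g :: "(real \<times> real) \<times> real \<Rightarrow> real" where "integrable lborel g"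
    "\<And>\<xi> \<eta> \<theta> e. (\<xi>, \<eta>) \<in> S \<Longrightarrow> \<xi> \<noteq> x \<Longrightarrow> \<eta> \<noteq> y \<Longrightarrow> e \<ge> 0 \<Longrightarrow>
      norm (sin_weight n \<theta> * cpow (bracket x y \<xi> \<eta> \<theta> + e) (- n / 2)) \<le> g ((\<xi>, \<eta>), \<theta>)"
proof -
  obtain lo hi a b where lo: "lo > 0" "lo \<le> hi" "S \<subseteq> {lo..hi} \<times> {a..b}"
    using compact_half_plane_bounds[OF S] .
  define c where "c = 4 * x * lo / pi\<^sup>2"
  have c: "c > 0" using x lo by (simp add: c_def)
  define C where "C = c powr (- (Re n - 1) / 2)"
  have C: "C \<ge> 0" by (simp add: C_def)
  define g where "g z = C * ((indicator {lo..hi} (fst (fst z)) * \<bar>fst (fst z) - x\<bar> powr - (1/2)) *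
      (indicator {a..b} (snd (fst z)) * \<bar>snd (fst z) - y\<bar> powr - (1/2))) * indicator {0..pi} (snd z)" for z
  show ?thesis
  proof (rule that[of g])
    have "integrable lborel (\<lambda>q. (indicator {lo..hi} (fst q) * \<bar>fst q - x\<bar> powr - (1/2)) *
      (indicator {a..b} (snd q) * \<bar>snd q - y\<bar> powr - (1/2)))"
      by (intro integrable_lborel_prod integrable_abs_powr_interval) auto
    then have "integrable lborel (\<lambda>q. C * ((indicator {lo..hi} (fst q) * \<bar>fst q - x\<bar> powr - (1/2)) *
      (indicator {a..b} (snd q) * \<bar>snd q - y\<bar> powr - (1/2))))"
      by (rule integrable_mult_right)
    moreover have "integrable lborel (indicator {0..pi} :: real \<Rightarrow> real)" by simp
    ultimately show "integrable lborel g"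
      unfolding g_def by (rule integrable_lborel_prod)
  next
    fix \<xi> \<eta> \<theta> e :: real
    assume q: "(\<xi>, \<eta>) \<in> S" and ne: "\<xi> \<noteq> x" "\<eta> \<noteq> y" and e: "e \<ge> 0"
    have b: "lo \<le> \<xi>" "\<xi> \<le> hi" "a \<le> \<eta>" "\<eta> \<le> b" using q lo(3) by auto
    show "norm (sin_weight n \<theta> * cpow (bracket x y \<xi> \<eta> \<theta> + e) (- n / 2)) \<le> g ((\<xi>, \<eta>), \<theta>)"
    proof (cases "0 < \<theta> \<and> \<theta> \<le> pi")
      case False
      then have "sin_weight n \<theta> = 0" by (cases "\<theta> = 0") (auto simp: sin_weight_def cpow_def)
      then show ?thesis using C by (simp add: g_def)
    next
      case True
      define X where "X = bracket x y \<xi> \<eta> \<theta> + e"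
      have "X \<ge> (x - \<xi>)\<^sup>2 + (y - \<eta>)\<^sup>2 + c * \<theta>\<^sup>2"
        using bracket_ge[OF x b(1) lo(1), of \<theta> y \<eta>] True e by (simp add: X_def c_def)
      moreover have "(x - \<xi>)\<^sup>2 > 0" using ne by simp
      moreover have "c * \<theta>\<^sup>2 \<ge> 0" using c by simp
      ultimately have X: "X > 0" "c * \<theta>\<^sup>2 \<le> X" "(x - \<xi>)\<^sup>2 + (y - \<eta>)\<^sup>2 \<le> X"
        using zero_le_power2[of "y - \<eta>"] by linarith+
      \<comment> \<open>Trading the power of \<theta> for a power of X reduces the singularity to
        X^(-1/2), whatever n is.\<close>
      have "\<theta> powr (Re n - 1) = C * (c * \<theta>\<^sup>2) powr ((Re n - 1) / 2)"
      proof -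
        have "2 * ((Re n - 1) / 2) = Re n - 1" by simp
        then have "(\<theta>\<^sup>2) powr ((Re n - 1) / 2) = \<theta> powr (Re n - 1)"
          using True powr_powr[of \<theta> 2 "(Re n - 1) / 2"] by (metis powr_numeral less_imp_le)
        then show ?thesis using c True by (simp add: C_def powr_mult flip: powr_add mult.assoc)
          (simp add: powr_add[symmetric] add_divide_distrib[symmetric])
      qed
      also have "\<dots> \<le> C * X powr ((Re n - 1) / 2)"
        using C c n X by (intro mult_left_mono powr_mono2) auto
      finally have 1: "\<theta> powr (Re n - 1) \<le> C * X powr ((Re n - 1) / 2)" .
      have s: "sin \<theta> \<ge> 0" using True by (intro sin_ge_zero) auto
      have "norm (sin_weight n \<theta> * cpow X (- n / 2)) = sin \<theta> powr (Re n - 1) * X powr (- Re n / 2)"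
        using True X by (simp add: norm_mult norm_sin_weight norm_cpow)
      also have "\<dots> \<le> \<theta> powr (Re n - 1) * X powr (- Re n / 2)"
        using s True n sin_x_le_x[of \<theta>] by (intro mult_right_mono powr_mono2) auto
      also have "\<dots> \<le> C * X powr ((Re n - 1) / 2) * X powr (- Re n / 2)"
        by (intro mult_right_mono 1) auto
      also have "\<dots> = C * X powr - (1/2)"
        by (simp add: mult.assoc powr_add[symmetric] diff_divide_distrib)
      \<comment> \<open>The inequality 2 a b \<le> a^2 + b^2 replaces the distance by a product,
        whose two inverse square roots are integrable separately.\<close>
      also have "\<dots> \<le> C * (\<bar>\<xi> - x\<bar> * \<bar>\<eta> - y\<bar>) powr - (1/2)"
      proof (intro mult_left_mono powr_mono2' C)
        have "2 * (\<bar>\<xi> - x\<bar> * \<bar>\<eta> - y\<bar>) \<le> (x - \<xi>)\<^sup>2 + (y - \<eta>)\<^sup>2"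
          using zero_le_power2[of "\<bar>\<xi> - x\<bar> - \<bar>\<eta> - y\<bar>"]
          by (simp add: power2_diff algebra_simps)
        moreover have "0 \<le> \<bar>\<xi> - x\<bar> * \<bar>\<eta> - y\<bar>" by simp
        ultimately show "\<bar>\<xi> - x\<bar> * \<bar>\<eta> - y\<bar> \<le> X" using X(3) by linarith
      qed (use ne in auto)
      also have "\<dots> = g ((\<xi>, \<eta>), \<theta>)"
        using True b by (simp add: g_def powr_mult)
      finally show ?thesis by (simp add: X_def)
    qed
  qed
qed

lemma integrand_measurable:
  fixes h :: "real \<times> real \<Rightarrow> complex"
  assumes "h \<in> borel_measurable borel"
  shows "(\<lambda>z. sin_weight n (snd z) * (h (fst z) *
     cpow (bracket x y (fst (fst z)) (snd (fst z)) (snd z) + e) (- n / 2))) \<in> borel_measurable borel"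
proof -
  have "snd \<in> borel \<rightarrow>\<^sub>M (borel :: real measure)" "fst \<in> borel \<rightarrow>\<^sub>M (borel :: (real \<times> real) measure)"
    by (intro borel_measurable_continuous_onI continuous_intros)+
  then show ?thesis
    by (intro borel_measurable_times cpow_measurable borel_measurable_add borel_measurable_bracket
        borel_measurable_const measurable_compose[OF _ assms] measurable_compose[OF _ sin_weight_measurable])
qed

text \<open>One majorant dominates the integrands for all e \<ge> 0. At e = 0 it gives integrability
  of the singular integrand, along e = \<epsilon>^2 it gives dominated convergence.\<close>

lemma regularised_limit:
  fixes h :: "real \<times> real \<Rightarrow> complex"
  assumes n: "Re n \<ge> 1" and x: "x > 0" and S: "compact S" "S \<subseteq> half_plane"
    and h: "h \<in> borel_measurable borel" "\<And>q. q \<in> S \<Longrightarrow> norm (h q) \<le> M" "\<And>q. q \<notin> S \<Longrightarrow> h q = 0"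
    and \<epsilon>: "\<And>k::nat. \<epsilon> k > 0" "\<epsilon> \<longlonglongrightarrow> 0"
  shows "integrable lborel (\<lambda>z. sin_weight n (snd z) * (h (fst z) *
      cpow (bracket x y (fst (fst z)) (snd (fst z)) (snd z)) (- n / 2)))"
    and "(\<lambda>k. LBINT z. sin_weight n (snd z) * (h (fst z) *
      cpow (bracket x y (fst (fst z)) (snd (fst z)) (snd z) + (\<epsilon> k)\<^sup>2) (- n / 2))) \<longlonglongrightarrow>
     (LBINT z. sin_weight n (snd z) * (h (fst z) *
      cpow (bracket x y (fst (fst z)) (snd (fst z)) (snd z)) (- n / 2)))"
proof -
  obtain g where g: "integrable lborel g"
    "\<And>\<xi> \<eta> \<theta> e. (\<xi>, \<eta>) \<in> S \<Longrightarrow> \<xi> \<noteq> x \<Longrightarrow> \<eta> \<noteq> y \<Longrightarrow> e \<ge> 0 \<Longrightarrow>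
      norm (sin_weight n \<theta> * cpow (bracket x y \<xi> \<eta> \<theta> + e) (- n / 2)) \<le> g ((\<xi>, \<eta>), \<theta>)"
    using singular_integrand_bound[OF n x S, of y] by blast
  define K where "K e z = sin_weight n (snd z) * (h (fst z) *
      cpow (bracket x y (fst (fst z)) (snd (fst z)) (snd z) + e) (- n / 2))" for e z
  have meas: "K e \<in> borel_measurable lborel" for e
    unfolding K_def using integrand_measurable[OF h(1)] by simp
  \<comment> \<open>The absolute values are there because g is bounded below only over S, and M
    could be negative if S is empty.\<close>
  have bound: "AE z in lborel. norm (K e z) \<le> \<bar>M\<bar> * \<bar>g z\<bar>" if e: "e \<ge> 0" for e
    using AE_off_lines[of x y]
  proof eventually_elim
    case (elim z)
    obtain \<xi> \<eta> \<theta> where z: "z = ((\<xi>, \<eta>), \<theta>)" by (metis surj_pair)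
    show ?case
    proof (cases "(\<xi>, \<eta>) \<in> S")
      case True
      have "norm (K e z) = norm (h (\<xi>, \<eta>)) * norm (sin_weight n \<theta> * cpow (bracket x y \<xi> \<eta> \<theta> + e) (- n / 2))"
        by (simp add: K_def z norm_mult)
      also have "\<dots> \<le> M * g ((\<xi>, \<eta>), \<theta>)"
        using elim z h(2)[OF True] order_trans[OF norm_ge_zero h(2)[OF True]]
        by (intro mult_mono g(2)[OF True _ _ e]) auto
      also have "\<dots> \<le> \<bar>M\<bar> * \<bar>g z\<bar>" by (simp add: z flip: abs_mult)
      finally show ?thesis .
    qed (simp add: K_def z h)
  qed
  have lim: "AE z in lborel. (\<lambda>k. K ((\<epsilon> k)\<^sup>2) z) \<longlonglongrightarrow> K 0 z"
    using AE_off_lines[of x y]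
  proof eventually_elim
    case (elim z)
    obtain \<xi> \<eta> \<theta> where z: "z = ((\<xi>, \<eta>), \<theta>)" by (metis surj_pair)
    show ?case
    proof (cases "(\<xi>, \<eta>) \<in> S")
      case True
      then have "\<xi> > 0" using S by (auto simp: half_plane_iff)
      then have "4 * x * \<xi> * (sin (\<theta> / 2))\<^sup>2 \<ge> 0" "(x - \<xi>)\<^sup>2 > 0" using x elim by (simp_all add: z)
      \<comment> \<open>Off the line \<xi> = x the bracket is positive for every \<theta>, and the
        power is continuous at positive bases.\<close>
      then have b: "bracket x y \<xi> \<eta> \<theta> + 0\<^sup>2 > 0"
        unfolding bracket_def zero_power2 using zero_le_power2[of "y - \<eta>"] by linarith
      have "(\<lambda>k. cpow (bracket x y \<xi> \<eta> \<theta> + (\<epsilon> k)\<^sup>2) (- n / 2)) \<longlonglongrightarrow> cpow (bracket x y \<xi> \<eta> \<theta> + 0\<^sup>2) (- n / 2)"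
        by (intro tendsto_cpow b tendsto_add tendsto_const tendsto_power \<epsilon>)
      then show ?thesis unfolding K_def z fst_conv snd_conv by (auto intro!: tendsto_mult)
    qed (simp add: K_def z h)
  qed
  have gi: "integrable lborel (\<lambda>z. \<bar>M\<bar> * \<bar>g z\<bar>)" using g(1) by simp
  have "integrable lborel (K 0)"
    by (rule Bochner_Integration.integrable_bound[OF gi meas]) (use bound[of 0] in simp)
  then show "integrable lborel (\<lambda>z. sin_weight n (snd z) * (h (fst z) *
      cpow (bracket x y (fst (fst z)) (snd (fst z)) (snd z)) (- n / 2)))" unfolding K_def by simp
  have "(\<lambda>k. LBINT z. K ((\<epsilon> k)\<^sup>2) z) \<longlonglongrightarrow> (LBINT z. K 0 z)"
    by (rule integral_dominated_convergence[OF meas meas gi lim]) (use bound in simp)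
  then show "(\<lambda>k. LBINT z. sin_weight n (snd z) * (h (fst z) *
      cpow (bracket x y (fst (fst z)) (snd (fst z)) (snd z) + (\<epsilon> k)\<^sup>2) (- n / 2))) \<longlonglongrightarrow>
     (LBINT z. sin_weight n (snd z) * (h (fst z) *
      cpow (bracket x y (fst (fst z)) (snd (fst z)) (snd z)) (- n / 2)))" unfolding K_def by simp
qed

text \<open>A Lebesgue integral over the whole line, with the cut-off inside the weight, so that
  Fubini on the product space applies directly.\<close>

definition green :: "complex \<Rightarrow> real \<Rightarrow> real \<Rightarrow> real \<times> real \<Rightarrow> complex" where
  "green n x y q = (LBINT \<theta>. sin_weight n \<theta> * cpow (bracket x y (fst q) (snd q) \<theta>) (- n / 2))"

lemma green_fubini:
  fixes h :: "real \<times> real \<Rightarrow> complex"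
  assumes n: "Re n \<ge> 1" and x: "x > 0" and S: "compact S" "S \<subseteq> half_plane"
    and h: "h \<in> borel_measurable borel" "\<And>q. q \<in> S \<Longrightarrow> norm (h q) \<le> M" "\<And>q. q \<notin> S \<Longrightarrow> h q = 0"
  shows "integrable lborel (\<lambda>q. h q * green n x y q)"
    and "(LBINT q. h q * green n x y q) = (LBINT z. sin_weight n (snd z) * (h (fst z) *
      cpow (bracket x y (fst (fst z)) (snd (fst z)) (snd z)) (- n / 2)))"
proof -
  let ?K = "\<lambda>z. sin_weight n (snd z) * (h (fst z) *
      cpow (bracket x y (fst (fst z)) (snd (fst z)) (snd z)) (- n / 2))"
  \<comment> \<open>Any positive null sequence would do: only the integrability part of the limit
    lemma is drawn upon.\<close>
  have "(\<lambda>k. inverse (real (Suc k))) \<longlonglongrightarrow> 0" by (rule LIMSEQ_inverse_real_of_nat)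
  from regularised_limit(1)[OF n x S h _ this]
  have i: "integrable (lborel \<Otimes>\<^sub>M lborel) ?K" by (simp add: lborel_prod)
  have eq: "(LBINT \<theta>. ?K (q, \<theta>)) = h q * green n x y q" for q
  proof -
    have "?K (q, \<theta>) = h q * (sin_weight n \<theta> * cpow (bracket x y (fst q) (snd q) \<theta>) (- n / 2))" for \<theta> by simp
    then show ?thesis by (simp only: green_def Bochner_Integration.integral_mult_right_zero)
  qed
  show "integrable lborel (\<lambda>q. h q * green n x y q)"
    using lborel_pair.integrable_fst'[OF i] unfolding eq .
  show "(LBINT q. h q * green n x y q) = (LBINT z. ?K z)"
    using lborel_pair.integral_fst'[OF i] unfolding eq by (simp add: lborel_prod)
qed

context weinstein_test begin

text \<open>The regularised integrals converge to the integral against the kernel by domination and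
  to a multiple of \<psi>(x, y) by the approximate identity; the two limits coincide.\<close>

lemma green_representation:
  shows "(LBINT q. cpow (fst q) n * L\<psi> q * green n x y q) = - 2 * of_real pi * \<psi> (x, y)"
proof -
  define \<epsilon> where "\<epsilon> k = inverse (real (Suc k))" for k
  have \<epsilon>: "\<And>k. \<epsilon> k > 0" "\<epsilon> \<longlonglongrightarrow> 0"
    unfolding \<epsilon>_def by (simp, rule LIMSEQ_inverse_real_of_nat)
  have cl: "closed S" using S by (simp add: compact_imp_closed)
  define h where "h q = cpow (fst q) n * L\<psi> q" for q
  have hc: "continuous_on half_plane h"
    unfolding h_def by (intro continuous_intros cont_L\<psi>) (auto simp: half_plane_iff)
  have hz: "h q = 0" if "q \<notin> S" for q using that by (simp add: h_def L\<psi>_zero)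
  have hm: "h \<in> borel_measurable borel"
    by (intro borel_measurable_continuous_onI continuous_on_extend_zero[OF open_half_plane cl S(2) hc hz])
  obtain M where M: "\<And>q. q \<in> S \<Longrightarrow> norm (h q) \<le> M"
    using compact_bound[OF S(1) continuous_on_subset[OF hc S(2)]] by blast
  have pc: "continuous_on UNIV \<psi>"
    by (rule continuous_on_extend_zero[OF open_half_plane cl S(2) cont(1) zero(1)])
  let ?I = "LBINT z. sin_weight n (snd z) * (h (fst z) * cpow (bracket x y (fst (fst z)) (snd (fst z)) (snd z)) (- n / 2))"
  have 1: "(\<lambda>k. LBINT z. sin_weight n (snd z) * (h (fst z) *
      cpow (bracket x y (fst (fst z)) (snd (fst z)) (snd z) + (\<epsilon> k)\<^sup>2) (- n / 2))) \<longlonglongrightarrow> ?I"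
    by (rule regularised_limit(2)[OF n x S hm M hz \<epsilon>])
  have reg: "(LBINT z. sin_weight n (snd z) * (h (fst z) *
      cpow (bracket x y (fst (fst z)) (snd (fst z)) (snd z) + (\<epsilon> k)\<^sup>2) (- n / 2))) =
     - (n * (n + 2)) * (LBINT z. indicator {0..pi} (snd z) * cpow (sin (snd z)) (n - 1) * cpow (fst (fst z)) n *
      \<psi> (fst z) * of_real ((\<epsilon> k)\<^sup>2) * cpow (bracket x y (fst (fst z)) (snd (fst z)) (snd z) + (\<epsilon> k)\<^sup>2) (- n / 2 - 2))" for k
  proof -
    have "(\<epsilon> k)\<^sup>2 > 0" using \<epsilon>(1)[of k] by simp
    from regularised_identity[OF this] show ?thesis
      unfolding F_def B_def h_def by (simp only: mult_ac)
  qed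
  have 2: "(\<lambda>k. LBINT z. sin_weight n (snd z) * (h (fst z) *
      cpow (bracket x y (fst (fst z)) (snd (fst z)) (snd z) + (\<epsilon> k)\<^sup>2) (- n / 2))) \<longlonglongrightarrow>
     - (n * (n + 2)) * (\<psi> (x, y) * (2 * of_real pi / (n * (n + 2))))"
    unfolding reg by (rule tendsto_mult_left[OF approximate_identity[OF n x S pc zero(1) \<epsilon>, of y]])
  \<comment> \<open>Re n \<ge> 1 permits cancelling n (n + 2), which leaves the bare constant -2
    pi.\<close>
  have "n \<noteq> 0" "n + 2 \<noteq> 0" using n by (auto simp: complex_eq_iff)
  then have "- (n * (n + 2)) * (\<psi> (x, y) * (2 * of_real pi / (n * (n + 2)))) = - 2 * of_real pi * \<psi> (x, y)"
    by simp
  with LIMSEQ_unique[OF 1 2] green_fubini(2)[OF n x S hm M hz, of y] show ?thesis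
    by (simp add: h_def)
qed

end

section \<open>Test functions and distributions defined by functions\<close>

lemma smooth_D:
  assumes "smooth \<phi>"
  shows "\<phi> differentiable_on UNIV" "smooth (pd_x \<phi>)" "smooth (pd_y \<phi>)" "continuous_on UNIV \<phi>"
proof -
  have "C_k (Suc k) \<phi>" for k using assms by (simp only: smooth_def)
  then show "\<phi> differentiable_on UNIV" "smooth (pd_x \<phi>)" "smooth (pd_y \<phi>)" by (auto simp: smooth_def)
  have "C_k 0 \<phi>" using assms by (simp only: smooth_def)
  then show "continuous_on UNIV \<phi>" by simp
qed

lemma smooth_has_vector_derivative:
  assumes "smooth \<phi>"
  shows "((\<lambda>t. \<phi> (t, snd q)) has_vector_derivative pd_x \<phi> q) (at (fst q))"
    and "((\<lambda>t. \<phi> (fst q, t)) has_vector_derivative pd_y \<phi> q) (at (snd q))"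
proof -
  have d: "\<phi> differentiable (at q)" for q
    using smooth_D(1)[OF assms] unfolding differentiable_on_def by blast
  have "(\<phi> \<circ> (\<lambda>t. (t, snd q))) differentiable (at (fst q))" "(\<phi> \<circ> (\<lambda>t. (fst q, t))) differentiable (at (snd q))"
    by (intro differentiable_chain_at d; auto simp: differentiable_def intro!: derivative_eq_intros)+
  then show "((\<lambda>t. \<phi> (t, snd q)) has_vector_derivative pd_x \<phi> q) (at (fst q))"
    "((\<lambda>t. \<phi> (fst q, t)) has_vector_derivative pd_y \<phi> q) (at (snd q))"
    by (simp_all add: pd_x_def pd_y_def o_def vector_derivative_works)
qed

lemma closed_supp: "closed (supp \<phi>)" by (simp add: supp_def)

lemma zero_off_supp: "q \<notin> supp \<phi> \<Longrightarrow> \<phi> q = 0"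
  unfolding supp_def using closure_subset[of "{p. \<phi> p \<noteq> 0}"] by blast

lemma pd_zero_off_supp:
  assumes "q \<notin> supp \<phi>"
  shows "pd_x \<phi> q = 0" "pd_y \<phi> q = 0"
proof -
  have cl: "closed ((\<lambda>t. (t, snd q)) -` supp \<phi>)" "closed ((\<lambda>t. (fst q, t)) -` supp \<phi>)"
    by (intro closed_vimage closed_supp continuous_intros)+
  have "((\<lambda>t. \<phi> (t, snd q)) has_vector_derivative 0) (at (fst q))"
    by (rule has_vector_derivative_extend_zero[OF cl(1)]) (use assms in \<open>auto intro: zero_off_supp\<close>)
  then show "pd_x \<phi> q = 0" by (simp add: pd_x_def vector_derivative_at)
  have "((\<lambda>t. \<phi> (fst q, t)) has_vector_derivative 0) (at (snd q))"
    by (rule has_vector_derivative_extend_zero[OF cl(2)]) (use assms in \<open>auto intro: zero_off_supp\<close>)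
  then show "pd_y \<phi> q = 0" by (simp add: pd_y_def vector_derivative_at)
qed

lemma supp_pd: "supp (pd_x \<phi>) \<subseteq> supp \<phi>" "supp (pd_y \<phi>) \<subseteq> supp \<phi>"
proof -
  have h: "{p. pd_x \<phi> p \<noteq> 0} \<subseteq> supp \<phi>" "{p. pd_y \<phi> p \<noteq> 0} \<subseteq> supp \<phi>"
    using pd_zero_off_supp[of _ \<phi>] by blast+
  show "supp (pd_x \<phi>) \<subseteq> supp \<phi>" "supp (pd_y \<phi>) \<subseteq> supp \<phi>"
    unfolding supp_def[of "pd_x \<phi>"] supp_def[of "pd_y \<phi>"]
    by (rule closure_minimal[OF h(1) closed_supp] closure_minimal[OF h(2) closed_supp])+
qed

text \<open>This is \<open>\<xi>^(-s) L\<^sub>n (\<xi>^s \<phi>)\<close>.\<close>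

definition weinstein_conjugate :: "complex \<Rightarrow> complex \<Rightarrow> (real \<times> real \<Rightarrow> complex) \<Rightarrow> real \<times> real \<Rightarrow> complex" where
  "weinstein_conjugate n s \<phi> q = pd_x (pd_x \<phi>) q + pd_y (pd_y \<phi>) q + (2 * s + n) / of_real (fst q) * pd_x \<phi> q +
     s * (s + n - 1) / (of_real (fst q))\<^sup>2 * \<phi> q"

text \<open>This is the representation formula for \<psi> = \<xi>^s \<phi>. Moving \<xi>^s out of
  \<open>L_n\<close> changes the weight to \<xi>^(n+s), and evaluation at the pole contributes
  a^s.\<close>

lemma green_weak_form:
  assumes n: "Re n \<ge> 1" and a: "a > 0" and \<phi>: "\<phi> \<in> test_functions half_plane"
  shows "(LBINT q. cpow (fst q) (n + s) * weinstein_conjugate n s \<phi> q * green n a b q) = - 2 * of_real pi * (cpow a s * \<phi> (a, b))"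
proof -
  have sm: "smooth \<phi>" and S: "compact (supp \<phi>)" "supp \<phi> \<subseteq> half_plane"
    using \<phi> by (auto simp: test_functions_def)
  note smx = smooth_D(2)[OF sm] and smy = smooth_D(3)[OF sm]
  note z = zero_off_supp[of _ \<phi>] pd_zero_off_supp[of _ \<phi>]
  have z2: "pd_x (pd_x \<phi>) q = 0" "pd_y (pd_y \<phi>) q = 0" if "q \<notin> supp \<phi>" for q
    using that supp_pd[of \<phi>] pd_zero_off_supp[of q "pd_x \<phi>"] pd_zero_off_supp[of q "pd_y \<phi>"] by auto
  have cont: "continuous_on A \<phi>" "continuous_on A (pd_x \<phi>)" "continuous_on A (pd_y \<phi>)"
    "continuous_on A (pd_x (pd_x \<phi>))" "continuous_on A (pd_y (pd_y \<phi>))" for A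
    using smooth_D(4)[OF sm] smooth_D(4)[OF smx] smooth_D(4)[OF smy]
      smooth_D(4)[OF smooth_D(2)[OF smx]] smooth_D(4)[OF smooth_D(3)[OF smy]]
    by (auto intro: continuous_on_subset)
  define \<psi> where "\<psi> q = cpow (fst q) s * \<phi> q" for q
  define \<psi>1 where "\<psi>1 q = cpow (fst q) s * pd_x \<phi> q + s * (cpow (fst q) (s - 1) * \<phi> q)" for q
  define \<psi>2 where "\<psi>2 q = cpow (fst q) s * pd_y \<phi> q" for q
  define \<psi>11 where "\<psi>11 q = cpow (fst q) s * pd_x (pd_x \<phi>) q + 2 * s * (cpow (fst q) (s - 1) * pd_x \<phi> q)
      + s * (s - 1) * (cpow (fst q) (s - 2) * \<phi> q)" for q
  define \<psi>22 where "\<psi>22 q = cpow (fst q) s * pd_y (pd_y \<phi>) q" for q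
  interpret weinstein_test n a b "supp \<phi>" \<psi> \<psi>1 \<psi>2 \<psi>11 \<psi>22
  proof
    show "1 \<le> Re n" "0 < a" "compact (supp \<phi>)" "supp \<phi> \<subseteq> half_plane" by fact+
    show "\<psi> q = 0" "\<psi>1 q = 0" "\<psi>2 q = 0" "\<psi>11 q = 0" "\<psi>22 q = 0" if "q \<notin> supp \<phi>" for q
      using that z z2 by (simp_all add: \<psi>_def \<psi>1_def \<psi>2_def \<psi>11_def \<psi>22_def)
    have p: "\<And>q. q \<in> half_plane \<Longrightarrow> fst q > 0" by (simp add: half_plane_iff)
    show "continuous_on half_plane \<psi>" "continuous_on half_plane \<psi>1" "continuous_on half_plane \<psi>2"
      "continuous_on half_plane \<psi>11" "continuous_on half_plane \<psi>22"
      unfolding \<psi>_def \<psi>1_def \<psi>2_def \<psi>11_def \<psi>22_def by (intro continuous_intros cont p; assumption)+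
    fix q assume q: "q \<in> half_plane"
    then have qp: "fst q > 0" by (rule p)
    have dX: "((\<lambda>t. cpow t r) has_vector_derivative r * cpow (fst q) (r - 1)) (at (fst q))" for r
      using has_vector_derivative_cpow[of "\<lambda>t. t" 1 "fst q" r] qp by (simp add: cpow_minus_1)
    note dx = smooth_has_vector_derivative(1)[OF sm, of q] smooth_has_vector_derivative(1)[OF smx, of q]
    show "((\<lambda>t. \<psi> (t, snd q)) has_vector_derivative \<psi>1 q) (at (fst q))"
      unfolding \<psi>_def \<psi>1_def fst_conv
      by (rule has_vector_derivative_eq_rhs[OF has_vector_derivative_mult[OF dX dx(1)]]) simp
    show "((\<lambda>t. \<psi>1 (t, snd q)) has_vector_derivative \<psi>11 q) (at (fst q))"
      unfolding \<psi>1_def \<psi>11_def fst_conv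
      by (rule has_vector_derivative_eq_rhs[OF has_vector_derivative_add[OF has_vector_derivative_mult[OF dX dx(2)]
              has_vector_derivative_mult_right[OF has_vector_derivative_mult[OF dX dx(1)]]]])
        (simp add: algebra_simps)
    show "((\<lambda>t. \<psi> (fst q, t)) has_vector_derivative \<psi>2 q) (at (snd q))"
      unfolding \<psi>_def \<psi>2_def fst_conv
      by (intro has_vector_derivative_mult_right smooth_has_vector_derivative sm)
    show "((\<lambda>t. \<psi>2 (fst q, t)) has_vector_derivative \<psi>22 q) (at (snd q))"
      unfolding \<psi>2_def \<psi>22_def fst_conv
      by (intro has_vector_derivative_mult_right smooth_has_vector_derivative smy)
  qed
  \<comment> \<open>In the first-order coefficient, 2 s is the Leibniz cross term and n comes from
    the operator; in the zeroth-order one, s (s - 1) + n s = s (s + n - 1).\<close>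
  have "cpow (fst q) n * L\<psi> q = cpow (fst q) (n + s) * weinstein_conjugate n s \<phi> q" for q
  proof (cases "q \<in> supp \<phi>")
    case True
    then have qp: "fst q > 0" using S by (auto simp: half_plane_iff)
    then have nz: "complex_of_real (fst q) \<noteq> 0" by simp
    define \<xi> where "\<xi> = complex_of_real (fst q)"
    show ?thesis
      unfolding L\<psi>_def weinstein_conjugate_def \<psi>11_def \<psi>22_def \<psi>1_def cpow_add cpow_minus_1[OF qp] cpow_minus_2[OF qp] \<xi>_def[symmetric]
      using nz[folded \<xi>_def] by (simp add: field_simps power2_eq_square)
  next
    case False
    then show ?thesis using z z2 by (simp add: L\<psi>_zero weinstein_conjugate_def)
  qed
  with green_representation show ?thesis by (simp add: \<psi>_def)
qed

section \<open>Locally integrable functions as distributions\<close>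

lemma set_integrable_mult_compact_support:
  fixes g :: "real \<times> real \<Rightarrow> complex"
  assumes f: "locally_integrable U f" and S: "compact S" "S \<subseteq> U"
    and g: "continuous_on UNIV g" "\<And>q. q \<notin> S \<Longrightarrow> g q = 0"
  shows "set_integrable lebesgue U (\<lambda>p. f p * g p)"
proof -
  have i: "integrable lebesgue (\<lambda>p. indicat_real S p *\<^sub>R f p)"
    using f S by (simp add: locally_integrable_def set_integrable_def)
  obtain M where M: "M \<ge> 0" "\<And>q. q \<in> S \<Longrightarrow> norm (g q) \<le> M"
    using compact_bound[OF S(1) continuous_on_subset[OF g(1)]] by blast
  have eq: "indicat_real U p *\<^sub>R (f p * g p) = (indicat_real S p *\<^sub>R f p) * g p" for p
    using S(2) g(2)[of p] by (auto simp: indicator_def)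
  have "g \<in> borel_measurable lborel" using g(1) by (simp add: borel_measurable_continuous_onI)
  then have gm: "g \<in> borel_measurable lebesgue" by (rule measurable_completion)
  have gM: "norm (g p) \<le> M" for p using M g(2)[of p] by (cases "p \<in> S") auto
  have iM: "integrable lebesgue (\<lambda>p. of_real M * (indicat_real S p *\<^sub>R f p))"
    by (rule integrable_mult_right) (rule i)
  show ?thesis
    unfolding set_integrable_def eq
  proof (rule Bochner_Integration.integrable_bound[OF iM])
    show "(\<lambda>p. (indicat_real S p *\<^sub>R f p) * g p) \<in> borel_measurable lebesgue"
      by (intro borel_measurable_times borel_measurable_integrable[OF i] gm)
    show "AE p in lebesgue. norm ((indicat_real S p *\<^sub>R f p) * g p) \<le> norm (of_real M * (indicat_real S p *\<^sub>R f p))"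
    proof (rule AE_I2)
      fix p
      show "norm ((indicat_real S p *\<^sub>R f p) * g p) \<le> norm (of_real M * (indicat_real S p *\<^sub>R f p))"
        using mult_left_mono[OF gM[of p], of "norm (indicat_real S p *\<^sub>R f p)"] M(1)
        by (simp add: norm_mult mult_ac)
    qed
  qed
qed

lemma test_functionD:
  assumes "\<phi> \<in> test_functions U"
  shows "smooth \<phi>" "compact (supp \<phi>)" "supp \<phi> \<subseteq> U"
  using assms by (auto simp: test_functions_def)

text \<open>Such a distribution has order 0: with N = 0 the seminorm sum is the sup norm of \<phi>,
  and C is the integral of |f| over K.\<close>

lemma locally_integrable_is_distribution:
  assumes f: "locally_integrable U f"
  shows "is_distribution U (dist_of U f)"
proof -
  have i: "set_integrable lebesgue U (\<lambda>p. f p * \<phi> p)" if "\<phi> \<in> test_functions U" for \<phi>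
    by (rule set_integrable_mult_compact_support[OF f test_functionD(2,3)[OF that] smooth_D(4)[OF test_functionD(1)[OF that]] zero_off_supp[of _ \<phi>]])
  have add: "dist_of U f (\<lambda>p. \<phi> p + \<psi> p) = dist_of U f \<phi> + dist_of U f \<psi>"
    if "\<phi> \<in> test_functions U" "\<psi> \<in> test_functions U" for \<phi> \<psi>
    using set_integral_add(2)[OF i[OF that(1)] i[OF that(2)]] by (simp add: dist_of_def distrib_left)
  have scale: "dist_of U f (\<lambda>p. c * \<phi> p) = c * dist_of U f \<phi>" for \<phi> c
  proof -
    have "(\<lambda>p. f p * (c * \<phi> p)) = (\<lambda>p. c * (f p * \<phi> p))" by (simp add: mult_ac)
    then show ?thesis by (simp add: dist_of_def)
  qed
  have "\<exists>N C. \<forall>\<phi>\<in>test_functions U. supp \<phi> \<subseteq> K \<longrightarrow>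
       cmod (dist_of U f \<phi>) \<le> C * (\<Sum>i\<le>N. \<Sum>j\<le>N. SUP p. cmod ((pd_x ^^ i) ((pd_y ^^ j) \<phi>) p))"
    if K: "compact K" "K \<subseteq> U" for K
  proof (intro exI ballI impI)
    fix \<phi> assume \<phi>: "\<phi> \<in> test_functions U" and sub: "supp \<phi> \<subseteq> K"
    have iK: "integrable lebesgue (\<lambda>p. indicat_real K p *\<^sub>R f p)"
      using f K by (simp add: locally_integrable_def set_integrable_def)
    obtain M where M: "\<And>q. q \<in> supp \<phi> \<Longrightarrow> norm (\<phi> q) \<le> M" "M \<ge> 0"
      using compact_bound[OF test_functionD(2)[OF \<phi>] continuous_on_subset[OF smooth_D(4)[OF test_functionD(1)[OF \<phi>]]]] by blast
    \<comment> \<open>A real supremum dominates the values only if they are bounded above, which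
      compact support and continuity ensure.\<close>
    have bdd: "bdd_above (range (\<lambda>p. cmod (\<phi> p)))"
    proof (rule bdd_aboveI2)
      show "cmod (\<phi> p) \<le> M" for p using M zero_off_supp[of p \<phi>] by (cases "p \<in> supp \<phi>") auto
    qed
    define s where "s = (SUP p. cmod (\<phi> p))"
    have s: "cmod (\<phi> p) \<le> s" for p unfolding s_def by (rule cSUP_upper[OF _ bdd]) simp
    have "cmod (dist_of U f \<phi>) \<le> (LINT p|lebesgue. norm (indicat_real U p *\<^sub>R (f p * \<phi> p)))"
      unfolding dist_of_def set_lebesgue_integral_def by (rule integral_norm_bound)
    also have "\<dots> \<le> (LINT p|lebesgue. s * norm (indicat_real K p *\<^sub>R f p))"
    proof (rule integral_mono)
      show "integrable lebesgue (\<lambda>p. norm (indicat_real U p *\<^sub>R (f p * \<phi> p)))"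
        using i[OF \<phi>] unfolding set_integrable_def by (rule integrable_norm)
      show "integrable lebesgue (\<lambda>p. s * norm (indicat_real K p *\<^sub>R f p))"
        by (rule integrable_mult_right[OF integrable_norm[OF iK]])
      show "norm (indicat_real U p *\<^sub>R (f p * \<phi> p)) \<le> s * norm (indicat_real K p *\<^sub>R f p)" for p
      proof (cases "p \<in> K")
        case True
        then show ?thesis using K(2) mult_left_mono[OF s, of "cmod (f p)" p] by (auto simp: norm_mult mult.commute)
      next
        case False
        then have "\<phi> p = 0" using sub zero_off_supp by blast
        then show ?thesis using False by simp
      qed
    qed
    also have "\<dots> = (LINT p|lebesgue. norm (indicat_real K p *\<^sub>R f p)) * (\<Sum>i\<le>0. \<Sum>j\<le>0. SUP p. cmod ((pd_x ^^ i) ((pd_y ^^ j) \<phi>) p))"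
      by (simp add: s_def del: norm_scaleR)
    finally show "cmod (dist_of U f \<phi>) \<le> (LINT p|lebesgue. norm (indicat_real K p *\<^sub>R f p)) *
      (\<Sum>i\<le>0. \<Sum>j\<le>0. SUP p. cmod ((pd_x ^^ i) ((pd_y ^^ j) \<phi>) p))" .
  qed
  then show ?thesis unfolding is_distribution_def using add scale by blast
qed

lemma test_functions_pd:
  assumes "\<phi> \<in> test_functions U"
  shows "pd_x \<phi> \<in> test_functions U" "pd_y \<phi> \<in> test_functions U"
proof -
  note D = test_functionD[OF assms]
  have "compact (supp \<phi> \<inter> supp (pd_x \<phi>))" "compact (supp \<phi> \<inter> supp (pd_y \<phi>))"
    by (intro compact_Int_closed D closed_supp)+
  moreover have "supp \<phi> \<inter> supp (pd_x \<phi>) = supp (pd_x \<phi>)" "supp \<phi> \<inter> supp (pd_y \<phi>) = supp (pd_y \<phi>)"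
    using supp_pd[of \<phi>] by blast+
  ultimately show "pd_x \<phi> \<in> test_functions U" "pd_y \<phi> \<in> test_functions U"
    using smooth_D[OF D(1)] D(3) supp_pd[of \<phi>] by (auto simp: test_functions_def)
qed

lemma dist_of_add:
  assumes "set_integrable lebesgue U (\<lambda>p. f p * g p)" "set_integrable lebesgue U (\<lambda>p. f p * h p)"
  shows "dist_of U f (\<lambda>p. g p + h p) = dist_of U f g + dist_of U f h"
  using set_integral_add(2)[OF assms] by (simp add: dist_of_def distrib_left)

lemma dist_of_cong:
  assumes "\<And>p. p \<in> U \<Longrightarrow> g p = h p"
  shows "dist_of U f g = dist_of U f h"
  unfolding dist_of_def set_lebesgue_integral_def
  by (rule Bochner_Integration.integral_cong) (auto simp: indicator_def assms)

lemma set_integrable_coefficient: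
  assumes f: "locally_integrable half_plane f" and \<phi>: "\<phi> \<in> test_functions half_plane"
    and c: "continuous_on half_plane c"
  shows "set_integrable lebesgue half_plane (\<lambda>p. f p * (c p * \<phi> p))"
proof (rule set_integrable_mult_compact_support[OF f test_functionD(2,3)[OF \<phi>]])
  have "continuous_on half_plane \<phi>"
    using smooth_D(4)[OF test_functionD(1)[OF \<phi>]] continuous_on_subset by blast
  then show "continuous_on UNIV (\<lambda>p. c p * \<phi> p)"
    by (intro continuous_on_extend_zero[OF open_half_plane closed_supp[of \<phi>] test_functionD(3)[OF \<phi>]] continuous_on_mult c)
      (simp_all add: zero_off_supp[of _ \<phi>])
qed (simp add: zero_off_supp[of _ \<phi>])

lemma continuous_on_inverse_fst: "continuous_on half_plane (\<lambda>p. c / of_real (fst p) ^ k :: complex)"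
  by (intro continuous_intros) (auto simp: half_plane_iff)

section \<open>Transposing the operators onto test functions\<close>

lemma weinstein_adjoint_dist_of:
  assumes f: "locally_integrable half_plane f" and \<phi>: "\<phi> \<in> test_functions half_plane"
  shows "weinstein_adjoint m (dist_of half_plane f) \<phi> =
    dist_of half_plane f (\<lambda>q. pd_x (pd_x \<phi>) q + pd_y (pd_y \<phi>) q + m / of_real (fst q) * pd_x \<phi> q)"
proof -
  note x = test_functions_pd(1)[OF \<phi>] and y = test_functions_pd(2)[OF \<phi>]
  have i: "set_integrable lebesgue half_plane (\<lambda>p. f p * g p)" if "g \<in> test_functions half_plane" for g
    using set_integrable_coefficient[OF f that, of "\<lambda>_. 1"] by simp
  have ia: "set_integrable lebesgue half_plane (\<lambda>p. f p * (m / of_real (fst p) * pd_x \<phi> p))"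
    using set_integrable_coefficient[OF f x continuous_on_inverse_fst[of m 1]] by simp
  have ixy: "set_integrable lebesgue half_plane (\<lambda>p. f p * (pd_x (pd_x \<phi>) p + pd_y (pd_y \<phi>) p))"
    using set_integral_add(1)[OF i[OF test_functions_pd(1)[OF x]] i[OF test_functions_pd(2)[OF y]]] by (simp add: distrib_left)
  \<comment> \<open>Two signs cancel in each second derivative, and in the first-order term the sign
    of \<open>dist_x\<close> cancels the minus sign of the adjoint.\<close>
  have "weinstein_adjoint m (dist_of half_plane f) \<phi> =
      dist_of half_plane f (pd_x (pd_x \<phi>)) + dist_of half_plane f (pd_y (pd_y \<phi>)) +
      dist_of half_plane f (\<lambda>q. m / of_real (fst q) * pd_x \<phi> q)"
    by (simp add: weinstein_adjoint_def dist_laplacian_def dist_x_def dist_y_def dist_mult_def case_prod_beta)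
  also have "\<dots> = dist_of half_plane f (\<lambda>q. pd_x (pd_x \<phi>) q + pd_y (pd_y \<phi>) q + m / of_real (fst q) * pd_x \<phi> q)"
    using dist_of_add[OF ixy ia] dist_of_add[OF i[OF test_functions_pd(1)[OF x]] i[OF test_functions_pd(2)[OF y]]] by simp
  finally show ?thesis .
qed

text \<open>Here the coefficient is applied outside the derivative, so m \<phi> / \<xi> itself gets
  differentiated and a zeroth-order term appears. The product rule is used on the half plane only,
  which is all that the integral sees.\<close>

lemma weinstein_dist_of:
  assumes f: "locally_integrable half_plane f" and \<phi>: "\<phi> \<in> test_functions half_plane"
  shows "weinstein m (dist_of half_plane f) \<phi> =
    dist_of half_plane f (\<lambda>q. pd_x (pd_x \<phi>) q + pd_y (pd_y \<phi>) q - m / of_real (fst q) * pd_x \<phi> q + m / (of_real (fst q))\<^sup>2 * \<phi> q)"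
proof -
  note x = test_functions_pd(1)[OF \<phi>] and y = test_functions_pd(2)[OF \<phi>]
  have i: "set_integrable lebesgue half_plane (\<lambda>p. f p * g p)" if "g \<in> test_functions half_plane" for g
    using set_integrable_coefficient[OF f that, of "\<lambda>_. 1"] by simp
  have ia: "set_integrable lebesgue half_plane (\<lambda>p. f p * (- m / of_real (fst p) * pd_x \<phi> p))"
    using set_integrable_coefficient[OF f x continuous_on_inverse_fst[of "- m" 1]] by simp
  have ib: "set_integrable lebesgue half_plane (\<lambda>p. f p * (m / (of_real (fst p))\<^sup>2 * \<phi> p))"
    by (rule set_integrable_coefficient[OF f \<phi> continuous_on_inverse_fst[of m 2]])
  have ixy: "set_integrable lebesgue half_plane (\<lambda>p. f p * (pd_x (pd_x \<phi>) p + pd_y (pd_y \<phi>) p))"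
    using set_integral_add(1)[OF i[OF test_functions_pd(1)[OF x]] i[OF test_functions_pd(2)[OF y]]] by (simp add: distrib_left)
  have iab: "set_integrable lebesgue half_plane (\<lambda>p. f p * (- m / of_real (fst p) * pd_x \<phi> p + m / (of_real (fst p))\<^sup>2 * \<phi> p))"
    using set_integral_add(1)[OF ia ib] by (simp only: distrib_left)
  have pd: "pd_x (\<lambda>p. (case p of (x, y) \<Rightarrow> m / of_real x) * \<phi> p) q = - (- m / of_real (fst q) * pd_x \<phi> q + m / (of_real (fst q))\<^sup>2 * \<phi> q)"
    if q: "q \<in> half_plane" for q
  proof -
    have qp: "fst q > 0" using q by (simp add: half_plane_iff)
    have "((\<lambda>t::real. 1 / t) has_real_derivative - (1 / (fst q)\<^sup>2)) (at (fst q))"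
      using qp by (auto intro!: derivative_eq_intros simp: power2_eq_square)
    then have "((\<lambda>t::real. complex_of_real (1 / t)) has_vector_derivative of_real (- (1 / (fst q)\<^sup>2))) (at (fst q))"
      by (intro has_vector_derivative_of_real) (simp add: has_real_derivative_iff_has_vector_derivative)
    note H = has_vector_derivative_mult[OF has_vector_derivative_mult_right[OF this, of m]
        smooth_has_vector_derivative(1)[OF test_functionD(1)[OF \<phi>], of q]]
    have "((\<lambda>t. m / of_real t * \<phi> (t, snd q)) has_vector_derivative
        - (- m / of_real (fst q) * pd_x \<phi> q + m / (of_real (fst q))\<^sup>2 * \<phi> q)) (at (fst q))"
      using H by (simp add: algebra_simps)
    then show ?thesis by (simp add: pd_x_def vector_derivative_at)
  qed
  have "dist_of half_plane f (pd_x (\<lambda>p. (case p of (x, y) \<Rightarrow> m / of_real x) * \<phi> p)) =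
      dist_of half_plane f (\<lambda>q. - (- m / of_real (fst q) * pd_x \<phi> q + m / (of_real (fst q))\<^sup>2 * \<phi> q))"
    by (rule dist_of_cong) (rule pd)
  also have "\<dots> = - dist_of half_plane f (\<lambda>q. - m / of_real (fst q) * pd_x \<phi> q + m / (of_real (fst q))\<^sup>2 * \<phi> q)"
    unfolding dist_of_def set_lebesgue_integral_def mult_minus_right scaleR_minus_right by simp
  finally have "weinstein m (dist_of half_plane f) \<phi> =
      dist_of half_plane f (pd_x (pd_x \<phi>)) + dist_of half_plane f (pd_y (pd_y \<phi>)) +
      dist_of half_plane f (\<lambda>q. - m / of_real (fst q) * pd_x \<phi> q + m / (of_real (fst q))\<^sup>2 * \<phi> q)"
    by (simp add: weinstein_def dist_laplacian_def dist_x_def dist_y_def dist_mult_def)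
  also have "\<dots> = dist_of half_plane f (\<lambda>q. (pd_x (pd_x \<phi>) q + pd_y (pd_y \<phi>) q) + (- m / of_real (fst q) * pd_x \<phi> q + m / (of_real (fst q))\<^sup>2 * \<phi> q))"
    using dist_of_add[OF ixy iab] dist_of_add[OF i[OF test_functions_pd(1)[OF x]] i[OF test_functions_pd(2)[OF y]]] by simp
  finally show ?thesis by (simp add: algebra_simps)
qed

text \<open>Common core of all four cases: the operator enters only through its transpose on test
  functions, and c normalises the factor -2 pi a^s of the weak form to 1. The function f is
  prescribed off the pole only, a null set.\<close>

lemma fundamental_solution_green:
  assumes n: "Re n \<ge> 1" and a: "a > 0"
    and f: "\<And>q. q \<in> half_plane \<Longrightarrow> q \<noteq> (a, b) \<Longrightarrow> f q = c * (cpow (fst q) (n + s) * green n a b q)"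
    and c: "c * (- 2 * of_real pi * cpow a s) = 1"
    and L: "\<And>\<phi>. locally_integrable half_plane f \<Longrightarrow> \<phi> \<in> test_functions half_plane \<Longrightarrow>
      L (dist_of half_plane f) \<phi> = dist_of half_plane f (weinstein_conjugate n s \<phi>)"
  shows "fundamental_solution_fun half_plane L (a, b) f"
proof -
  have loc: "locally_integrable half_plane f"
    unfolding locally_integrable_def
  proof (intro allI impI)
    fix K assume K: "compact K \<and> K \<subseteq> half_plane"
    \<comment> \<open>Cutting the weight off at K makes it bounded and zero off K, the form in which
      Fubini for the kernel is available.\<close>
    define h where "h q = indicator K q * cpow (fst q) (n + s)" for q
    have hm: "h \<in> borel_measurable borel"
      unfolding h_def using K
      by (intro borel_measurable_times cpow_measurable borel_measurable_indicator borel_measurable_continuous_onI continuous_intros)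
        (simp add: borel_compact)
    have "continuous_on K (\<lambda>q. cpow (fst q) (n + s))"
      using K by (intro continuous_intros) (auto simp: half_plane_iff)
    then obtain M where "\<And>q. q \<in> K \<Longrightarrow> norm (cpow (fst q) (n + s)) \<le> M"
      using compact_bound K by metis
    then have M: "norm (h q) \<le> M" if "q \<in> K" for q using that by (simp add: h_def)
    have "integrable lborel (\<lambda>q. h q * green n a b q)"
      by (rule green_fubini(1)[OF n a _ _ hm M]) (use K in \<open>auto simp: h_def\<close>)
    then have "integrable lborel (\<lambda>q. c * (h q * green n a b q))" by (rule integrable_mult_right)
    then have "integrable lebesgue (\<lambda>q. c * (h q * green n a b q))"
      using integrable_completion[OF borel_measurable_integrable] by blast
    moreover have "c * (h q * green n a b q) = indicat_real K q *\<^sub>R (c * (cpow (fst q) (n + s) * green n a b q))" for q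
      by (simp add: h_def indicator_def)
    ultimately have "(\<lambda>q. c * (cpow (fst q) (n + s) * green n a b q)) absolutely_integrable_on K"
      by (simp add: set_integrable_def)
    then show "f absolutely_integrable_on K"
      by (rule absolutely_integrable_spike[of _ _ "{(a, b)}"]) (use f K in auto)
  qed
  have "L (dist_of half_plane f) \<phi> = dirac (a, b) \<phi>" if \<phi>: "\<phi> \<in> test_functions half_plane" for \<phi>
  proof -
    note D = test_functionD[OF \<phi>]
    let ?w = "weinstein_conjugate n s \<phi>"
    define h where "h q = cpow (fst q) (n + s) * ?w q" for q
    have ct: "continuous_on A \<phi>" "continuous_on A (pd_x \<phi>)" "continuous_on A (pd_x (pd_x \<phi>))" "continuous_on A (pd_y (pd_y \<phi>))" for A
      using smooth_D(4)[OF D(1)] smooth_D(4)[OF smooth_D(2)[OF D(1)]]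
        smooth_D(4)[OF smooth_D(2)[OF smooth_D(2)[OF D(1)]]] smooth_D(4)[OF smooth_D(3)[OF smooth_D(3)[OF D(1)]]]
      by (auto intro: continuous_on_subset)
    have wz: "?w q = 0" if "q \<notin> supp \<phi>" for q
    proof -
      have "q \<notin> supp (pd_x \<phi>)" "q \<notin> supp (pd_y \<phi>)" using that supp_pd by blast+
      then show ?thesis using that
        by (simp add: weinstein_conjugate_def zero_off_supp[OF that] pd_zero_off_supp)
    qed
    have wc: "continuous_on half_plane ?w"
      unfolding weinstein_conjugate_def
      by (intro continuous_intros ct) (auto simp: half_plane_iff)
    have hc: "continuous_on half_plane h"
      unfolding h_def by (intro continuous_intros wc) (auto simp: half_plane_iff)
    have hz: "h q = 0" if "q \<notin> supp \<phi>" for q using wz[OF that] by (simp add: h_def)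
    have hm: "h \<in> borel_measurable borel"
      by (intro borel_measurable_continuous_onI continuous_on_extend_zero[OF open_half_plane closed_supp D(3) hc hz])
    obtain M where M: "\<And>q. q \<in> supp \<phi> \<Longrightarrow> norm (h q) \<le> M"
      using compact_bound[OF D(2) continuous_on_subset[OF hc D(3)]] by blast
    have i: "integrable lborel (\<lambda>q. h q * green n a b q)"
      by (rule green_fubini(1)[OF n a D(2,3) hm M hz])
    have si: "set_integrable lebesgue half_plane (\<lambda>q. f q * ?w q)"
      by (rule set_integrable_mult_compact_support[OF loc D(2,3) continuous_on_extend_zero[OF open_half_plane closed_supp D(3) wc wz] wz])
    have "dist_of half_plane f ?w = (LINT q|lebesgue. c * (h q * green n a b q))"
      unfolding dist_of_def set_lebesgue_integral_def
    proof (rule integral_cong_AE)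
      show "(\<lambda>q. indicat_real half_plane q *\<^sub>R (f q * ?w q)) \<in> borel_measurable lebesgue"
        using si unfolding set_integrable_def by (rule borel_measurable_integrable)
      have "integrable lborel (\<lambda>q. c * (h q * green n a b q))" using i by (rule integrable_mult_right)
      then show "(\<lambda>q. c * (h q * green n a b q)) \<in> borel_measurable lebesgue"
        by (intro measurable_completion borel_measurable_integrable)
      show "AE q in lebesgue. indicat_real half_plane q *\<^sub>R (f q * ?w q) = c * (h q * green n a b q)"
      proof (rule AE_I'[of "{(a, b)}"])
        show "{(a, b)} \<in> null_sets lebesgue" by (simp flip: negligible_iff_null_sets)
        have "indicat_real half_plane q *\<^sub>R (f q * ?w q) = c * (h q * green n a b q)" if "q \<noteq> (a, b)" for q
        proof (cases "q \<in> half_plane")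
          case True
          then show ?thesis using f[OF True that] by (simp add: h_def)
        next
          case False
          then have "q \<notin> supp \<phi>" using D(3) by blast
          then show ?thesis using False by (simp add: hz)
        qed
        then show "{q \<in> space lebesgue. indicat_real half_plane q *\<^sub>R (f q * ?w q) \<noteq> c * (h q * green n a b q)} \<subseteq> {(a, b)}"
          by blast
      qed
    qed
    also have "\<dots> = (LINT q|lborel. c * (h q * green n a b q))"
      by (rule integral_completion) (use borel_measurable_integrable[OF i] in simp)
    also have "\<dots> = c * (- 2 * of_real pi * (cpow a s * \<phi> (a, b)))"
      using green_weak_form[OF n a \<phi>, of s b] by (simp add: h_def)
    also have "\<dots> = (c * (- 2 * of_real pi * cpow a s)) * \<phi> (a, b)" by (simp only: mult_ac)
    also have "\<dots> = dirac (a, b) \<phi>" unfolding c by (simp add: dirac_def)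
    finally show ?thesis using L[OF loc \<phi>] by simp
  qed
  then show ?thesis
    using loc locally_integrable_is_distribution[OF loc]
    by (simp add: fundamental_solution_fun_def fundamental_solution_def dist_eq_def)
qed

section \<open>Symmetry of the angular integral and its relation to \<open>E\<close>\<close>

lemma bracket_sym: "bracket x y \<xi> \<eta> \<theta> = bracket \<xi> \<eta> x y \<theta>"
  by (simp add: bracket_def power2_commute[of x] power2_commute[of y] mult_ac)

text \<open>It exchanges pole and variable, so that the statement in (x, y) is covered by the same
  core as the one in (\<xi>, \<eta>).\<close>

lemma green_sym: "green n x y (\<xi>, \<eta>) = green n \<xi> \<eta> (x, y)"
  by (simp add: green_def bracket_sym[of x])

text \<open>Away from the pole the bracket is positive for all \<theta>, so the integrand is
  absolutely integrable and its gauge and Lebesgue integrals agree.\<close>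

lemma E_ge1_green:
  assumes n: "Re n \<ge> 1" and p: "x > 0" "\<xi> > 0" "(\<xi>, \<eta>) \<noteq> (x, y)"
  shows "E_ge1 n x y \<xi> \<eta> = - (cpow \<xi> n / (2 * of_real pi)) * green n x y (\<xi>, \<eta>)"
proof -
  have b: "bracket x y \<xi> \<eta> \<theta> > 0" for \<theta>
  proof -
    have "(x - \<xi>)\<^sup>2 + (y - \<eta>)\<^sup>2 > 0" using p by (auto simp: sum_power2_gt_zero_iff)
    moreover have "4 * x * \<xi> * (sin (\<theta> / 2))\<^sup>2 \<ge> 0" using p by simp
    ultimately show ?thesis unfolding bracket_def by linarith
  qed
  define W where "W \<theta> = cpow (sin \<theta>) (n - 1) * cpow (bracket x y \<xi> \<eta> \<theta>) (- n / 2)" for \<theta>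
  have c: "continuous_on A (\<lambda>\<theta>. cpow (bracket x y \<xi> \<eta> \<theta>) (- n / 2))" for A
    by (intro continuous_on_cpow b) (auto simp: bracket_def intro!: continuous_intros)
  have si: "set_integrable lborel {0..pi} W"
    unfolding W_def by (rule set_integrable_sin_powr[OF n c])
  have "integral {0..pi} (\<lambda>\<theta>. of_real (sin \<theta>) powr (n - 1) / of_real (bracket x y \<xi> \<eta> \<theta>) powr (n / 2)) = integral {0..pi} W"
  proof (rule integral_cong)
    fix \<theta> assume "\<theta> \<in> {0..pi}"
    then have "sin \<theta> \<ge> 0" by (auto intro: sin_ge_zero)
    then show "of_real (sin \<theta>) powr (n - 1) / of_real (bracket x y \<xi> \<eta> \<theta>) powr (n / 2) = W \<theta>"
      using b[of \<theta>] cpow_minus[OF b[of \<theta>], of "n / 2"] by (simp add: W_def of_real_powr_eq_cpow)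
  qed
  also have "\<dots> = (LBINT \<theta>:{0..pi}. W \<theta>)" using set_borel_integral_eq_integral(2)[OF si] by simp
  also have "\<dots> = green n x y (\<xi>, \<eta>)"
    unfolding set_lebesgue_integral_def green_def
    by (rule Bochner_Integration.integral_cong) (auto simp: sin_weight_def W_def indicator_def)
  finally show ?thesis using p by (simp add: E_ge1_def of_real_powr_eq_cpow)
qed

theorem theorem4p4:
  fixes m :: complex
  shows
    "(Re m < 1 \<longrightarrow>
        (\<forall>x y \<xi> \<eta>. (x, y) \<in> half_plane \<and> (\<xi>, \<eta>) \<in> half_plane \<and> (x, y) \<noteq> (\<xi>, \<eta>) \<longrightarrow>
          E m x y \<xi> \<eta> =
            - (of_real \<xi> * of_real x powr (1 - m) / (2 * of_real pi)) *
              integral {0..pi} (\<lambda>\<theta>. of_real (sin \<theta>) powr (1 - m) /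
                 of_real ((x - \<xi>)\<^sup>2 + 4 * x * \<xi> * (sin (\<theta> / 2))\<^sup>2 + (y - \<eta>)\<^sup>2) powr (1 - m / 2))))
     \<and> (\<forall>x y. (x, y) \<in> half_plane \<longrightarrow>
          fundamental_solution_fun half_plane (weinstein_adjoint m) (x, y)
            (\<lambda>(\<xi>, \<eta>). E m x y \<xi> \<eta>))
     \<and> (\<forall>\<xi> \<eta>. (\<xi>, \<eta>) \<in> half_plane \<longrightarrow>
          fundamental_solution_fun half_plane (weinstein m) (\<xi>, \<eta>)
            (\<lambda>(x, y). E m x y \<xi> \<eta>))"
proof (intro conjI impI allI)
  \<comment> \<open>The exponents m - 1 and 2 - m of \<xi> add up to 1, which yields the second
    formula for \<open>E\<close>.\<close>
  have prefactor: "cpow (\<xi> / x) (m - 1) * cpow \<xi> (2 - m) = of_real \<xi> * cpow x (1 - m)"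
    if "x > 0" "\<xi> > 0" for x \<xi>
  proof -
    have "cpow (\<xi> / x) (m - 1) = cpow \<xi> (m - 1) * cpow (1 / x) (m - 1)"
      using that cpow_mult[of \<xi> "1 / x" "m - 1"] by simp
    also have "cpow (1 / x) (m - 1) = cpow x (1 - m)" using that by (simp add: cpow_inverse)
    finally have "cpow (\<xi> / x) (m - 1) * cpow \<xi> (2 - m) = cpow \<xi> ((m - 1) + (2 - m)) * cpow x (1 - m)"
      unfolding cpow_add by (simp only: mult_ac)
    then show ?thesis using that by (simp add: cpow_1)
  qed
  show "E m x y \<xi> \<eta> =
            - (of_real \<xi> * of_real x powr (1 - m) / (2 * of_real pi)) *
              integral {0..pi} (\<lambda>\<theta>. of_real (sin \<theta>) powr (1 - m) /
                 of_real ((x - \<xi>)\<^sup>2 + 4 * x * \<xi> * (sin (\<theta> / 2))\<^sup>2 + (y - \<eta>)\<^sup>2) powr (1 - m / 2))"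
    if m: "Re m < 1" and H: "(x, y) \<in> half_plane \<and> (\<xi>, \<eta>) \<in> half_plane \<and> (x, y) \<noteq> (\<xi>, \<eta>)" for x y \<xi> \<eta>
  proof -
    have p: "x > 0" "\<xi> > 0" using H by (auto simp: half_plane_iff)
    have e: "2 - m - 1 = 1 - m" "(2 - m) / 2 = 1 - m / 2" by (simp_all add: diff_divide_distrib)
    show ?thesis
      using m prefactor[OF p] p
      by (simp add: E_def E_ge1_def e bracket_def of_real_powr_eq_cpow del: of_real_divide)
  qed
  have Ege: "E m x y \<xi> \<eta> = - (cpow \<xi> m / (2 * of_real pi)) * green m x y (\<xi>, \<eta>)"
    if "Re m \<ge> 1" "x > 0" "\<xi> > 0" "(\<xi>, \<eta>) \<noteq> (x, y)" for x y \<xi> \<eta>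
    using that by (simp add: E_def E_ge1_green)
  have Elt: "E m x y \<xi> \<eta> = - (of_real \<xi> * cpow x (1 - m) / (2 * of_real pi)) * green (2 - m) x y (\<xi>, \<eta>)"
    if "Re m < 1" "x > 0" "\<xi> > 0" "(\<xi>, \<eta>) \<noteq> (x, y)" for x y \<xi> \<eta>
    using that prefactor[of x \<xi>]
    by (simp add: E_def E_ge1_green of_real_powr_eq_cpow del: of_real_divide)
  show "fundamental_solution_fun half_plane (weinstein_adjoint m) (x, y) (\<lambda>(\<xi>, \<eta>). E m x y \<xi> \<eta>)"
    if "(x, y) \<in> half_plane" for x y
  proof -
    have x: "x > 0" using that by (simp add: half_plane_iff)
    show ?thesis
    proof (cases "Re m \<ge> 1")
      case True
      show ?thesis
      \<comment> \<open>The transpose of the adjoint has coefficients m/\<xi> and 0, so 2 s + n = m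
        and s (s + n - 1) = 0 are required. The solutions are s = 0, n = m and s = 1 - n, n = 2 - m;
        Re n \<ge> 1 decides which one to take.\<close>
      proof (rule fundamental_solution_green[OF True x, where s=0 and c="- 1 / (2 * of_real pi)"])
        show "(case q of (\<xi>, \<eta>) \<Rightarrow> E m x y \<xi> \<eta>) = - 1 / (2 * of_real pi) * (cpow (fst q) (m + 0) * green m x y q)"
          if "q \<in> half_plane" "q \<noteq> (x, y)" for q
          using that Ege[OF True x, of "fst q" "snd q" y] by (cases q) (simp add: half_plane_iff)
        show "- 1 / (2 * of_real pi) * (- 2 * of_real pi * cpow x 0) = (1::complex)" using x by simp
      qed (simp add: weinstein_adjoint_dist_of weinstein_conjugate_def[abs_def])
    next
      case False
      then have n: "Re (2 - m) \<ge> 1" by simp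
      show ?thesis
      \<comment> \<open>The second solution: the weight is \<xi>^(n+s) = \<xi>, and c collects the
        factors of \<open>E\<close> that depend on x alone.\<close>
      proof (rule fundamental_solution_green[OF n x, where s="m - 1" and c="- cpow x (1 - m) / (2 * of_real pi)"])
        show "(case q of (\<xi>, \<eta>) \<Rightarrow> E m x y \<xi> \<eta>) =
            - cpow x (1 - m) / (2 * of_real pi) * (cpow (fst q) (2 - m + (m - 1)) * green (2 - m) x y q)"
          if "q \<in> half_plane" "q \<noteq> (x, y)" for q
          using that False Elt[of x "fst q" "snd q" y] x by (cases q) (simp add: half_plane_iff cpow_1)
        show "- cpow x (1 - m) / (2 * of_real pi) * (- 2 * of_real pi * cpow x (m - 1)) = 1"
          using x cpow_add[of x "1 - m" "m - 1"] by simp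
      qed (simp add: weinstein_adjoint_dist_of weinstein_conjugate_def[abs_def])
    qed
  qed
  show "fundamental_solution_fun half_plane (weinstein m) (\<xi>, \<eta>) (\<lambda>(x, y). E m x y \<xi> \<eta>)"
    if "(\<xi>, \<eta>) \<in> half_plane" for \<xi> \<eta>
  proof -
    have \<xi>: "\<xi> > 0" using that by (simp add: half_plane_iff)
    show ?thesis
    proof (cases "Re m \<ge> 1")
      case True
      show ?thesis
      \<comment> \<open>The transpose of \<open>weinstein m\<close> has coefficients -m/x and m/x^2,
        so 2 s + n = -m and s (s + n - 1) = m. Eliminating n gives (s + 1) (s + m) = 0, and s = -m
        goes with n = m and the constant weight 1.\<close>
      proof (rule fundamental_solution_green[OF True \<xi>, where s="- m" and c="- cpow \<xi> m / (2 * of_real pi)"])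
        show "(case q of (x, y) \<Rightarrow> E m x y \<xi> \<eta>) = - cpow \<xi> m / (2 * of_real pi) * (cpow (fst q) (m + - m) * green m \<xi> \<eta> q)"
          if "q \<in> half_plane" "q \<noteq> (\<xi>, \<eta>)" for q
          using that Ege[OF True _ \<xi>, of "fst q" \<eta> "snd q"] green_sym[of m "fst q" "snd q" \<xi> \<eta>]
          by (cases q) (auto simp: half_plane_iff)
        show "- cpow \<xi> m / (2 * of_real pi) * (- 2 * of_real pi * cpow \<xi> (- m)) = 1"
          using \<xi> cpow_add[of \<xi> m "- m"] by simp
      qed (simp add: weinstein_dist_of weinstein_conjugate_def[abs_def])
    next
      case False
      then have n: "Re (2 - m) \<ge> 1" by simp
      show ?thesis
      \<comment> \<open>The other root s = -1 goes with n = 2 - m; the weight x^(n+s) = x^(1-m) is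
        exactly the power of x in \<open>E\<close>.\<close>
      proof (rule fundamental_solution_green[OF n \<xi>, where s="- 1" and c="- of_real \<xi> / (2 * of_real pi)"])
        show "(case q of (x, y) \<Rightarrow> E m x y \<xi> \<eta>) =
            - of_real \<xi> / (2 * of_real pi) * (cpow (fst q) (2 - m + - 1) * green (2 - m) \<xi> \<eta> q)"
          if "q \<in> half_plane" "q \<noteq> (\<xi>, \<eta>)" for q
          using that False Elt[of "fst q" \<xi> \<eta> "snd q"] \<xi> green_sym[of "2 - m" "fst q" "snd q" \<xi> \<eta>]
          by (cases q) (auto simp: half_plane_iff)
        show "- of_real \<xi> / (2 * of_real pi) * (- 2 * of_real pi * cpow \<xi> (- 1)) = (1::complex)"
          using \<xi> by (simp add: cpow_minus cpow_1)
      qed (simp add: weinstein_dist_of weinstein_conjugate_def[abs_def])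
    qed
  qed
qed

end
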